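(* Assume (A1)--(A4) and $L_s\ge\frac{\alpha^2}{\alpha_{\mathfrak b}}$. Then the alternate (splitting) Newton method converges linearly if $\tau$ is small enough. That is, there is $\tau_0>0$ (which may depend on the mesh and the data) such that whenever $\tau\le\tau_0$, for every time level $n\in\{1,\dots,N\}$ the iterates $(\mathbf u_h^{n,i},\mathbf q_h^{n,i},p_h^{n,i})_{i\ge 0}$ defined by the two-step scheme (S) with initial guess $(\mathbf u_h^{n,0},\mathbf q_h^{n,0},p_h^{n,0})=(\mathbf u_h^{n-1},\mathbf q_h^{n-1},p_h^{n-1})$ converge linearly, as $i\to\infty$, to the solution $(\mathbf u_h^n,\mathbf q_h^n,p_h^n)$ of the fully discrete problem (D). The problem (D), the scheme (S), the assumptions (A1)--(A4) and the meaning of linear convergence are given in the context.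
   Context: **Setting.** $\Omega\subset\mathbb R^d$, $d\in\{2,3\}$, is a bounded domain, $T>0$, $N\in\mathbb N$, $\tau=T/N$ is the time step and $t_n=n\tau$. $(\cdot,\cdot)$ and $\|\cdot\|$ are the inner product and norm of $L^2(\Omega)$ (scalar-, vector- or tensor-valued). $\varepsilon(\mathbf u)=\frac12(\nabla\mathbf u+(\nabla\mathbf u)^{\top})$. The data are the Biot constant $\alpha$, the body force $\rho_b\mathbf g$, the fluid gravity term $\rho_f\mathbf g$, the source $S_f$ (all given and sufficiently regular), a scalar function $k$ on $\Omega$ with mobility tensor $\mathbf K=k\mathbf I$, and nonlinear functions $\mathfrak b,\mathfrak c:\mathbb R\to\mathbb R$. $L_s\ge0$ is a stabilization parameter. **Assumptions.** (A1) $\mathfrak c$ and $\mathfrak b$ are differentiable, with $\mathfrak c'$ and $\mathfrak b'$ Lipschitz continuous. (A2) There is a constant $\alpha_{\mathfrak c}>0$ with $\mathfrak c'(\xi)>\alpha_{\mathfrak c}$ for all $\xi\in\mathbb R$. (A3) There is a constant $\alpha_{\mathfrak b}>0$ with $\mathfrak b'(\xi)>\alpha_{\mathfrak b}$ for all $\xi\in\mathbb R$. (A4) There are constants $k_m>0$ and $k_M$ with $k_m\le k(x)\le k_M$ for all $x\in\Omega$. **Discrete spaces.** $\mathcal T_h$ is a regular decomposition of $\Omega$ into $d$-simplices with mesh size $h$, and $\mathbf V_h=\{\mathbf v_h\in (H^1_0(\Omega))^d:\ \mathbf v_h|_K\in(\mathbb P_1)^d\ \forall K\in\mathcal T_h\}$,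 $W_h=\{w_h\in L^2(\Omega):\ w_h|_K\in\mathbb P_0\ \forall K\in\mathcal T_h\}$, $\mathbf Z_h=\{\mathbf z_h\in H(\mathrm{div};\Omega):\ \mathbf z_h|_K(x)=a+bx,\ a\in\mathbb R^d,\ b\in\mathbb R,\ \forall K\in\mathcal T_h\}$ (lowest order Raviart--Thomas), where $\mathbb P_0,\mathbb P_1$ are the constant and linear polynomials. **Fully discrete problem (D).** For $n\ge1$, given $(\mathbf u_h^{n-1},\mathbf q_h^{n-1},p_h^{n-1})$, find $(\mathbf u_h^{n},\mathbf q_h^{n},p_h^{n})\in\mathbf V_h\times\mathbf Z_h\times W_h$ such that for all $(\mathbf v_h,\mathbf z_h,w_h)\in\mathbf V_h\times\mathbf Z_h\times W_h$ $$(\varepsilon(\mathbf u_h^n),\varepsilon(\mathbf v_h))+(\mathfrak c(\nabla\cdot\mathbf u_h^n),\nabla\cdot\mathbf v_h)-\alpha(p_h^n,\nabla\cdot\mathbf v_h)=(\rho_b\mathbf g,\mathbf v_h),$$ $$(\mathbf K^{-1}\mathbf q_h^n,\mathbf z_h)-(p_h^n,\nabla\cdot\mathbf z_h)=(\rho_f\mathbf g,\mathbf z_h),$$ $$(\mathfrak b(p_h^n)-\mathfrak b(p_h^{n-1}),w_h)+\alpha(\nabla\cdot(\mathbf u_h^n-\mathbf u_h^{n-1}),w_h)+\tau(\nabla\cdot\mathbf q_h^n,w_h)=\tau(S_f,w_h).$$ The initial data at $n=0$ are compatible: $\mathbf u$ at $n=0$ is obtained from the pressure at $n=0$ by solving the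 mechanics equation, and the pressure by solving the flow equation. **Alternate splitting Newton scheme (S).** With $\delta(\cdot)^{n,i}=(\cdot)^{n,i}-(\cdot)^{n,i-1}$, for $i=1,2,\dots$, given $(\mathbf u_h^{n,i-1},\mathbf q_h^{n,i-1},p_h^{n,i-1})\in\mathbf V_h\times\mathbf Z_h\times W_h$: Step 1: find $(\mathbf q_h^{n,i},p_h^{n,i})\in\mathbf Z_h\times W_h$ such that for all $(\mathbf z_h,w_h)\in\mathbf Z_h\times W_h$ $$(\mathbf K^{-1}\mathbf q_h^{n,i},\mathbf z_h)-(p_h^{n,i},\nabla\cdot\mathbf z_h)=(\rho_f\mathbf g,\mathbf z_h),$$ $$(\mathfrak b(p_h^{n,i-1})+\mathfrak b'(p_h^{n,i-1})\delta p_h^{n,i}-\mathfrak b(p_h^{n-1}),w_h)+\tau(\nabla\cdot\mathbf q_h^{n,i},w_h)+\alpha(\nabla\cdot(\mathbf u_h^{n,i-1}-\mathbf u_h^{n-1}),w_h)=\tau(S_f,w_h).$$ Step 2: find $\mathbf u_h^{n,i}\in\mathbf V_h$ such that for all $\mathbf v_h\in\mathbf V_h$ $$(\varepsilon(\mathbf u_h^{n,i}),\varepsilon(\mathbf v_h))+(\mathfrak c(\nabla\cdot\mathbf u_h^{n,i-1})+\mathfrak c'(\nabla\cdot\mathbf u_h^{n,i-1})\nabla\cdot\delta\mathbf u_h^{n,i},\nabla\cdot\mathbf v_h)+(L_s\nabla\cdot\delta\mathbf u_h^{n,i},\nabla\cdot\mathbf v_h)-\alpha(p_h^{n,i},\nabla\cdot\mathbf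 v_h)=(\rho_b\mathbf g,\mathbf v_h).$$ **Linear convergence.** Put $e^{i}=(\mathbf u_h^{n,i}-\mathbf u_h^n,\ \mathbf q_h^{n,i}-\mathbf q_h^n,\ p_h^{n,i}-p_h^n)$. The iterates converge linearly if there are a norm $|\cdot|$ on the finite-dimensional space $\mathbf V_h\times\mathbf Z_h\times W_h$ and a constant $\theta\in(0,1)$, both independent of $i$, with $|e^i|\le\theta|e^{i-1}|$ for all $i\ge1$. *)

theory Defs
  imports "HOL-Analysis.Analysis"
begin

text \<open>Elements of \<open>L\<^sup>2\<close> are represented by functions on the whole space; only their values almost
  everywhere in \<open>\<Omega>\<close> matter. The inner product on the type \<open>real^'d^'d\<close> is the Frobenius product, so
  one definition covers scalar, vector and tensor fields.\<close>

definition L2 :: "(real^'d) set \<Rightarrow> (real^'d \<Rightarrow> 'b::euclidean_space) set" where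
  "L2 \<Omega> = {f \<in> borel_measurable (lebesgue_on \<Omega>). integrable (lebesgue_on \<Omega>) (\<lambda>x. (norm (f x))\<^sup>2)}"

definition l2_inner ::
    "(real^'d) set \<Rightarrow> (real^'d \<Rightarrow> 'b::euclidean_space) \<Rightarrow> (real^'d \<Rightarrow> 'b) \<Rightarrow> real" where
  "l2_inner \<Omega> f g = (LINT x|lebesgue_on \<Omega>. f x \<bullet> g x)"

definition l2_norm :: "(real^'d) set \<Rightarrow> (real^'d \<Rightarrow> 'b::euclidean_space) \<Rightarrow> real" where
  "l2_norm \<Omega> f = sqrt (l2_inner \<Omega> f f)"


definition grad :: "(real^'d \<Rightarrow> real) \<Rightarrow> real^'d \<Rightarrow> real^'d" where
  "grad f x = (\<chi> i. frechet_derivative f (at x) (axis i 1))"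

primrec Ck :: "nat \<Rightarrow> (real^'d \<Rightarrow> real) \<Rightarrow> bool" where
  "Ck 0 f \<longleftrightarrow> continuous_on UNIV f"
| "Ck (Suc m) f \<longleftrightarrow> (\<forall>x. f differentiable at x) \<and> (\<forall>i. Ck m (\<lambda>x. grad f x $ i))"

definition test_functions :: "(real^'d) set \<Rightarrow> (real^'d \<Rightarrow> real) set" where
  "test_functions \<Omega> =
     {\<phi>. (\<forall>m. Ck m \<phi>) \<and> compact (closure {x. \<phi> x \<noteq> 0}) \<and> closure {x. \<phi> x \<noteq> 0} \<subseteq> \<Omega>}"

definition has_weak_grad ::
    "(real^'d) set \<Rightarrow> (real^'d \<Rightarrow> real) \<Rightarrow> (real^'d \<Rightarrow> real^'d) \<Rightarrow> bool" where
  "has_weak_grad \<Omega> f G \<longleftrightarrow> G \<in> L2 \<Omega> \<and>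
     (\<forall>\<phi>\<in>test_functions \<Omega>. \<forall>i.
        (LINT x|lebesgue_on \<Omega>. f x * grad \<phi> x $ i) = - (LINT x|lebesgue_on \<Omega>. G x $ i * \<phi> x))"

definition has_weak_div ::
    "(real^'d) set \<Rightarrow> (real^'d \<Rightarrow> real^'d) \<Rightarrow> (real^'d \<Rightarrow> real) \<Rightarrow> bool" where
  "has_weak_div \<Omega> z w \<longleftrightarrow> w \<in> L2 \<Omega> \<and>
     (\<forall>\<phi>\<in>test_functions \<Omega>.
        (LINT x|lebesgue_on \<Omega>. z x \<bullet> grad \<phi> x) = - (LINT x|lebesgue_on \<Omega>. w x * \<phi> x))"

text \<open>Weak derivatives are unique only almost everywhere; these operators select a representative.\<close>

definition weak_grad :: "(real^'d) set \<Rightarrow> (real^'d \<Rightarrow> real) \<Rightarrow> real^'d \<Rightarrow> real^'d" where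
  "weak_grad \<Omega> f = (SOME G. has_weak_grad \<Omega> f G)"

definition weak_div :: "(real^'d) set \<Rightarrow> (real^'d \<Rightarrow> real^'d) \<Rightarrow> real^'d \<Rightarrow> real" where
  "weak_div \<Omega> z = (SOME w. has_weak_div \<Omega> z w)"

definition weak_jacobian :: "(real^'d) set \<Rightarrow> (real^'d \<Rightarrow> real^'d) \<Rightarrow> real^'d \<Rightarrow> real^'d^'d" where
  "weak_jacobian \<Omega> u x = (\<chi> i. weak_grad \<Omega> (\<lambda>y. u y $ i) x)"

definition strain :: "(real^'d) set \<Rightarrow> (real^'d \<Rightarrow> real^'d) \<Rightarrow> real^'d \<Rightarrow> real^'d^'d" where
  "strain \<Omega> u x = (1/2) *\<^sub>R (weak_jacobian \<Omega> u x + transpose (weak_jacobian \<Omega> u x))"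

definition H1 :: "(real^'d) set \<Rightarrow> (real^'d \<Rightarrow> real) set" where
  "H1 \<Omega> = {f \<in> L2 \<Omega>. \<exists>G. has_weak_grad \<Omega> f G}"

definition H1_0 :: "(real^'d) set \<Rightarrow> (real^'d \<Rightarrow> real) set" where
  "H1_0 \<Omega> = {f \<in> H1 \<Omega>. \<exists>\<phi>::nat \<Rightarrow> real^'d \<Rightarrow> real. (\<forall>m. \<phi> m \<in> test_functions \<Omega>) \<and>
      (\<lambda>m. l2_norm \<Omega> (\<lambda>x. \<phi> m x - f x)) \<longlonglongrightarrow> 0 \<and>
      (\<lambda>m. l2_norm \<Omega> (\<lambda>x. grad (\<phi> m) x - weak_grad \<Omega> f x)) \<longlonglongrightarrow> 0}"

definition H_div :: "(real^'d) set \<Rightarrow> (real^'d \<Rightarrow> real^'d) set" where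
  "H_div \<Omega> = {z \<in> L2 \<Omega>. \<exists>w. has_weak_div \<Omega> z w}"


text \<open>\<^const>\<open>triangulation\<close> says that the mesh is finite and that any two cells meet in a
  (possibly empty) common face. Simplices are closed and nondegenerate, so a single mesh is
  automatically shape regular.\<close>

definition simplicial_mesh :: "(real^'d) set \<Rightarrow> (real^'d) set set \<Rightarrow> bool" where
  "simplicial_mesh \<Omega> \<T> \<longleftrightarrow> triangulation \<T> \<and> (\<forall>K\<in>\<T>. int CARD('d) simplex K) \<and>
     \<Union>\<T> = closure \<Omega> \<and> (\<forall>K\<in>\<T>. interior K \<subseteq> \<Omega>)"

definition V_h :: "(real^'d) set \<Rightarrow> (real^'d) set set \<Rightarrow> (real^'d \<Rightarrow> real^'d) set" where
  "V_h \<Omega> \<T> = {v. (\<forall>i. (\<lambda>x. v x $ i) \<in> H1_0 \<Omega>) \<and>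
     (\<forall>K\<in>\<T>. \<exists>(A::real^'d^'d) a. AE x in lebesgue_on K. v x = a + A *v x)}"

definition W_h :: "(real^'d) set \<Rightarrow> (real^'d) set set \<Rightarrow> (real^'d \<Rightarrow> real) set" where
  "W_h \<Omega> \<T> = {w \<in> L2 \<Omega>. \<forall>K\<in>\<T>. \<exists>a. AE x in lebesgue_on K. w x = a}"

definition Z_h :: "(real^'d) set \<Rightarrow> (real^'d) set set \<Rightarrow> (real^'d \<Rightarrow> real^'d) set" where
  "Z_h \<Omega> \<T> = {z \<in> H_div \<Omega>. \<forall>K\<in>\<T>. \<exists>a b. AE x in lebesgue_on K. z x = a + b *\<^sub>R x}"


text \<open>\<open>fb\<close> and \<open>ff\<close> stand for the body force and the fluid gravity term (density times gravity).
  The mobility tensor is \<open>mat (k x)\<close>, i.e. \<open>k x\<close> times the identity matrix.\<close>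

definition mechanics_eq ::
    "(real^'d) set \<Rightarrow> (real^'d) set set \<Rightarrow> (real \<Rightarrow> real) \<Rightarrow> real \<Rightarrow> (real^'d \<Rightarrow> real^'d) \<Rightarrow>
     (real^'d \<Rightarrow> real^'d) \<Rightarrow> (real^'d \<Rightarrow> real) \<Rightarrow> bool" where
  "mechanics_eq \<Omega> \<T> \<cc> \<alpha> fb u p \<longleftrightarrow> (\<forall>v\<in>V_h \<Omega> \<T>.
     l2_inner \<Omega> (strain \<Omega> u) (strain \<Omega> v)
     + l2_inner \<Omega> (\<lambda>x. \<cc> (weak_div \<Omega> u x)) (weak_div \<Omega> v)
     - \<alpha> * l2_inner \<Omega> p (weak_div \<Omega> v)
     = l2_inner \<Omega> fb v)"

definition darcy_eq ::
    "(real^'d) set \<Rightarrow> (real^'d) set set \<Rightarrow> (real^'d \<Rightarrow> real) \<Rightarrow> (real^'d \<Rightarrow> real^'d) \<Rightarrow>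
     (real^'d \<Rightarrow> real^'d) \<Rightarrow> (real^'d \<Rightarrow> real) \<Rightarrow> bool" where
  "darcy_eq \<Omega> \<T> k ff q p \<longleftrightarrow> (\<forall>z\<in>Z_h \<Omega> \<T>.
     l2_inner \<Omega> (\<lambda>x. matrix_inv (mat (k x)) *v q x) z
     - l2_inner \<Omega> p (weak_div \<Omega> z)
     = l2_inner \<Omega> ff z)"

definition mass_balance_eq ::
    "(real^'d) set \<Rightarrow> (real^'d) set set \<Rightarrow> (real \<Rightarrow> real) \<Rightarrow> real \<Rightarrow> (real^'d \<Rightarrow> real) \<Rightarrow> real \<Rightarrow>
     (real^'d \<Rightarrow> real^'d) \<Rightarrow> (real^'d \<Rightarrow> real) \<Rightarrow>
     (real^'d \<Rightarrow> real^'d) \<Rightarrow> (real^'d \<Rightarrow> real^'d) \<Rightarrow> (real^'d \<Rightarrow> real) \<Rightarrow> bool" where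
  "mass_balance_eq \<Omega> \<T> \<bb> \<alpha> Sf \<tau> u' p' u q p \<longleftrightarrow> (\<forall>w\<in>W_h \<Omega> \<T>.
     l2_inner \<Omega> (\<lambda>x. \<bb> (p x) - \<bb> (p' x)) w
     + \<alpha> * l2_inner \<Omega> (weak_div \<Omega> (\<lambda>x. u x - u' x)) w
     + \<tau> * l2_inner \<Omega> (weak_div \<Omega> q) w
     = \<tau> * l2_inner \<Omega> Sf w)"

text \<open>The primed \<open>u'\<close> and \<open>p'\<close> are the values at the previous time level.\<close>

definition discrete_step ::
    "(real^'d) set \<Rightarrow> (real^'d) set set \<Rightarrow> (real \<Rightarrow> real) \<Rightarrow> (real \<Rightarrow> real) \<Rightarrow> (real^'d \<Rightarrow> real) \<Rightarrow>
     real \<Rightarrow> (real^'d \<Rightarrow> real^'d) \<Rightarrow> (real^'d \<Rightarrow> real^'d) \<Rightarrow> (real^'d \<Rightarrow> real) \<Rightarrow> real \<Rightarrow>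
     (real^'d \<Rightarrow> real^'d) \<Rightarrow> (real^'d \<Rightarrow> real) \<Rightarrow>
     (real^'d \<Rightarrow> real^'d) \<Rightarrow> (real^'d \<Rightarrow> real^'d) \<Rightarrow> (real^'d \<Rightarrow> real) \<Rightarrow> bool" where
  "discrete_step \<Omega> \<T> \<bb> \<cc> k \<alpha> fb ff Sf \<tau> u' p' u q p \<longleftrightarrow>
     u \<in> V_h \<Omega> \<T> \<and> q \<in> Z_h \<Omega> \<T> \<and> p \<in> W_h \<Omega> \<T> \<and>
     mechanics_eq \<Omega> \<T> \<cc> \<alpha> fb u p \<and>
     darcy_eq \<Omega> \<T> k ff q p \<and>
     mass_balance_eq \<Omega> \<T> \<bb> \<alpha> Sf \<tau> u' p' u q p"

text \<open>In one iteration of the splitting scheme, \<open>u'\<close>, \<open>p'\<close> are the values at the previous time level and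
  \<open>uit\<close>, \<open>pit\<close> those of the previous iterate; \<open>u\<close>, \<open>q\<close>, \<open>p\<close> is the new iterate.\<close>

definition newton_flow_step ::
    "(real^'d) set \<Rightarrow> (real^'d) set set \<Rightarrow> (real \<Rightarrow> real) \<Rightarrow> (real^'d \<Rightarrow> real) \<Rightarrow>
     real \<Rightarrow> (real^'d \<Rightarrow> real^'d) \<Rightarrow> (real^'d \<Rightarrow> real) \<Rightarrow> real \<Rightarrow>
     (real^'d \<Rightarrow> real^'d) \<Rightarrow> (real^'d \<Rightarrow> real) \<Rightarrow>
     (real^'d \<Rightarrow> real^'d) \<Rightarrow> (real^'d \<Rightarrow> real) \<Rightarrow>
     (real^'d \<Rightarrow> real^'d) \<Rightarrow> (real^'d \<Rightarrow> real) \<Rightarrow> bool" where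
  "newton_flow_step \<Omega> \<T> \<bb> k \<alpha> ff Sf \<tau> u' p' uit pit q p \<longleftrightarrow>
     q \<in> Z_h \<Omega> \<T> \<and> p \<in> W_h \<Omega> \<T> \<and>
     darcy_eq \<Omega> \<T> k ff q p \<and>
     (\<forall>w\<in>W_h \<Omega> \<T>.
        l2_inner \<Omega> (\<lambda>x. \<bb> (pit x) + deriv \<bb> (pit x) * (p x - pit x) - \<bb> (p' x)) w
        + \<tau> * l2_inner \<Omega> (weak_div \<Omega> q) w
        + \<alpha> * l2_inner \<Omega> (weak_div \<Omega> (\<lambda>x. uit x - u' x)) w
        = \<tau> * l2_inner \<Omega> Sf w)"

definition newton_mechanics_step ::
    "(real^'d) set \<Rightarrow> (real^'d) set set \<Rightarrow> (real \<Rightarrow> real) \<Rightarrow> real \<Rightarrow> real \<Rightarrow>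
     (real^'d \<Rightarrow> real^'d) \<Rightarrow> (real^'d \<Rightarrow> real^'d) \<Rightarrow>
     (real^'d \<Rightarrow> real^'d) \<Rightarrow> (real^'d \<Rightarrow> real) \<Rightarrow> bool" where
  "newton_mechanics_step \<Omega> \<T> \<cc> \<alpha> Ls fb uit u p \<longleftrightarrow>
     u \<in> V_h \<Omega> \<T> \<and>
     (\<forall>v\<in>V_h \<Omega> \<T>.
        l2_inner \<Omega> (strain \<Omega> u) (strain \<Omega> v)
        + l2_inner \<Omega>
            (\<lambda>x. \<cc> (weak_div \<Omega> uit x)
                 + deriv \<cc> (weak_div \<Omega> uit x) * weak_div \<Omega> (\<lambda>y. u y - uit y) x)
            (weak_div \<Omega> v)
        + l2_inner \<Omega> (\<lambda>x. Ls * weak_div \<Omega> (\<lambda>y. u y - uit y) x) (weak_div \<Omega> v)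
        - \<alpha> * l2_inner \<Omega> p (weak_div \<Omega> v)
        = l2_inner \<Omega> fb v)"

definition splitting_newton_iterates ::
    "(real^'d) set \<Rightarrow> (real^'d) set set \<Rightarrow> (real \<Rightarrow> real) \<Rightarrow> (real \<Rightarrow> real) \<Rightarrow> (real^'d \<Rightarrow> real) \<Rightarrow>
     real \<Rightarrow> real \<Rightarrow> (real^'d \<Rightarrow> real^'d) \<Rightarrow> (real^'d \<Rightarrow> real^'d) \<Rightarrow> (real^'d \<Rightarrow> real) \<Rightarrow> real \<Rightarrow>
     (real^'d \<Rightarrow> real^'d) \<Rightarrow> (real^'d \<Rightarrow> real^'d) \<Rightarrow> (real^'d \<Rightarrow> real) \<Rightarrow>
     (nat \<Rightarrow> real^'d \<Rightarrow> real^'d) \<Rightarrow> (nat \<Rightarrow> real^'d \<Rightarrow> real^'d) \<Rightarrow> (nat \<Rightarrow> real^'d \<Rightarrow> real) \<Rightarrow> bool" where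
  "splitting_newton_iterates \<Omega> \<T> \<bb> \<cc> k \<alpha> Ls fb ff Sf \<tau> u' q' p' uit qit pit \<longleftrightarrow>
     uit 0 = u' \<and> qit 0 = q' \<and> pit 0 = p' \<and>
     (\<forall>i\<ge>1. newton_flow_step \<Omega> \<T> \<bb> k \<alpha> ff Sf \<tau> u' p' (uit (i-1)) (pit (i-1)) (qit i) (pit i) \<and>
            newton_mechanics_step \<Omega> \<T> \<cc> \<alpha> Ls fb (uit (i-1)) (uit i) (pit i))"


text \<open>A norm on the product space, whose elements are classes of functions equal almost everywhere
  in \<open>\<Omega>\<close>. Together with the triangle inequality, the definiteness condition makes \<open>Nrm\<close>
  independent of representatives.\<close>

definition norm_on_discrete_space ::
    "(real^'d) set \<Rightarrow> (real^'d) set set \<Rightarrow>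
     ((real^'d \<Rightarrow> real^'d) \<Rightarrow> (real^'d \<Rightarrow> real^'d) \<Rightarrow> (real^'d \<Rightarrow> real) \<Rightarrow> real) \<Rightarrow> bool" where
  "norm_on_discrete_space \<Omega> \<T> Nrm \<longleftrightarrow>
     (\<forall>u\<in>V_h \<Omega> \<T>. \<forall>q\<in>Z_h \<Omega> \<T>. \<forall>p\<in>W_h \<Omega> \<T>.
        0 \<le> Nrm u q p \<and>
        (Nrm u q p = 0 \<longleftrightarrow>
           (AE x in lebesgue_on \<Omega>. u x = 0) \<and> (AE x in lebesgue_on \<Omega>. q x = 0) \<and>
           (AE x in lebesgue_on \<Omega>. p x = 0)) \<and>
        (\<forall>r. Nrm (\<lambda>x. r *\<^sub>R u x) (\<lambda>x. r *\<^sub>R q x) (\<lambda>x. r * p x) = \<bar>r\<bar> * Nrm u q p) \<and>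
        (\<forall>u'\<in>V_h \<Omega> \<T>. \<forall>q'\<in>Z_h \<Omega> \<T>. \<forall>p'\<in>W_h \<Omega> \<T>.
           Nrm (\<lambda>x. u x + u' x) (\<lambda>x. q x + q' x) (\<lambda>x. p x + p' x) \<le> Nrm u q p + Nrm u' q' p'))"

definition converges_linearly ::
    "(real^'d) set \<Rightarrow> (real^'d) set set \<Rightarrow>
     (nat \<Rightarrow> real^'d \<Rightarrow> real^'d) \<Rightarrow> (nat \<Rightarrow> real^'d \<Rightarrow> real^'d) \<Rightarrow> (nat \<Rightarrow> real^'d \<Rightarrow> real) \<Rightarrow>
     (real^'d \<Rightarrow> real^'d) \<Rightarrow> (real^'d \<Rightarrow> real^'d) \<Rightarrow> (real^'d \<Rightarrow> real) \<Rightarrow> bool" where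
  "converges_linearly \<Omega> \<T> uit qit pit u q p \<longleftrightarrow>
     (\<exists>Nrm \<theta>. norm_on_discrete_space \<Omega> \<T> Nrm \<and> 0 < \<theta> \<and> \<theta> < 1 \<and>
        (\<forall>i\<ge>1. Nrm (\<lambda>x. uit i x - u x) (\<lambda>x. qit i x - q x) (\<lambda>x. pit i x - p x)
          \<le> \<theta> * Nrm (\<lambda>x. uit (i-1) x - u x) (\<lambda>x. qit (i-1) x - q x) (\<lambda>x. pit (i-1) x - p x)))"

end

(*
  Error equations. Subtracting (D) from (S), the Newton linearizations leave remainders bounded by the
  Lipschitz constant times the square of the previous error, and the coupling terms combine to
  Ls (div e^i - div e^(i-1), div e^i) - alpha (e_p^i, div e^i - div e^(i-1)). Since Ls >= alpha^2 / alpha_b,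
  Young's inequality absorbs these, so that with
    E(u,q,p) = |eps(u)|^2 + tau |K^(-1/2) q|^2 + alpha_b/4 |p|^2 + (alpha_c + Ls)/2 |div u|^2
  one has E(e^i) <= kappa E(e^(i-1)), kappa = (Ls + alpha_c/2) / (Ls + alpha_c), as soon as e_p and div e_u are
  small in the sup norm. These two functions are piecewise constant, so the sup norm is controlled by E on
  the fixed mesh, and smallness propagates along the iteration.

  Starting value. Testing the difference of two consecutive time steps of (D) with the increments, and
  using (K^(-1) dq, q) = (|q|^2 - |q'|^2 + |dq|^2) / 2, gives a bound on |K^(-1/2) q^n| uniform in n and tau,
  and then E(e^0) <= C tau.

  sqrt E is a norm by Korn's first inequality: for u in H^1_0 with eps(u) = 0 the gradients satisfy
  (d_j u_i, d_i phi) = (d_i u_i, d_j phi) = 0, hence (grad u_j, grad phi) = 0 for all test functions phi.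
*)
theory Submission
  imports Defs
begin

section \<open>Square integrable functions\<close>

text \<open>The splitting prevents the usual cancellation: the flow step sees the old displacement
  and the mechanics step the new pressure, so a coupling term with the increment of div e survives.
  Half of \<open>\<alpha>\<^sub>b\<close> pays for it, and the pressure part of the energy lives on
  the other half. The strain and flux errors of the previous iterate never enter the estimate, so
  the energy may carry them freely. The smallness threshold uses only the pressure and divergence
  weights, which contain no \<open>\<tau>\<close>. It can therefore be fixed first and the step size
  afterwards; the weight \<open>\<tau>\<close> of the flux does no harm, because the norm only has
  to be independent of i. Two features of the encoding shape the rest. \<open>weak_grad\<close> and
  \<open>weak_div\<close> choose representatives, so linearity holds only almost everywhere and
  rests on uniqueness of weak derivatives, hence on a supply of smooth test functions. And the
  pressure and div u are piecewise constant, so all nonlinear expressions in them stay in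
  \<open>W_h\<close> and are square integrable, whatever the growth of \<open>\<bb>\<close> and
  \<open>\<cc>\<close>.\<close>

lemma L2_measurable: "f \<in> L2 \<Omega> \<Longrightarrow> f \<in> borel_measurable (lebesgue_on \<Omega>)"
  by (simp add: L2_def)

lemma L2_square_integrable: "f \<in> L2 \<Omega> \<Longrightarrow> integrable (lebesgue_on \<Omega>) (\<lambda>x. (norm (f x))\<^sup>2)"
  by (simp add: L2_def)

lemma L2_linear:
  assumes "bounded_linear T" "f \<in> L2 \<Omega>"
  shows "(\<lambda>x. T (f x)) \<in> L2 \<Omega>"
proof -
  obtain K where K: "\<And>x. norm (T x) \<le> norm x * K" "K > 0"
    using bounded_linear.pos_bounded[OF assms(1)] by blast
  have m: "(\<lambda>x. T (f x)) \<in> borel_measurable (lebesgue_on \<Omega>)"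
    using borel_measurable_continuous_on[OF linear_continuous_on[OF assms(1)] L2_measurable[OF assms(2)]] .
  have "integrable (lebesgue_on \<Omega>) (\<lambda>x. (norm (T (f x)))\<^sup>2)"
  proof (rule Bochner_Integration.integrable_bound)
    show "integrable (lebesgue_on \<Omega>) (\<lambda>x. K\<^sup>2 * (norm (f x))\<^sup>2)"
      using L2_square_integrable[OF assms(2)] by simp
    show "(\<lambda>x. (norm (T (f x)))\<^sup>2) \<in> borel_measurable (lebesgue_on \<Omega>)"
      using m by measurable
    have "(norm (T y))\<^sup>2 \<le> K\<^sup>2 * (norm y)\<^sup>2" for y
      using power_mono[OF K(1)[of y] norm_ge_zero, of 2] by (simp add: power_mult_distrib mult.commute)
    then show "AE x in lebesgue_on \<Omega>. norm ((norm (T (f x)))\<^sup>2) \<le> norm (K\<^sup>2 * (norm (f x))\<^sup>2)"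
      by simp
  qed
  with m show ?thesis by (simp add: L2_def)
qed

lemma L2_add:
  assumes "f \<in> L2 \<Omega>" "g \<in> L2 \<Omega>"
  shows "(\<lambda>x. f x + g x) \<in> L2 \<Omega>"
proof -
  have m: "(\<lambda>x. f x + g x) \<in> borel_measurable (lebesgue_on \<Omega>)"
    using assms[THEN L2_measurable] by measurable
  have "integrable (lebesgue_on \<Omega>) (\<lambda>x. (norm (f x + g x))\<^sup>2)"
  proof (rule Bochner_Integration.integrable_bound)
    show "integrable (lebesgue_on \<Omega>) (\<lambda>x. 2 * (norm (f x))\<^sup>2 + 2 * (norm (g x))\<^sup>2)"
      using assms[THEN L2_square_integrable] by simp
    show "(\<lambda>x. (norm (f x + g x))\<^sup>2) \<in> borel_measurable (lebesgue_on \<Omega>)"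
      using m by measurable
    have "(norm (a + b))\<^sup>2 \<le> 2 * (norm a)\<^sup>2 + 2 * (norm b)\<^sup>2" for a b :: 'b
    proof -
      have "(norm (a + b))\<^sup>2 \<le> (norm a + norm b)\<^sup>2"
        by (simp add: norm_triangle_ineq power_mono)
      also have "\<dots> \<le> 2 * (norm a)\<^sup>2 + 2 * (norm b)\<^sup>2"
        using zero_le_power2[of "norm a - norm b"] by (simp add: power2_sum power2_diff)
      finally show ?thesis .
    qed
    then show "AE x in lebesgue_on \<Omega>. norm ((norm (f x + g x))\<^sup>2)
        \<le> norm (2 * (norm (f x))\<^sup>2 + 2 * (norm (g x))\<^sup>2)"
      by simp
  qed
  with m show ?thesis by (simp add: L2_def)
qed

lemma L2_scaleR: "f \<in> L2 \<Omega> \<Longrightarrow> (\<lambda>x. r *\<^sub>R f x) \<in> L2 \<Omega>"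
  by (rule L2_linear[OF bounded_linear_scaleR_right])

lemma L2_cmult: "f \<in> L2 \<Omega> \<Longrightarrow> (\<lambda>x. r * f x :: real) \<in> L2 \<Omega>"
  using L2_scaleR[of f \<Omega> r] by simp

lemma L2_diff: "f \<in> L2 \<Omega> \<Longrightarrow> g \<in> L2 \<Omega> \<Longrightarrow> (\<lambda>x. f x - g x) \<in> L2 \<Omega>"
  using L2_add[of f \<Omega> "\<lambda>x. (-1) *\<^sub>R g x"] L2_scaleR[of g \<Omega> "-1"] by simp

lemma L2_zero: "(\<lambda>x. 0) \<in> L2 \<Omega>"
  by (simp add: L2_def)

lemma L2_sum: "(\<And>i. i \<in> I \<Longrightarrow> f i \<in> L2 \<Omega>) \<Longrightarrow> (\<lambda>x. \<Sum>i\<in>I. f i x) \<in> L2 \<Omega>"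
  by (induction I rule: infinite_finite_induct) (auto intro: L2_zero L2_add)

lemma L2_nth: "f \<in> L2 \<Omega> \<Longrightarrow> (\<lambda>x. f x $ i) \<in> L2 \<Omega>"
  by (rule L2_linear[OF bounded_linear_vec_nth])

lemma L2_vecI:
  fixes f :: "real^'d \<Rightarrow> 'b::euclidean_space ^ 'n"
  assumes "\<And>i. (\<lambda>x. f x $ i) \<in> L2 \<Omega>"
  shows "f \<in> L2 \<Omega>"
proof -
  have "bounded_linear (axis i :: 'b \<Rightarrow> 'b ^ 'n)" for i
    by (rule linear_conv_bounded_linear[THEN iffD1])
      (auto intro!: linearI simp: axis_def vec_eq_iff)
  then have "(\<lambda>x. \<Sum>i\<in>UNIV. axis i (f x $ i)) \<in> L2 \<Omega>"
    by (intro L2_sum L2_linear[where T = "axis _"] assms)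
  moreover have "(\<Sum>i\<in>UNIV. axis i (f x $ i)) = f x" for x
    by (simp add: vec_eq_iff axis_def if_distrib[where f = "\<lambda>v. v $ _"] cong: if_cong)
  ultimately show ?thesis by simp
qed

lemma L2_inner_integrable:
  assumes "f \<in> L2 \<Omega>" "g \<in> L2 \<Omega>"
  shows "integrable (lebesgue_on \<Omega>) (\<lambda>x. f x \<bullet> g x)"
proof (rule Bochner_Integration.integrable_bound)
  show "integrable (lebesgue_on \<Omega>) (\<lambda>x. (norm (f x))\<^sup>2 + (norm (g x))\<^sup>2)"
    using assms[THEN L2_square_integrable] by simp
  show "(\<lambda>x. f x \<bullet> g x) \<in> borel_measurable (lebesgue_on \<Omega>)"
    using assms[THEN L2_measurable] by measurable
  have "\<bar>a \<bullet> b\<bar> \<le> (norm a)\<^sup>2 + (norm b)\<^sup>2" for a b :: 'b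
  proof -
    have "\<bar>a \<bullet> b\<bar> \<le> norm a * norm b" by (rule Cauchy_Schwarz_ineq2)
    also have "\<dots> \<le> (norm a)\<^sup>2 + (norm b)\<^sup>2"
      using zero_le_power2[of "norm a - norm b"] mult_nonneg_nonneg[OF norm_ge_zero[of a] norm_ge_zero[of b]]
      unfolding power2_diff by linarith
    finally show ?thesis .
  qed
  then show "AE x in lebesgue_on \<Omega>. norm (f x \<bullet> g x) \<le> norm ((norm (f x))\<^sup>2 + (norm (g x))\<^sup>2)"
    by simp
qed

lemma L2_mult_integrable:
  fixes f g :: "real^'d \<Rightarrow> real"
  assumes "f \<in> L2 \<Omega>" "g \<in> L2 \<Omega>"
  shows "integrable (lebesgue_on \<Omega>) (\<lambda>x. f x * g x)"
  using L2_inner_integrable[OF assms] by simp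

text \<open>Serves for the mobility weight \<open>sqrt (1 / k x)\<close> and for multiplication by a
  coordinate on the bounded domain.\<close>

lemma L2_bounded_mult:
  fixes c :: "real^'d \<Rightarrow> real"
  assumes "f \<in> L2 \<Omega>" "c \<in> borel_measurable (lebesgue_on \<Omega>)" "\<And>x. x \<in> \<Omega> \<Longrightarrow> \<bar>c x\<bar> \<le> B"
  shows "(\<lambda>x. c x *\<^sub>R f x) \<in> L2 \<Omega>"
proof -
  have m: "(\<lambda>x. c x *\<^sub>R f x) \<in> borel_measurable (lebesgue_on \<Omega>)"
    using assms(2) L2_measurable[OF assms(1)] by measurable
  have "integrable (lebesgue_on \<Omega>) (\<lambda>x. (norm (c x *\<^sub>R f x))\<^sup>2)"
  proof (rule Bochner_Integration.integrable_bound)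
    show "integrable (lebesgue_on \<Omega>) (\<lambda>x. B\<^sup>2 * (norm (f x))\<^sup>2)"
      using L2_square_integrable[OF assms(1)] by simp
    show "(\<lambda>x. (norm (c x *\<^sub>R f x))\<^sup>2) \<in> borel_measurable (lebesgue_on \<Omega>)"
      using m by measurable
    show "AE x in lebesgue_on \<Omega>. norm ((norm (c x *\<^sub>R f x))\<^sup>2) \<le> norm (B\<^sup>2 * (norm (f x))\<^sup>2)"
      using assms(3) power_mono[of "\<bar>c _\<bar>" B 2]
      by (intro AE_I2) (auto simp: power_mult_distrib intro!: mult_right_mono)
  qed
  with m show ?thesis by (simp add: L2_def)
qed

lemma l2_inner_add_left:
  "f \<in> L2 \<Omega> \<Longrightarrow> g \<in> L2 \<Omega> \<Longrightarrow> h \<in> L2 \<Omega> \<Longrightarrow>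
    l2_inner \<Omega> (\<lambda>x. f x + g x) h = l2_inner \<Omega> f h + l2_inner \<Omega> g h"
  by (simp add: l2_inner_def inner_add_left L2_inner_integrable)

lemma l2_inner_diff_left:
  "f \<in> L2 \<Omega> \<Longrightarrow> g \<in> L2 \<Omega> \<Longrightarrow> h \<in> L2 \<Omega> \<Longrightarrow>
    l2_inner \<Omega> (\<lambda>x. f x - g x) h = l2_inner \<Omega> f h - l2_inner \<Omega> g h"
  by (simp add: l2_inner_def inner_diff_left L2_inner_integrable)

lemma l2_inner_commute: "l2_inner \<Omega> f g = l2_inner \<Omega> g f"
  by (simp add: l2_inner_def inner_commute)

lemma l2_inner_add_right:
  "f \<in> L2 \<Omega> \<Longrightarrow> g \<in> L2 \<Omega> \<Longrightarrow> h \<in> L2 \<Omega> \<Longrightarrow>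
    l2_inner \<Omega> h (\<lambda>x. f x + g x) = l2_inner \<Omega> h f + l2_inner \<Omega> h g"
  by (simp add: l2_inner_def inner_add_right L2_inner_integrable)

lemma l2_inner_diff_right:
  "f \<in> L2 \<Omega> \<Longrightarrow> g \<in> L2 \<Omega> \<Longrightarrow> h \<in> L2 \<Omega> \<Longrightarrow>
    l2_inner \<Omega> h (\<lambda>x. f x - g x) = l2_inner \<Omega> h f - l2_inner \<Omega> h g"
  by (simp add: l2_inner_def inner_diff_right L2_inner_integrable)

text \<open>Identities between weak derivatives hold only off a null set; this carries them into the
  bilinear forms. Only the pointwise products have to agree.\<close>

lemma l2_inner_cong_AE:
  assumes "AE x in lebesgue_on \<Omega>. f x \<bullet> g x = f' x \<bullet> g' x"
    "f \<in> L2 \<Omega>" "g \<in> L2 \<Omega>" "f' \<in> L2 \<Omega>" "g' \<in> L2 \<Omega>"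
  shows "l2_inner \<Omega> f g = l2_inner \<Omega> f' g'"
  unfolding l2_inner_def
  using assms(1) L2_inner_integrable[OF assms(2,3)] L2_inner_integrable[OF assms(4,5)]
  by (intro integral_cong_AE) (auto dest: borel_measurable_integrable)

lemma l2_inner_self_nonneg: "0 \<le> l2_inner \<Omega> f f"
  by (simp add: l2_inner_def)

lemma l2_norm_square: "(l2_norm \<Omega> f)\<^sup>2 = l2_inner \<Omega> f f"
  by (simp add: l2_norm_def l2_inner_self_nonneg)

lemma l2_norm_nonneg: "0 \<le> l2_norm \<Omega> f"
  by (simp add: l2_norm_def l2_inner_self_nonneg)

lemma l2_norm_scaleR: "l2_norm \<Omega> (\<lambda>x. r *\<^sub>R f x) = \<bar>r\<bar> * l2_norm \<Omega> f"
proof -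
  have "l2_inner \<Omega> (\<lambda>x. r *\<^sub>R f x) (\<lambda>x. r *\<^sub>R f x) = r\<^sup>2 * l2_inner \<Omega> f f"
    by (simp add: l2_inner_def power2_eq_square mult.assoc)
  then show ?thesis by (simp add: l2_norm_def real_sqrt_mult)
qed

lemma l2_norm_cong_AE:
  assumes "AE x in lebesgue_on \<Omega>. f x = g x" "f \<in> L2 \<Omega>" "g \<in> L2 \<Omega>"
  shows "l2_norm \<Omega> f = l2_norm \<Omega> g"
  using assms unfolding l2_norm_def by (intro arg_cong[where f = sqrt] l2_inner_cong_AE) auto

lemma l2_inner_eq_0_iff:
  assumes "f \<in> L2 \<Omega>"
  shows "l2_inner \<Omega> f f = 0 \<longleftrightarrow> (AE x in lebesgue_on \<Omega>. f x = 0)"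
  using integral_nonneg_eq_0_iff_AE[OF L2_inner_integrable[OF assms assms]]
  by (simp add: l2_inner_def)

lemma l2_norm_eq_0_iff:
  assumes "f \<in> L2 \<Omega>"
  shows "l2_norm \<Omega> f = 0 \<longleftrightarrow> (AE x in lebesgue_on \<Omega>. f x = 0)"
  using l2_inner_eq_0_iff[OF assms] by (simp add: l2_norm_def)

lemma l2_norm_add_square:
  assumes "f \<in> L2 \<Omega>" "g \<in> L2 \<Omega>"
  shows "(l2_norm \<Omega> (\<lambda>x. f x + g x))\<^sup>2
    = (l2_norm \<Omega> f)\<^sup>2 + 2 * l2_inner \<Omega> f g + (l2_norm \<Omega> g)\<^sup>2"
  using assms by (simp add: l2_norm_square l2_inner_add_left l2_inner_add_right L2_add
      l2_inner_commute[of \<Omega> g f])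

text \<open>The quadratic polynomial |f + t g|^2 in t has no negative value, which bounds its
  discriminant.\<close>

lemma l2_Cauchy_Schwarz:
  assumes f: "f \<in> L2 \<Omega>" and g: "g \<in> L2 \<Omega>"
  shows "\<bar>l2_inner \<Omega> f g\<bar> \<le> l2_norm \<Omega> f * l2_norm \<Omega> g"
proof -
  define A B C where "A = l2_inner \<Omega> f f" and "B = l2_inner \<Omega> f g" and "C = l2_inner \<Omega> g g"
  have q: "0 \<le> A + 2 * t * B + t\<^sup>2 * C" for t
  proof -
    have "l2_inner \<Omega> f (\<lambda>x. t *\<^sub>R g x) = t * B"
      by (simp add: l2_inner_def B_def)
    moreover have "(l2_norm \<Omega> (\<lambda>x. t *\<^sub>R g x))\<^sup>2 = t\<^sup>2 * C"
      unfolding l2_norm_scaleR C_def by (simp add: power_mult_distrib l2_norm_square)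
    ultimately show ?thesis
      using l2_norm_add_square[OF f L2_scaleR[OF g, of t]]
        zero_le_power2[of "l2_norm \<Omega> (\<lambda>x. f x + t *\<^sub>R g x)"]
      by (simp add: l2_norm_square A_def)
  qed
  have "B\<^sup>2 \<le> A * C"
  proof (cases "C = 0")
    case True
    have "B = 0"
    proof (rule ccontr)
      assume "B \<noteq> 0"
      \<comment> \<open>If C = 0 the polynomial is affine, and this t gives it the value -1.\<close>
      then show False using q[of "- (A + 1) / (2 * B)"] True by (simp add: field_simps)
    qed
    then show ?thesis using True by simp
  next
    case False
    then have "C > 0" using l2_inner_self_nonneg[of \<Omega> g] by (simp add: C_def)
    \<comment> \<open>The minimum point of the polynomial.\<close>
    then show ?thesis using q[of "- B / C"] by (simp add: field_simps power2_eq_square)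
  qed
  then have "sqrt (B\<^sup>2) \<le> sqrt (A * C)" by (rule real_sqrt_le_mono)
  then show ?thesis by (simp add: A_def B_def C_def l2_norm_def real_sqrt_mult)
qed

lemma l2_norm_triangle:
  assumes f: "f \<in> L2 \<Omega>" and g: "g \<in> L2 \<Omega>"
  shows "l2_norm \<Omega> (\<lambda>x. f x + g x) \<le> l2_norm \<Omega> f + l2_norm \<Omega> g"
proof (rule power2_le_imp_le)
  show "(l2_norm \<Omega> (\<lambda>x. f x + g x))\<^sup>2 \<le> (l2_norm \<Omega> f + l2_norm \<Omega> g)\<^sup>2"
    using l2_Cauchy_Schwarz[OF f g] by (simp add: l2_norm_add_square[OF f g] power2_sum)
qed (simp add: l2_norm_nonneg)

lemma l2_tendsto_inner:
  assumes "(\<lambda>m. l2_norm \<Omega> (\<lambda>x. \<phi> m x - f x)) \<longlonglongrightarrow> 0" "\<And>m. \<phi> m \<in> L2 \<Omega>" "f \<in> L2 \<Omega>" "g \<in> L2 \<Omega>"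
  shows "(\<lambda>m. l2_inner \<Omega> (\<phi> m) g) \<longlonglongrightarrow> l2_inner \<Omega> f g"
proof (rule LIM_zero_cancel, rule Lim_null_comparison)
  show "\<forall>\<^sub>F m in sequentially. norm (l2_inner \<Omega> (\<phi> m) g - l2_inner \<Omega> f g)
      \<le> l2_norm \<Omega> (\<lambda>x. \<phi> m x - f x) * l2_norm \<Omega> g"
    using l2_Cauchy_Schwarz[OF L2_diff[OF assms(2) assms(3)] assms(4)]
    by (simp add: l2_inner_diff_left assms)
  show "(\<lambda>m. l2_norm \<Omega> (\<lambda>x. \<phi> m x - f x) * l2_norm \<Omega> g) \<longlonglongrightarrow> 0"
    using tendsto_mult_left_zero[OF assms(1)] .
qed

section \<open>Smooth functions and bumps\<close>

definition smooth :: "(real^'d \<Rightarrow> real) \<Rightarrow> bool" where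
  "smooth f \<longleftrightarrow> (\<forall>m. Ck m f)"

lemma grad_nth_eq: "(f has_derivative D) (at x) \<Longrightarrow> grad f x $ i = D (axis i 1)"
  by (simp add: grad_def frechet_derivative_at[symmetric])

lemma Ck_continuous: "Ck m f \<Longrightarrow> continuous_on UNIV f"
  by (cases m) (auto simp: continuous_on_eq_continuous_within differentiable_imp_continuous_within)

lemma Ck_SucD: "Ck (Suc m) f \<Longrightarrow> Ck m f"
proof (induction m arbitrary: f)
  case 0
  then show ?case using Ck_continuous[of "Suc 0" f] by simp
next
  case (Suc m)
  then show ?case by (metis Ck.simps(2))
qed

lemma grad_add_nth:
  assumes "f differentiable at x" "g differentiable at x"
  shows "grad (\<lambda>y. f y + g y) x $ i = grad f x $ i + grad g x $ i"
proof -
  have "((\<lambda>y. f y + g y) has_derivative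
      (\<lambda>h. frechet_derivative f (at x) h + frechet_derivative g (at x) h)) (at x)"
    using assms by (intro has_derivative_add) (simp_all add: frechet_derivative_works[symmetric])
  from grad_nth_eq[OF this] show ?thesis by (simp add: grad_def)
qed

lemma grad_mult_nth:
  assumes "f differentiable at x" "g differentiable at x"
  shows "grad (\<lambda>y. f y * g y) x $ i = f x * grad g x $ i + grad f x $ i * g x"
proof -
  have "((\<lambda>y. f y * g y) has_derivative
      (\<lambda>h. f x * frechet_derivative g (at x) h + frechet_derivative f (at x) h * g x)) (at x)"
    using assms by (intro has_derivative_mult) (simp_all add: frechet_derivative_works[symmetric])
  from grad_nth_eq[OF this] show ?thesis by (simp add: grad_def)
qed

lemma grad_const_nth: "grad (\<lambda>y. c) x $ i = 0"
  by (rule grad_nth_eq[OF has_derivative_const])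

lemma Ck_const: "Ck m (\<lambda>x. c)"
  by (induction m arbitrary: c) (simp_all add: grad_const_nth)

lemma Ck_add: "Ck m f \<Longrightarrow> Ck m g \<Longrightarrow> Ck m (\<lambda>x. f x + g x)"
  by (induction m arbitrary: f g) (auto intro: continuous_intros simp: grad_add_nth)

text \<open>The product rule pairs a derivative, of order m, with an undifferentiated factor, which
  first has to be lowered to order m.\<close>

lemma Ck_mult: "Ck m f \<Longrightarrow> Ck m g \<Longrightarrow> Ck m (\<lambda>x. f x * g x)"
proof (induction m arbitrary: f g)
  case 0
  then show ?case by (auto intro: continuous_intros)
next
  case (Suc m)
  then show ?case using Ck_SucD[OF Suc.prems(1)] Ck_SucD[OF Suc.prems(2)]
    by (auto simp: grad_mult_nth intro!: Ck_add)
qed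

lemma Ck_nth: "Ck m (\<lambda>x::real^'d. x $ j)"
proof (cases m)
  case 0
  then show ?thesis by (auto intro: continuous_intros)
next
  case (Suc m')
  have "((\<lambda>x::real^'d. x $ j) has_derivative (\<lambda>h. h $ j)) (at x)" for x
    by (rule bounded_linear.has_derivative[OF bounded_linear_vec_nth]) simp
  then have "(\<lambda>x::real^'d. x $ j) differentiable at x" "grad (\<lambda>x::real^'d. x $ j) x $ i = axis i 1 $ j" for x i
    by (auto simp: differentiable_def intro: grad_nth_eq)
  then show ?thesis using Suc by (simp add: Ck_const)
qed

lemma smooth_const: "smooth (\<lambda>x. c)"
  and smooth_nth: "smooth (\<lambda>x. x $ j)"
  and smooth_add: "smooth f \<Longrightarrow> smooth g \<Longrightarrow> smooth (\<lambda>x. f x + g x)"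
  and smooth_mult: "smooth f \<Longrightarrow> smooth g \<Longrightarrow> smooth (\<lambda>x. f x * g x)"
  by (simp_all add: smooth_def Ck_const Ck_nth Ck_add Ck_mult)

lemma smooth_sum: "(\<And>i. i \<in> I \<Longrightarrow> smooth (f i)) \<Longrightarrow> smooth (\<lambda>x. \<Sum>i\<in>I. f i x)"
  by (induction I rule: infinite_finite_induct) (auto intro: smooth_const smooth_add)

lemma smooth_grad: "smooth f \<Longrightarrow> smooth (\<lambda>x. grad f x $ i)"
  unfolding smooth_def by (metis Ck.simps(2))

lemma smooth_differentiable: "smooth f \<Longrightarrow> f differentiable at x"
  unfolding smooth_def by (metis Ck.simps(2))

lemma smooth_continuous: "smooth f \<Longrightarrow> continuous_on UNIV f"
  unfolding smooth_def using Ck_continuous by blast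

lemma smooth_DERIV_line:
  assumes "smooth f"
  shows "((\<lambda>s. f (x + s *\<^sub>R axis i 1)) has_real_derivative grad f (x + s *\<^sub>R axis i 1) $ i) (at s)"
proof -
  have 1: "((\<lambda>s. x + s *\<^sub>R axis i 1) has_derivative (\<lambda>h. h *\<^sub>R axis i 1)) (at s)"
    by (auto intro!: derivative_eq_intros)
  have 2: "(f has_derivative frechet_derivative f (at (x + s *\<^sub>R axis i 1))) (at (x + s *\<^sub>R axis i 1))"
    using smooth_differentiable[OF assms] frechet_derivative_works by blast
  have "linear (frechet_derivative f (at (x + s *\<^sub>R axis i 1)))"
    using has_derivative_linear[OF 2] .
  then have "frechet_derivative f (at (x + s *\<^sub>R axis i 1)) (h *\<^sub>R axis i 1)
      = grad f (x + s *\<^sub>R axis i 1) $ i * h" for h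
    by (simp add: grad_def linear_scale)
  with has_derivative_compose[OF 1 2] show ?thesis
    by (simp add: has_field_derivative_def mult.commute[of _ "grad f _ $ _"])
qed

text \<open>The mean value theorem is applied twice: in direction i to the difference of two
  translates, then in direction j to the resulting partial derivative.\<close>

lemma smooth_second_difference:
  assumes f: "smooth f" and h: "h > 0"
  obtains \<xi> \<eta> where "0 < \<xi>" "\<xi> < h" "0 < \<eta>" "\<eta> < h"
    "f (x + h *\<^sub>R axis i 1 + h *\<^sub>R axis j 1) - f (x + h *\<^sub>R axis i 1) - f (x + h *\<^sub>R axis j 1) + f x
      = h * h * grad (\<lambda>y. grad f y $ i) (x + \<xi> *\<^sub>R axis i 1 + \<eta> *\<^sub>R axis j 1) $ j"
proof -
  define F where "F s = f ((x + h *\<^sub>R axis j 1) + s *\<^sub>R axis i 1) - f (x + s *\<^sub>R axis i 1)" for s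
  have F: "(F has_real_derivative grad f ((x + h *\<^sub>R axis j 1) + s *\<^sub>R axis i 1) $ i
      - grad f (x + s *\<^sub>R axis i 1) $ i) (at s)" for s
    unfolding F_def by (intro DERIV_diff smooth_DERIV_line f)
  obtain \<xi> where \<xi>: "0 < \<xi>" "\<xi> < h" "F h - F 0 = (h - 0) * (grad f ((x + h *\<^sub>R axis j 1) + \<xi> *\<^sub>R axis i 1) $ i
      - grad f (x + \<xi> *\<^sub>R axis i 1) $ i)"
    using MVT2[OF h F] by blast
  define H where "H t = grad f ((x + \<xi> *\<^sub>R axis i 1) + t *\<^sub>R axis j 1) $ i" for t
  have H: "(H has_real_derivative grad (\<lambda>y. grad f y $ i) ((x + \<xi> *\<^sub>R axis i 1) + t *\<^sub>R axis j 1) $ j) (at t)" for t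
    unfolding H_def by (intro smooth_DERIV_line[where f = "\<lambda>y. grad f y $ i"] smooth_grad f)
  obtain \<eta> where \<eta>: "0 < \<eta>" "\<eta> < h"
      "H h - H 0 = (h - 0) * grad (\<lambda>y. grad f y $ i) ((x + \<xi> *\<^sub>R axis i 1) + \<eta> *\<^sub>R axis j 1) $ j"
    using MVT2[OF h H] by blast
  have "F h - F 0 = h * (H h - H 0)"
    using \<xi>(3) by (simp add: H_def add_ac)
  then have "F h - F 0 = h * h * grad (\<lambda>y. grad f y $ i) (x + \<xi> *\<^sub>R axis i 1 + \<eta> *\<^sub>R axis j 1) $ j"
    using \<eta>(3) by simp
  then show ?thesis
    by (intro that[OF \<xi>(1,2) \<eta>(1,2)]) (simp add: F_def algebra_simps)
qed

text \<open>Schwarz's theorem, needed to exchange derivatives of test functions in Korn's argument.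
  The second difference is symmetric in i and j, so a value of one mixed derivative near x equals a
  value of the other near x; continuity does the rest.\<close>

lemma smooth_grad_commute:
  fixes f :: "real^'d \<Rightarrow> real"
  assumes f: "smooth f"
  shows "grad (\<lambda>y. grad f y $ i) x $ j = grad (\<lambda>y. grad f y $ j) x $ i"
proof -
  define A B where "A y = grad (\<lambda>y. grad f y $ i) y $ j" and "B y = grad (\<lambda>y. grad f y $ j) y $ i" for y
  have cA: "isCont A x" and cB: "isCont B x"
    using smooth_continuous[OF smooth_grad[OF smooth_grad[OF f, of i], of j]]
      smooth_continuous[OF smooth_grad[OF smooth_grad[OF f, of j], of i]]
    unfolding A_def B_def by (auto simp: continuous_on_eq_continuous_at)
  have "\<bar>A x - B x\<bar> < e" if e: "e > 0" for e
  proof -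
    obtain d1 where d1: "d1 > 0" "\<And>y. dist y x < d1 \<Longrightarrow> dist (A y) (A x) < e / 2"
      using cA[unfolded continuous_at_eps_delta, rule_format, of "e / 2"] e by auto
    obtain d2 where d2: "d2 > 0" "\<And>y. dist y x < d2 \<Longrightarrow> dist (B y) (B x) < e / 2"
      using cB[unfolded continuous_at_eps_delta, rule_format, of "e / 2"] e by auto
    \<comment> \<open>Each point supplied by the mean value theorem is less than h + h away from x,
      and h + h is the smaller of the two radii.\<close>
    define h where "h = min d1 d2 / 2"
    have h: "h > 0" using d1 d2 by (simp add: h_def)
    obtain \<xi> \<eta> where 1: "0 < \<xi>" "\<xi> < h" "0 < \<eta>" "\<eta> < h"
      "f (x + h *\<^sub>R axis i 1 + h *\<^sub>R axis j 1) - f (x + h *\<^sub>R axis i 1) - f (x + h *\<^sub>R axis j 1) + f x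
      = h * h * A (x + \<xi> *\<^sub>R axis i 1 + \<eta> *\<^sub>R axis j 1)"
      unfolding A_def by (rule smooth_second_difference[OF f h, where i = i and j = j and x = x])
    obtain \<xi>' \<eta>' where 2: "0 < \<xi>'" "\<xi>' < h" "0 < \<eta>'" "\<eta>' < h"
      "f (x + h *\<^sub>R axis j 1 + h *\<^sub>R axis i 1) - f (x + h *\<^sub>R axis j 1) - f (x + h *\<^sub>R axis i 1) + f x
      = h * h * B (x + \<xi>' *\<^sub>R axis j 1 + \<eta>' *\<^sub>R axis i 1)"
      unfolding B_def by (rule smooth_second_difference[OF f h])
    have "h * h * A (x + \<xi> *\<^sub>R axis i 1 + \<eta> *\<^sub>R axis j 1) = h * h * B (x + \<xi>' *\<^sub>R axis j 1 + \<eta>' *\<^sub>R axis i 1)"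
      using 1(5) 2(5) by (simp add: algebra_simps)
    then have AB: "A (x + \<xi> *\<^sub>R axis i 1 + \<eta> *\<^sub>R axis j 1) = B (x + \<xi>' *\<^sub>R axis j 1 + \<eta>' *\<^sub>R axis i 1)"
      using h by simp
    have near: "dist (x + s *\<^sub>R axis k 1 + t *\<^sub>R axis l (1::real)) x < min d1 d2"
      if "0 < s" "s < h" "0 < t" "t < h" for s t and k l :: 'd
    proof -
      have "dist (x + s *\<^sub>R axis k 1 + t *\<^sub>R axis l (1::real)) x \<le> norm (s *\<^sub>R axis k (1::real)) + norm (t *\<^sub>R axis l (1::real))"
        by (simp add: dist_norm norm_triangle_le add.assoc)
      also have "\<dots> < h + h" using that by simp
      finally show ?thesis by (simp add: h_def)
    qed
    have "dist (A (x + \<xi> *\<^sub>R axis i 1 + \<eta> *\<^sub>R axis j 1)) (A x) < e / 2"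
      using near[OF 1(1-4), of i j] by (intro d1) auto
    moreover have "dist (B (x + \<xi>' *\<^sub>R axis j 1 + \<eta>' *\<^sub>R axis i 1)) (B x) < e / 2"
      using near[OF 2(1-4), of j i] by (intro d2) auto
    ultimately show ?thesis using AB unfolding dist_real_def by linarith
  qed
  then have "A x = B x" by (metis abs_0_eq abs_ge_zero diff_0 eq_iff_diff_eq_0 less_irrefl zero_less_abs_iff)
  then show ?thesis by (simp add: A_def B_def)
qed

text \<open>The functions Q(1/t) exp(-1/t), extended by zero, form a family closed under
  differentiation; Q = 1 is the classical bump. Keeping Q general makes smoothness a plain
  induction.\<close>

definition bump :: "real poly \<Rightarrow> real \<Rightarrow> real" where
  "bump Q t = (if t > 0 then poly Q (1 / t) * exp (- (1 / t)) else 0)"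

lemma tendsto_poly_exp_0: "((\<lambda>x::real. poly Q x * exp (- x)) \<longlongrightarrow> 0) at_top"
proof -
  have "((\<lambda>x::real. \<Sum>i\<le>degree Q. coeff Q i * (x ^ i / exp x)) \<longlongrightarrow> 0) at_top"
    by (intro tendsto_null_sum tendsto_mult_right_zero tendsto_power_div_exp_0)
  then show ?thesis
    by (simp add: poly_altdef sum_distrib_right exp_minus divide_inverse mult.assoc)
qed

lemma bump_tendsto_0: "(bump Q \<longlongrightarrow> 0) (at 0)"
  unfolding filterlim_split_at_real
proof (intro filterlim_split_at)
  show "(bump Q \<longlongrightarrow> 0) (at_left 0)"
    by (rule tendsto_eventually) (auto simp: bump_def eventually_at_filter)
  have "((\<lambda>t. poly Q (inverse t) * exp (- inverse t)) \<longlongrightarrow> 0) (at_right 0)"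
    using filterlim_compose[OF tendsto_poly_exp_0 filterlim_inverse_at_top_right] .
  then show "(bump Q \<longlongrightarrow> 0) (at_right 0)"
    by (rule Lim_transform_eventually) (auto simp: bump_def eventually_at_filter inverse_eq_divide)
qed

text \<open>With X = 1/t one has X' = -X^2, so the derivative of Q(X) exp(-X) is X^2 (Q - Q')(X)
  exp(-X).\<close>

lemma bump_has_derivative:
  "(bump Q has_real_derivative bump ([:0, 0, 1:] * (Q - pderiv Q)) t) (at t)"
proof -
  consider "t > 0" | "t < 0" | "t = 0" by linarith
  then show ?thesis
  proof cases
    case 1
    have "((\<lambda>s. poly Q (1 / s) * exp (- (1 / s))) has_real_derivative
        bump ([:0, 0, 1:] * (Q - pderiv Q)) t) (at t)"
      using 1 by (auto intro!: derivative_eq_intros simp: bump_def field_simps power2_eq_square)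
    then show ?thesis
      by (rule has_field_derivative_transform_within_open[where S = "{0<..}"]) (use 1 in \<open>auto simp: bump_def\<close>)
  next
    case 2
    have "((\<lambda>s. 0) has_real_derivative bump ([:0, 0, 1:] * (Q - pderiv Q)) t) (at t)"
      using 2 by (simp add: bump_def)
    then show ?thesis
      by (rule has_field_derivative_transform_within_open[where S = "{..<0}"]) (use 2 in \<open>auto simp: bump_def\<close>)
  next
    case 3
    \<comment> \<open>\<open>pCons 0 Q\<close> is the polynomial X Q, so this function is the
      difference quotient of \<open>bump Q\<close> at 0.\<close>
    have "((\<lambda>h. bump (pCons 0 Q) h) \<longlongrightarrow> 0) (at 0)" by (rule bump_tendsto_0)
    then have "((\<lambda>h. (bump Q (0 + h) - bump Q 0) / h) \<longlongrightarrow> 0) (at 0)"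
      by (rule Lim_transform_eventually) (auto simp: bump_def eventually_at_filter field_simps)
    then show ?thesis using 3 by (simp add: DERIV_def bump_def)
  qed
qed

text \<open>\<open>Q\<close> varies in the induction because differentiation replaces it by another
  polynomial.\<close>

lemma Ck_bump_compose: "Ck m P \<Longrightarrow> Ck m (\<lambda>x. bump Q (P x))"
proof (induction m arbitrary: P Q)
  case 0
  have "continuous_on UNIV (bump Q)"
    using bump_has_derivative by (meson DERIV_continuous_on has_field_derivative_at_within)
  then show ?case using 0 by (auto intro: continuous_on_compose2)
next
  case (Suc m)
  define Q' where "Q' = [:0, 0, 1:] * (Q - pderiv Q)"
  have D: "((\<lambda>x. bump Q (P x)) has_derivative
      (\<lambda>h. frechet_derivative P (at x) h * bump Q' (P x))) (at x)" for x
    unfolding Q'_def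
    using has_derivative_compose[OF _ bump_has_derivative[unfolded has_field_derivative_def], of P _ x UNIV Q]
      Suc.prems by (auto simp: frechet_derivative_works[symmetric] mult.commute)
  then have "grad (\<lambda>x. bump Q (P x)) x $ i = grad P x $ i * bump Q' (P x)" for x i
    using grad_nth_eq[OF D] by (simp add: grad_def)
  then show ?case
    using D Suc.prems Suc.IH[OF Ck_SucD[OF Suc.prems]] by (auto simp: differentiable_def intro!: Ck_mult)
qed

lemma smooth_bump_compose: "smooth P \<Longrightarrow> smooth (\<lambda>x. bump Q (P x))"
  by (simp add: smooth_def Ck_bump_compose)

section \<open>Test functions\<close>

lemma bounded_open_lmeasurable: "open \<Omega> \<Longrightarrow> bounded \<Omega> \<Longrightarrow> \<Omega> \<in> lmeasurable"
  by (simp add: bounded_set_imp_lmeasurable borel_open)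

lemma L2_bounded:
  assumes "\<Omega> \<in> lmeasurable" "f \<in> borel_measurable (lebesgue_on \<Omega>)"
    "AE x in lebesgue_on \<Omega>. norm (f x) \<le> B"
  shows "f \<in> L2 \<Omega>"
proof -
  interpret finite_measure "lebesgue_on \<Omega>"
    using assms(1) by (rule finite_measure_lebesgue_on)
  have "integrable (lebesgue_on \<Omega>) (\<lambda>x. (norm (f x))\<^sup>2)"
  proof (rule integrable_const_bound[where B = "B\<^sup>2"])
    show "AE x in lebesgue_on \<Omega>. norm ((norm (f x))\<^sup>2) \<le> B\<^sup>2"
      using assms(3) by eventually_elim (simp add: power_mono)
    show "(\<lambda>x. (norm (f x))\<^sup>2) \<in> borel_measurable (lebesgue_on \<Omega>)"
      using assms(2) by measurable
  qed
  with assms(2) show ?thesis by (simp add: L2_def)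
qed

lemma L2_imp_integrable:
  fixes f :: "real^'d \<Rightarrow> real"
  assumes "\<Omega> \<in> lmeasurable" "f \<in> L2 \<Omega>"
  shows "integrable (lebesgue_on \<Omega>) f"
  using L2_mult_integrable[OF assms(2) L2_bounded[OF assms(1), of "\<lambda>x. 1" 1]] by simp

lemma continuous_measurable_lebesgue_on:
  "continuous_on UNIV f \<Longrightarrow> f \<in> borel_measurable (lebesgue_on S)"
  by (intro measurable_restrict_space1 measurable_completion) (simp add: borel_measurable_continuous_onI)

lemma test_functions_smooth: "\<phi> \<in> test_functions \<Omega> \<Longrightarrow> smooth \<phi>"
  by (simp add: test_functions_def smooth_def)

lemma test_functionsI:
  assumes "smooth \<psi>" "{x. \<psi> x \<noteq> 0} \<subseteq> S" "compact S" "S \<subseteq> \<Omega>"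
  shows "\<psi> \<in> test_functions \<Omega>"
proof -
  have "closure {x. \<psi> x \<noteq> 0} \<subseteq> S"
    using assms(2,3) by (simp add: closure_minimal compact_imp_closed)
  then show ?thesis
    using assms(1,4) compact_Int_closed[OF assms(3) closed_closure, of "{x. \<psi> x \<noteq> 0}"]
    by (auto simp: test_functions_def smooth_def Int_absorb1)
qed

lemma test_functions_mono: "\<Omega>' \<subseteq> \<Omega> \<Longrightarrow> test_functions \<Omega>' \<subseteq> test_functions \<Omega>"
  by (auto simp: test_functions_def)

text \<open>The gradient vanishes off the support too, because the complement of a compact set is
  open and the function is locally zero there.\<close>

lemma test_functions_support:
  assumes "\<phi> \<in> test_functions \<Omega>"
  obtains S where "compact S" "S \<subseteq> \<Omega>" "\<And>x. x \<notin> S \<Longrightarrow> \<phi> x = 0" "\<And>x i. x \<notin> S \<Longrightarrow> grad \<phi> x $ i = 0"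
proof -
  define C where "C = closure {x. \<phi> x \<noteq> 0}"
  have C: "compact C" "C \<subseteq> \<Omega>"
    using assms by (auto simp: test_functions_def C_def)
  have zero: "\<phi> x = 0" if "x \<notin> C" for x
    using that closure_subset[of "{x. \<phi> x \<noteq> 0}"] by (auto simp: C_def)
  have "(\<phi> has_derivative (\<lambda>h. 0)) (at x)" if "x \<notin> C" for x
    using that by (intro has_derivative_transform_within_open[where f = "\<lambda>_. 0" and s = "- C",
          OF has_derivative_const open_Compl[OF compact_imp_closed[OF C(1)]]])
      (simp_all add: zero)
  then have "grad \<phi> x $ i = 0" if "x \<notin> C" for x i
    using grad_nth_eq that by blast
  with C zero show ?thesis by (rule that)
qed

lemma test_functions_grad:
  assumes "\<phi> \<in> test_functions \<Omega>"
  shows "(\<lambda>x. grad \<phi> x $ i) \<in> test_functions \<Omega>"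
proof -
  obtain S where "compact S" "S \<subseteq> \<Omega>" "\<And>x i. x \<notin> S \<Longrightarrow> grad \<phi> x $ i = 0"
    using test_functions_support[OF assms] by metis
  then show ?thesis
    by (intro test_functionsI[where S = S]) (auto intro: smooth_grad test_functions_smooth[OF assms])
qed

lemma test_functions_mult:
  assumes "\<phi> \<in> test_functions \<Omega>" "smooth g"
  shows "(\<lambda>x. g x * \<phi> x) \<in> test_functions \<Omega>"
proof -
  obtain S where "compact S" "S \<subseteq> \<Omega>" "\<And>x. x \<notin> S \<Longrightarrow> \<phi> x = 0"
    using test_functions_support[OF assms(1)] by metis
  then show ?thesis
    by (intro test_functionsI[where S = S]) (auto intro: smooth_mult assms test_functions_smooth[OF assms(1)])
qed

lemma test_functions_add:
  assumes "\<phi> \<in> test_functions \<Omega>" "\<psi> \<in> test_functions \<Omega>"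
  shows "(\<lambda>x. \<phi> x + \<psi> x) \<in> test_functions \<Omega>"
proof -
  obtain S where "compact S" "S \<subseteq> \<Omega>" "\<And>x. x \<notin> S \<Longrightarrow> \<phi> x = 0"
    using test_functions_support[OF assms(1)] by metis
  moreover obtain S' where "compact S'" "S' \<subseteq> \<Omega>" "\<And>x. x \<notin> S' \<Longrightarrow> \<psi> x = 0"
    using test_functions_support[OF assms(2)] by metis
  ultimately show ?thesis
    by (intro test_functionsI[where S = "S \<union> S'"])
      (fastforce intro: smooth_add test_functions_smooth assms)+
qed

lemma test_functions_bounded:
  assumes "\<phi> \<in> test_functions \<Omega>"
  obtains B where "B \<ge> 0" "\<And>x. \<bar>\<phi> x\<bar> \<le> B"
proof -
  obtain S where S: "compact S" "\<And>x. x \<notin> S \<Longrightarrow> \<phi> x = 0"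
    using test_functions_support[OF assms] by metis
  have "bounded (\<phi> ` S)"
    using S(1) smooth_continuous[OF test_functions_smooth[OF assms]]
    by (intro compact_imp_bounded compact_continuous_image) (auto intro: continuous_on_subset)
  then obtain B where B: "\<And>x. x \<in> S \<Longrightarrow> \<bar>\<phi> x\<bar> \<le> B" "B > 0"
    unfolding bounded_pos by auto
  have "\<bar>\<phi> x\<bar> \<le> B" for x using B S(2)[of x] by (cases "x \<in> S") auto
  then show ?thesis using B(2) by (intro that[of B]) auto
qed

lemma test_functions_L2:
  assumes "\<Omega> \<in> lmeasurable" "\<phi> \<in> test_functions \<Omega>'"
  shows "\<phi> \<in> L2 \<Omega>"
proof -
  obtain B where "\<And>x. \<bar>\<phi> x\<bar> \<le> B" using test_functions_bounded[OF assms(2)] by metis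
  then show ?thesis
    by (intro L2_bounded[OF assms(1), where B = B] continuous_measurable_lebesgue_on smooth_continuous
        test_functions_smooth[OF assms(2)]) auto
qed

text \<open>The source of the integration by parts on cells. By translation invariance of Lebesgue
  measure each difference quotient has integral zero, and dominated convergence passes to the
  derivative.\<close>

lemma integral_grad_test_function:
  fixes \<phi> :: "real^'d \<Rightarrow> real"
  assumes \<phi>: "\<phi> \<in> test_functions \<Omega>" and "\<Omega> \<in> sets lebesgue"
  shows "(LINT x|lebesgue_on \<Omega>. grad \<phi> x $ i) = 0"
proof -
  define e :: "real^'d" where "e = axis i 1"
  have ne: "norm e = 1" by (simp add: e_def)
  have sm: "smooth \<phi>" using \<phi> by (rule test_functions_smooth)
  obtain S where S: "compact S" "S \<subseteq> \<Omega>" "\<And>x. x \<notin> S \<Longrightarrow> \<phi> x = 0" "\<And>x i. x \<notin> S \<Longrightarrow> grad \<phi> x $ i = 0"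
    using test_functions_support[OF \<phi>] by metis
  obtain R where R: "S \<subseteq> cball 0 R"
    using compact_imp_bounded[OF S(1)] unfolding bounded_iff by (auto simp: subset_iff)
  obtain B where B: "B \<ge> 0" "\<And>x. \<bar>grad \<phi> x $ i\<bar> \<le> B"
    using test_functions_bounded[OF test_functions_grad[OF \<phi>]] by metis
  have c: "continuous_on UNIV \<phi>" using sm by (rule smooth_continuous)
  have m: "\<phi> \<in> borel_measurable lborel"
    using borel_measurable_continuous_onI[OF c] by simp
  have mg: "(\<lambda>x. grad \<phi> x $ i) \<in> borel_measurable lborel"
    using borel_measurable_continuous_onI[OF smooth_continuous[OF smooth_grad[OF sm]]] by simp
  obtain B' where B': "\<And>x. \<bar>\<phi> x\<bar> \<le> B'" "B' \<ge> 0" using test_functions_bounded[OF \<phi>] by metis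
  have intc: "integrable lborel (\<lambda>x. C * indicat_real (cball (0::real^'d) r) x)" for C r
    by (intro integrable_mult_right integrable_real_indicator) (use emeasure_bounded_finite[OF bounded_cball] in auto)
  have int0: "integrable lborel \<phi>"
  proof (rule Bochner_Integration.integrable_bound[OF intc[of B' R] m])
    show "AE x in lborel. norm (\<phi> x) \<le> norm (B' * indicat_real (cball 0 R) x)"
      using B' S(3) R by (intro AE_I2) (auto simp: indicator_def subset_iff)
  qed
  have shift: "(LINT x|lborel. \<phi> (a + x)) = (LINT x|lborel. \<phi> x)"
    "integrable lborel (\<lambda>x. \<phi> (a + x))" for a
  proof -
    have "(LINT x|distr lborel borel ((+) a). \<phi> x) = (LINT x|lborel. \<phi> (a + x))"
      using m by (intro integral_distr) auto
    then show "(LINT x|lborel. \<phi> (a + x)) = (LINT x|lborel. \<phi> x)"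
      by (simp add: lborel_distr_plus)
    have "integrable (distr lborel borel ((+) a)) \<phi>"
      using int0 by (simp add: lborel_distr_plus)
    then show "integrable lborel (\<lambda>x. \<phi> (a + x))"
      using m by (subst (asm) integrable_distr_eq) auto
  qed
  define t where "t n = 1 / real (Suc n)" for n
  have t: "0 < t n" "t n \<le> 1" for n by (auto simp: t_def)
  define D where "D n x = (\<phi> (x + t n *\<^sub>R e) - \<phi> x) / t n" for n x
  have D0: "(LINT x|lborel. D n x) = 0" for n
    using shift[of "t n *\<^sub>R e"] int0 by (simp add: D_def add.commute)
  have "(\<lambda>n. LINT x|lborel. D n x) \<longlonglongrightarrow> (LINT x|lborel. grad \<phi> x $ i)"
  \<comment> \<open>The mean value theorem bounds the quotients by B; as the steps are at most 1,
    they vanish outside the ball of radius R + 1.\<close>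
  proof (rule integral_dominated_convergence[OF mg _ intc[of B "R + 1"]])
    show "D n \<in> borel_measurable lborel" for n
      using int0 shift(2)[of "t n *\<^sub>R e"] unfolding D_def
      by (intro borel_measurable_integrable) (simp add: add.commute)
    have lim: "(\<lambda>n. D n x) \<longlonglongrightarrow> grad \<phi> x $ i" for x
    proof -
      have "((\<lambda>h. (\<phi> (x + h *\<^sub>R e) - \<phi> x) / h) \<longlongrightarrow> grad \<phi> x $ i) (at 0)"
        using smooth_DERIV_line[OF sm, of x i 0] by (simp add: DERIV_def e_def)
      moreover have "filterlim t (at 0) sequentially"
        unfolding t_def filterlim_at
        using LIMSEQ_inverse_real_of_nat by (auto simp: inverse_eq_divide simp del: of_nat_Suc)
      ultimately show ?thesis unfolding D_def by (rule filterlim_compose)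
    qed
    then show "AE x in lborel. (\<lambda>n. D n x) \<longlonglongrightarrow> grad \<phi> x $ i" by simp
    show "AE x in lborel. norm (D n x) \<le> B * indicat_real (cball 0 (R + 1)) x" for n
    proof (rule AE_I2)
      fix x
      show "norm (D n x) \<le> B * indicat_real (cball 0 (R + 1)) x"
      proof (cases "x \<in> cball 0 (R + 1)")
        case True
        have d: "((\<lambda>s. \<phi> (x + s *\<^sub>R e)) has_real_derivative grad \<phi> (x + s *\<^sub>R e) $ i) (at s)" for s
          using smooth_DERIV_line[OF sm] by (simp add: e_def)
        obtain z where "\<phi> (x + t n *\<^sub>R e) - \<phi> (x + 0 *\<^sub>R e) = (t n - 0) * grad \<phi> (x + z *\<^sub>R e) $ i"
          using MVT2[OF t(1)[of n] d] by blast
        then have "D n x = grad \<phi> (x + z *\<^sub>R e) $ i" using t(1)[of n] by (simp add: D_def)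
        then show ?thesis using B(2) True by simp
      next
        case False
        then have "norm x > R + 1" by simp
        moreover have "norm (x + t n *\<^sub>R e) \<ge> norm x - t n"
          using norm_diff_ineq[of x "t n *\<^sub>R e"] t(1)[of n] ne by simp
        ultimately have "x \<notin> S" "x + t n *\<^sub>R e \<notin> S"
          using t(2)[of n] R by (auto simp: subset_iff)
        then show ?thesis using False S(3) by (simp add: D_def)
      qed
    qed
  qed
  then have "(LINT x|lborel. grad \<phi> x $ i) = 0"
    using D0 by (simp add: LIMSEQ_const_iff)
  \<comment> \<open>The gradient vanishes off \<open>\<Omega>\<close>, so the integral over the
    domain is the one over the whole space.\<close>
  moreover have "(LINT x|lebesgue_on \<Omega>. grad \<phi> x $ i) = (LINT x|lebesgue. grad \<phi> x $ i)"
  proof -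
    have "indicat_real \<Omega> x *\<^sub>R grad \<phi> x $ i = grad \<phi> x $ i" for x
      using S(2,4) by (cases "x \<in> \<Omega>") auto
    then show ?thesis using assms(2) by (simp only: integral_restrict_space Int_UNIV_right space_completion space_lborel space_borel)
  qed
  ultimately show ?thesis using mg by (simp add: integral_completion)
qed

lemma bump_one_tendsto:
  assumes "filterlim s at_top sequentially"
  shows "(\<lambda>n. bump 1 (s n)) \<longlonglongrightarrow> 1"
proof -
  have "(\<lambda>n. exp (- inverse (s n))) \<longlonglongrightarrow> exp (- 0)"
    by (intro tendsto_exp tendsto_minus filterlim_compose[OF tendsto_inverse_0_at_top assms]) (rule filterlim_ident)
  moreover have "\<forall>\<^sub>F n in sequentially. exp (- inverse (s n)) = bump 1 (s n)"
    using filterlim_at_top_dense[THEN iffD1, OF assms, rule_format, of 0]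
    by eventually_elim (simp add: bump_def inverse_eq_divide)
  ultimately show ?thesis using Lim_transform_eventually by fastforce
qed

lemma bump_one_bounds: "0 \<le> bump 1 t" "bump 1 t \<le> 1" "bump 1 t > 0 \<longleftrightarrow> t > 0"
  by (auto simp: bump_def)

text \<open>Cover the open set by countably many balls whose closures lie inside, add up one bump per ball,
  and apply a rescaled bump to the growing sums.\<close>

lemma test_functions_tendsto_indicator:
  fixes U :: "(real^'d) set"
  assumes U: "open U" "U \<noteq> {}"
  obtains \<phi> where "\<And>n. \<phi> n \<in> test_functions U" "\<And>n x. 0 \<le> \<phi> n x" "\<And>n x. \<phi> n x \<le> 1"
    "\<And>x. (\<lambda>n. \<phi> n x) \<longlonglongrightarrow> indicat_real U x"
proof -
  define F where "F = {ball x r | x r. r > 0 \<and> cball x r \<subseteq> U}"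
  have FU: "\<Union>F = U"
  proof
    show "U \<subseteq> \<Union>F"
    proof
      fix x assume "x \<in> U"
      then obtain r where "r > 0" "cball x r \<subseteq> U"
        using U(1) open_contains_cball by blast
      then have "ball x r \<in> F" "x \<in> ball x r" by (auto simp: F_def)
      then show "x \<in> \<Union>F" by blast
    qed
    show "\<Union>F \<subseteq> U" using ball_subset_cball by (fastforce simp: F_def)
  qed
  have "\<And>S. S \<in> F \<Longrightarrow> open S" by (auto simp: F_def)
  then obtain F' where F': "F' \<subseteq> F" "countable F'" "\<Union>F' = \<Union>F" using Lindelof by metis
  have "F' \<noteq> {}" using F'(3) FU U(2) by auto
  define b where "b = from_nat_into F'"
  have range_b: "range b = F'"
    unfolding b_def using F'(2) \<open>F' \<noteq> {}\<close> by (rule range_from_nat_into[rotated])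
  then have "\<forall>j. \<exists>x r. b j = ball x r \<and> r > 0 \<and> cball x r \<subseteq> U"
    using F'(1) unfolding F_def by blast
  then obtain c r where b: "\<And>j. b j = ball (c j) (r j)" "\<And>j. r j > 0" "\<And>j. cball (c j) (r j) \<subseteq> U"
    by metis
  \<comment> \<open>Equals r_j^2 - |x - c_j|^2, which is positive exactly on the ball; spelled out
    in coordinates so that the closure rules for \<open>smooth\<close> apply.\<close>
  define P where "P j x = (r j)\<^sup>2 + (\<Sum>i\<in>UNIV. (- 1) * ((x $ i + - (c j $ i)) * (x $ i + - (c j $ i))))" for j and x :: "real^'d"
  have P: "P j x = (r j)\<^sup>2 - (dist x (c j))\<^sup>2" for j x
    by (simp add: P_def dist_norm norm_vec_def L2_set_def sum_nonneg sum_negf power2_eq_square)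
  have Ppos: "P j x > 0 \<longleftrightarrow> x \<in> b j" for j x
    using b(2)[of j] by (auto simp: P b(1) dist_commute[of x] intro: power2_less_imp_less power_strict_mono)
  define s where "s n x = (\<Sum>j<n. bump 1 (P j x))" for n x
  \<comment> \<open>At a point of U the sums are eventually bounded away from 0, so the factor n
    drives the argument to infinity, where the bump tends to 1.\<close>
  define \<phi> where "\<phi> n x = bump 1 (real n * s n x)" for n x
  have smP: "smooth (P j)" for j
    unfolding P_def by (intro smooth_add smooth_sum smooth_mult smooth_const smooth_nth)
  have sm: "smooth (\<phi> n)" for n
    unfolding \<phi>_def s_def by (intro smooth_bump_compose smooth_mult smooth_sum smooth_const smP)
  have s0: "s n x = 0" if "\<And>j. j < n \<Longrightarrow> x \<notin> b j" for n x
    unfolding s_def using that Ppos by (intro sum.neutral) (auto simp: bump_def)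
  show ?thesis
  proof
    show "\<phi> n \<in> test_functions U" for n
    proof (rule test_functionsI[OF sm])
      show "compact (\<Union>j<n. cball (c j) (r j))" by auto
      show "(\<Union>j<n. cball (c j) (r j)) \<subseteq> U" using b(3) by auto
      show "{x. \<phi> n x \<noteq> 0} \<subseteq> (\<Union>j<n. cball (c j) (r j))"
      proof safe
        fix x assume "\<phi> n x \<noteq> 0"
        then have "s n x \<noteq> 0" by (auto simp: \<phi>_def bump_def)
        then obtain j where "j < n" "x \<in> b j" using s0 by blast
        then show "x \<in> (\<Union>j<n. cball (c j) (r j))" using b(1)[of j] by (auto intro!: bexI[of _ j])
      qed
    qed
    show "0 \<le> \<phi> n x" "\<phi> n x \<le> 1" for n x by (simp_all add: \<phi>_def bump_one_bounds)
    show "(\<lambda>n. \<phi> n x) \<longlonglongrightarrow> indicat_real U x" for x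
    proof (cases "x \<in> U")
      case False
      have "x \<notin> b j" for j using False range_b F'(3) FU by auto
      then have "\<phi> n x = 0" for n by (simp add: \<phi>_def s0 bump_def)
      then show ?thesis using False by simp
    next
      case True
      then obtain j where j: "x \<in> b j" using range_b F'(3) FU by auto
      define \<epsilon> where "\<epsilon> = bump 1 (P j x)"
      have \<epsilon>: "\<epsilon> > 0" using j Ppos bump_one_bounds(3) by (simp add: \<epsilon>_def)
      have ge: "\<epsilon> \<le> s n x" if "n > j" for n
        unfolding s_def \<epsilon>_def using that by (intro member_le_sum) (auto simp: bump_one_bounds)
      have "\<forall>\<^sub>F n in sequentially. real n * \<epsilon> \<le> real n * s n x"
        using eventually_gt_at_top[of j] by eventually_elim (simp add: ge mult_left_mono)
      moreover have "filterlim (\<lambda>n. real n * \<epsilon>) at_top sequentially"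
        using \<epsilon> by (intro filterlim_at_top_mult_tendsto_pos[OF tendsto_const _ filterlim_real_sequentially])
      ultimately have "filterlim (\<lambda>n. real n * s n x) at_top sequentially"
        by (rule filterlim_at_top_mono[rotated])
      then show ?thesis using True unfolding \<phi>_def by (simp add: bump_one_tendsto)
    qed
  qed
qed

section \<open>Weak derivatives\<close>

lemma L2_mono:
  assumes "f \<in> L2 \<Omega>" "S \<subseteq> \<Omega>" "S \<in> sets lebesgue" "\<Omega> \<in> sets lebesgue"
  shows "f \<in> L2 S"
proof -
  have "f \<in> borel_measurable (lebesgue_on S)"
    using measurable_restrict_mono[OF L2_measurable[OF assms(1)] assms(2)] .
  moreover have "integrable lebesgue (\<lambda>x. indicat_real \<Omega> x *\<^sub>R (norm (f x))\<^sup>2)"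
    using L2_square_integrable[OF assms(1)] assms(4) by (simp add: integrable_restrict_space)
  from integrable_mult_indicator[OF assms(3) this]
  have "integrable lebesgue (\<lambda>x. indicat_real S x *\<^sub>R (norm (f x))\<^sup>2)"
    by (rule back_subst[where P = "integrable lebesgue"]) (use assms(2) in \<open>auto simp: indicator_def fun_eq_iff\<close>)
  then have "integrable (lebesgue_on S) (\<lambda>x. (norm (f x))\<^sup>2)"
    using assms(3) by (simp add: integrable_restrict_space)
  ultimately show ?thesis by (simp add: L2_def)
qed

lemma integral_lebesgue_on_support:
  fixes g :: "real^'d \<Rightarrow> real"
  assumes "S \<subseteq> \<Omega>" "S \<in> sets lebesgue" "\<Omega> \<in> sets lebesgue" "\<And>x. x \<notin> S \<Longrightarrow> g x = 0"
  shows "(LINT x|lebesgue_on \<Omega>. g x) = (LINT x|lebesgue_on S. g x)"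
proof -
  have "(\<lambda>x. indicat_real \<Omega> x *\<^sub>R g x) = (\<lambda>x. indicat_real S x *\<^sub>R g x)"
    using assms(1,4) by (auto simp: indicator_def fun_eq_iff)
  then show ?thesis using assms(2,3) by (simp add: integral_restrict_space)
qed

text \<open>Test functions converging boundedly to indicators make the integral of D vanish over
  every open set. A pi-lambda argument extends this to Borel sets, completion to Lebesgue sets, and
  a density whose integrals all vanish is zero.\<close>

lemma fundamental_lemma:
  fixes D :: "real^'d \<Rightarrow> real"
  assumes \<Omega>: "open \<Omega>" "bounded \<Omega>" and D: "D \<in> L2 \<Omega>"
    and 0: "\<And>\<phi>. \<phi> \<in> test_functions \<Omega> \<Longrightarrow> (LINT x|lebesgue_on \<Omega>. D x * \<phi> x) = 0"
  shows "AE x in lebesgue_on \<Omega>. D x = 0"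
proof -
  have lm: "\<Omega> \<in> lmeasurable" using \<Omega> by (rule bounded_open_lmeasurable)
  then have ls: "\<Omega> \<in> sets lebesgue" by auto
  have Di: "integrable (lebesgue_on \<Omega>) D" using L2_imp_integrable[OF lm D] .
  define f where "f x = indicat_real \<Omega> x * D x" for x
  have fi: "integrable lebesgue f"
    using Di ls by (simp add: f_def[abs_def] integrable_restrict_space)
  have basic: "(LINT x:U|lebesgue. f x) = 0" if U: "open U" for U
  proof (cases "U \<inter> \<Omega> = {}")
    case True
    then have "(\<lambda>x. indicat_real U x *\<^sub>R f x) = (\<lambda>x. 0)" by (auto simp: f_def indicator_def fun_eq_iff)
    then show ?thesis by (simp add: set_lebesgue_integral_def)
  next
    case False
    obtain \<phi> where \<phi>: "\<And>n. \<phi> n \<in> test_functions (U \<inter> \<Omega>)" "\<And>n x. 0 \<le> \<phi> n x" "\<And>n x. \<phi> n x \<le> 1"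
      "\<And>x. (\<lambda>n. \<phi> n x) \<longlonglongrightarrow> indicat_real (U \<inter> \<Omega>) x"
      by (rule test_functions_tendsto_indicator[OF open_Int[OF U \<Omega>(1)] False]) (rule that)
    have "(\<lambda>n. LINT x|lebesgue_on \<Omega>. D x * \<phi> n x) \<longlonglongrightarrow> (LINT x|lebesgue_on \<Omega>. D x * indicat_real (U \<inter> \<Omega>) x)"
    proof (rule integral_dominated_convergence[where w = "\<lambda>x. \<bar>D x\<bar>"])
      show "(\<lambda>x. D x * indicat_real (U \<inter> \<Omega>) x) \<in> borel_measurable (lebesgue_on \<Omega>)"
        using L2_measurable[OF D] that \<Omega>(1)
        by (intro borel_measurable_times borel_measurable_indicator)
          (auto simp: sets_restrict_space_iff ls)
      show "(\<lambda>x. D x * \<phi> n x) \<in> borel_measurable (lebesgue_on \<Omega>)" for n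
        using L2_measurable[OF D] L2_measurable[OF test_functions_L2[OF lm \<phi>(1)]]
        by (intro borel_measurable_times)
      show "AE x in lebesgue_on \<Omega>. (\<lambda>n. D x * \<phi> n x) \<longlonglongrightarrow> D x * indicat_real (U \<inter> \<Omega>) x"
        by (intro AE_I2 tendsto_mult_left \<phi>(4))
      show "AE x in lebesgue_on \<Omega>. norm (D x * \<phi> n x) \<le> \<bar>D x\<bar>" for n
        using \<phi>(2,3)[of n] by (auto simp: abs_mult intro!: mult_left_le)
    qed (use Di in auto)
    moreover have "(LINT x|lebesgue_on \<Omega>. D x * \<phi> n x) = 0" for n
      using \<phi>(1)[of n] test_functions_mono[of "U \<inter> \<Omega>" \<Omega>] by (intro 0) auto
    ultimately have "(LINT x|lebesgue_on \<Omega>. D x * indicat_real (U \<inter> \<Omega>) x) = 0"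
      by (simp add: LIMSEQ_const_iff)
    then have "(LINT x|lebesgue. indicat_real \<Omega> x *\<^sub>R (D x * indicat_real (U \<inter> \<Omega>) x)) = 0"
      using ls by (simp add: integral_restrict_space)
    moreover have "(\<lambda>x. indicat_real \<Omega> x *\<^sub>R (D x * indicat_real (U \<inter> \<Omega>) x)) = (\<lambda>x. indicat_real U x *\<^sub>R f x)"
      by (auto simp: f_def indicator_def fun_eq_iff)
    ultimately show ?thesis by (simp add: set_lebesgue_integral_def)
  qed
  have si: "set_integrable lebesgue A f" if "A \<in> sets lebesgue" for A
    unfolding set_integrable_def using that fi by (rule integrable_mult_indicator)
  have borel: "(LINT x:A|lebesgue. f x) = 0" if "A \<in> sets borel" for A
  proof -
    have sb: "sigma_sets UNIV {S::(real^'d) set. open S} = sets borel"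
      by (simp add: borel_def)
    have "A \<in> sigma_sets UNIV {S. open S}" using that sb by simp
    \<comment> \<open>Open sets are stable under intersection and generate the Borel sets, so
      Dynkin's induction only asks for complements and disjoint unions.\<close>
    have "Int_stable {S::(real^'d) set. open S}" "{S::(real^'d) set. open S} \<subseteq> Pow UNIV"
      by (auto simp: Int_stable_def)
    from this \<open>A \<in> sigma_sets UNIV {S. open S}\<close> show ?thesis
    proof (induction rule: sigma_sets_induct_disjoint)
      case (basic A)
      then show ?case using \<open>\<And>U. open U \<Longrightarrow> (LINT x:U|lebesgue. f x) = 0\<close> by simp
    next
      case empty
      show ?case by (simp add: set_lebesgue_integral_def)
    next
      case (compl A)
      then have A: "A \<in> sets lebesgue" using sb by auto
      have "(LINT x:UNIV|lebesgue. f x) = (LINT x:A|lebesgue. f x) + (LINT x:UNIV - A|lebesgue. f x)"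
        using A si Compl_in_sets_lebesgue[of A]
        by (subst set_integral_Un[symmetric]) (auto simp: Compl_eq_Diff_UNIV)
      moreover have "(LINT x:UNIV|lebesgue. f x) = 0" by (rule basic) simp
      ultimately show ?case using compl by simp
    next
      case (union A)
      then have A: "A i \<in> sets lebesgue" for i using sb by auto
      have "(LINT x:(\<Union>i. A i)|lebesgue. f x) = (\<Sum>i. (LINT x:(A i)|lebesgue. f x))"
        using A union(1) si by (intro lebesgue_integral_countable_add) (auto simp: disjoint_family_on_def)
      then show ?case using union by simp
    qed
  qed
  have "AE x in lebesgue. f x = 0"
  proof (rule density_unique_real[OF fi])
    show "integrable lebesgue (\<lambda>x::real^'d. 0::real)" by simp
    fix A :: "(real^'d) set" assume A: "A \<in> sets lebesgue"
    \<comment> \<open>A Lebesgue set differs from a Borel set by a subset of a null set.\<close>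
    then obtain S N N' where S: "A = S \<union> N" "N \<subseteq> N'" "N' \<in> null_sets lborel" "S \<in> sets lborel"
      by (auto elim: sets_completionE)
    have "(LINT x:A|lebesgue. f x) = (LINT x:S|lebesgue. f x)"
      unfolding set_lebesgue_integral_def
    proof (rule integral_cong_AE)
      show "(\<lambda>x. indicat_real A x *\<^sub>R f x) \<in> borel_measurable lebesgue"
        using si[OF A] unfolding set_integrable_def by (rule borel_measurable_integrable)
      show "(\<lambda>x. indicat_real S x *\<^sub>R f x) \<in> borel_measurable lebesgue"
        using si[of S] S(4) unfolding set_integrable_def by (intro borel_measurable_integrable) auto
      have "N' \<in> null_sets lebesgue" using S(3) by (rule null_sets_completionI)
      from AE_not_in[OF this] show "AE x in lebesgue. indicat_real A x *\<^sub>R f x = indicat_real S x *\<^sub>R f x"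
        by eventually_elim (use S(1,2) in \<open>auto simp: indicator_def\<close>)
    qed
    also have "\<dots> = 0" using borel S(4) by simp
    finally show "(LINT x:A|lebesgue. f x) = (LINT x:A|lebesgue. 0)" by simp
  qed
  then show ?thesis
    using ls by (subst AE_restrict_space_iff) (auto simp: f_def indicator_def elim!: eventually_mono)
qed

text \<open>\<open>weak_grad\<close> is a chosen representative, so a property of it is obtained by
  exhibiting some weak gradient with that property and appealing to uniqueness.\<close>

lemma has_weak_grad_unique:
  assumes "open \<Omega>" "bounded \<Omega>" "has_weak_grad \<Omega> f G" "has_weak_grad \<Omega> f G'"
  shows "AE x in lebesgue_on \<Omega>. G x = G' x"
proof -
  have lm: "\<Omega> \<in> lmeasurable" using assms(1,2) by (rule bounded_open_lmeasurable)
  have L: "G \<in> L2 \<Omega>" "G' \<in> L2 \<Omega>" using assms(3,4) by (auto simp: has_weak_grad_def)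
  have "AE x in lebesgue_on \<Omega>. G x $ i - G' x $ i = 0" for i
  proof (rule fundamental_lemma[OF assms(1,2)])
    show "(\<lambda>x. G x $ i - G' x $ i) \<in> L2 \<Omega>" by (intro L2_diff L2_nth L)
    fix \<phi> assume \<phi>: "\<phi> \<in> test_functions \<Omega>"
    have I: "integrable (lebesgue_on \<Omega>) (\<lambda>x. G x $ i * \<phi> x)" "integrable (lebesgue_on \<Omega>) (\<lambda>x. G' x $ i * \<phi> x)"
      by (intro L2_mult_integrable L2_nth L test_functions_L2[OF lm \<phi>])+
    show "(LINT x|lebesgue_on \<Omega>. (G x $ i - G' x $ i) * \<phi> x) = 0"
      using assms(3,4) \<phi> I by (simp add: has_weak_grad_def left_diff_distrib)
  qed
  then have "AE x in lebesgue_on \<Omega>. \<forall>i. G x $ i - G' x $ i = 0" by (rule eventually_all_finite)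
  then show ?thesis by eventually_elim (simp add: vec_eq_iff)
qed

lemma has_weak_div_unique:
  assumes "open \<Omega>" "bounded \<Omega>" "has_weak_div \<Omega> z w" "has_weak_div \<Omega> z w'"
  shows "AE x in lebesgue_on \<Omega>. w x = w' x"
proof -
  have lm: "\<Omega> \<in> lmeasurable" using assms(1,2) by (rule bounded_open_lmeasurable)
  have L: "w \<in> L2 \<Omega>" "w' \<in> L2 \<Omega>" using assms(3,4) by (auto simp: has_weak_div_def)
  have "AE x in lebesgue_on \<Omega>. w x - w' x = 0"
  proof (rule fundamental_lemma[OF assms(1,2)])
    show "(\<lambda>x. w x - w' x) \<in> L2 \<Omega>" by (intro L2_diff L)
    fix \<phi> assume \<phi>: "\<phi> \<in> test_functions \<Omega>"
    have I: "integrable (lebesgue_on \<Omega>) (\<lambda>x. w x * \<phi> x)" "integrable (lebesgue_on \<Omega>) (\<lambda>x. w' x * \<phi> x)"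
      by (intro L2_mult_integrable L test_functions_L2[OF lm \<phi>])+
    show "(LINT x|lebesgue_on \<Omega>. (w x - w' x) * \<phi> x) = 0"
      using assms(3,4) \<phi> I by (simp add: has_weak_div_def left_diff_distrib)
  qed
  then show ?thesis by simp
qed

lemma H1_weak_grad: "f \<in> H1 \<Omega> \<Longrightarrow> has_weak_grad \<Omega> f (weak_grad \<Omega> f)"
  unfolding H1_def weak_grad_def using someI_ex[of "has_weak_grad \<Omega> f"] by simp

lemma H1_L2: "f \<in> H1 \<Omega> \<Longrightarrow> f \<in> L2 \<Omega>"
  by (simp add: H1_def)

lemma weak_grad_L2: "f \<in> H1 \<Omega> \<Longrightarrow> weak_grad \<Omega> f \<in> L2 \<Omega>"
  using H1_weak_grad by (auto simp: has_weak_grad_def)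

lemma H_div_weak_div: "z \<in> H_div \<Omega> \<Longrightarrow> has_weak_div \<Omega> z (weak_div \<Omega> z)"
  unfolding H_div_def weak_div_def using someI_ex[of "has_weak_div \<Omega> z"] by simp

lemma H_div_L2: "z \<in> H_div \<Omega> \<Longrightarrow> z \<in> L2 \<Omega>"
  by (simp add: H_div_def)

lemma weak_div_L2: "z \<in> H_div \<Omega> \<Longrightarrow> weak_div \<Omega> z \<in> L2 \<Omega>"
  using H_div_weak_div by (auto simp: has_weak_div_def)

lemma grad_L2: "\<Omega> \<in> lmeasurable \<Longrightarrow> \<phi> \<in> test_functions \<Omega> \<Longrightarrow> grad \<phi> \<in> L2 \<Omega>"
  using L2_vecI test_functions_L2[OF _ test_functions_grad] by blast

lemma L2_lincomb:
  "f \<in> L2 \<Omega> \<Longrightarrow> g \<in> L2 \<Omega> \<Longrightarrow> (\<lambda>x. a *\<^sub>R f x + b *\<^sub>R g x) \<in> L2 \<Omega>"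
  by (intro L2_add L2_scaleR)

lemma L2_lincomb_real:
  fixes f g :: "real^'d \<Rightarrow> real"
  shows "f \<in> L2 \<Omega> \<Longrightarrow> g \<in> L2 \<Omega> \<Longrightarrow> (\<lambda>x. a * f x + b * g x) \<in> L2 \<Omega>"
  using L2_lincomb[of f \<Omega> g a b] by simp

lemma has_weak_grad_lincomb:
  assumes lm: "\<Omega> \<in> lmeasurable" and f: "f \<in> L2 \<Omega>" "has_weak_grad \<Omega> f F"
    and g: "g \<in> L2 \<Omega>" "has_weak_grad \<Omega> g G"
  shows "has_weak_grad \<Omega> (\<lambda>x. a * f x + b * g x) (\<lambda>x. a *\<^sub>R F x + b *\<^sub>R G x)"
  unfolding has_weak_grad_def
proof (intro conjI ballI allI)
  have L: "F \<in> L2 \<Omega>" "G \<in> L2 \<Omega>" using f(2) g(2) by (auto simp: has_weak_grad_def)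
  then show "(\<lambda>x. a *\<^sub>R F x + b *\<^sub>R G x) \<in> L2 \<Omega>" by (rule L2_lincomb)
  fix \<phi> i assume \<phi>: "\<phi> \<in> test_functions \<Omega>"
  have "integrable (lebesgue_on \<Omega>) (\<lambda>x. f x * grad \<phi> x $ i)" "integrable (lebesgue_on \<Omega>) (\<lambda>x. g x * grad \<phi> x $ i)"
    "integrable (lebesgue_on \<Omega>) (\<lambda>x. F x $ i * \<phi> x)" "integrable (lebesgue_on \<Omega>) (\<lambda>x. G x $ i * \<phi> x)"
    by (intro L2_mult_integrable f g L2_nth L grad_L2[OF lm \<phi>] test_functions_L2[OF lm \<phi>])+
  then show "(LINT x|lebesgue_on \<Omega>. (a * f x + b * g x) * grad \<phi> x $ i)
      = - (LINT x|lebesgue_on \<Omega>. (a *\<^sub>R F x + b *\<^sub>R G x) $ i * \<phi> x)"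
    using f(2) g(2) \<phi> by (simp add: has_weak_grad_def distrib_right mult.assoc)
qed

lemma has_weak_div_lincomb:
  assumes lm: "\<Omega> \<in> lmeasurable" and f: "f \<in> L2 \<Omega>" "has_weak_div \<Omega> f F"
    and g: "g \<in> L2 \<Omega>" "has_weak_div \<Omega> g G"
  shows "has_weak_div \<Omega> (\<lambda>x. a *\<^sub>R f x + b *\<^sub>R g x) (\<lambda>x. a * F x + b * G x)"
  unfolding has_weak_div_def
proof (intro conjI ballI)
  have L: "F \<in> L2 \<Omega>" "G \<in> L2 \<Omega>" using f(2) g(2) by (auto simp: has_weak_div_def)
  then show "(\<lambda>x. a * F x + b * G x) \<in> L2 \<Omega>" by (rule L2_lincomb_real)
  fix \<phi> assume \<phi>: "\<phi> \<in> test_functions \<Omega>"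
  have "integrable (lebesgue_on \<Omega>) (\<lambda>x. f x \<bullet> grad \<phi> x)" "integrable (lebesgue_on \<Omega>) (\<lambda>x. g x \<bullet> grad \<phi> x)"
    by (intro L2_inner_integrable f g grad_L2[OF lm \<phi>])+
  moreover have "integrable (lebesgue_on \<Omega>) (\<lambda>x. F x * \<phi> x)" "integrable (lebesgue_on \<Omega>) (\<lambda>x. G x * \<phi> x)"
    by (intro L2_mult_integrable L test_functions_L2[OF lm \<phi>])+
  ultimately show "(LINT x|lebesgue_on \<Omega>. (a *\<^sub>R f x + b *\<^sub>R g x) \<bullet> grad \<phi> x)
      = - (LINT x|lebesgue_on \<Omega>. (a * F x + b * G x) * \<phi> x)"
    using f(2) g(2) \<phi> by (simp add: has_weak_div_def distrib_right mult.assoc inner_add_left)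
qed

lemma H1_lincomb:
  assumes "\<Omega> \<in> lmeasurable" "f \<in> H1 \<Omega>" "g \<in> H1 \<Omega>"
  shows "(\<lambda>x. a * f x + b * g x) \<in> H1 \<Omega>"
  using has_weak_grad_lincomb[OF assms(1) H1_L2[OF assms(2)] H1_weak_grad[OF assms(2)]
      H1_L2[OF assms(3)] H1_weak_grad[OF assms(3)]] L2_lincomb_real[OF assms(2,3)[THEN H1_L2]]
  by (auto simp: H1_def)

lemma weak_grad_lincomb:
  assumes "open \<Omega>" "bounded \<Omega>" "f \<in> H1 \<Omega>" "g \<in> H1 \<Omega>"
  shows "AE x in lebesgue_on \<Omega>. weak_grad \<Omega> (\<lambda>x. a * f x + b * g x) x
    = a *\<^sub>R weak_grad \<Omega> f x + b *\<^sub>R weak_grad \<Omega> g x"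
  using bounded_open_lmeasurable[OF assms(1,2)] assms
  by (intro has_weak_grad_unique[OF assms(1,2) H1_weak_grad has_weak_grad_lincomb] H1_lincomb H1_L2 H1_weak_grad)

lemma H_div_lincomb:
  assumes "\<Omega> \<in> lmeasurable" "f \<in> H_div \<Omega>" "g \<in> H_div \<Omega>"
  shows "(\<lambda>x. a *\<^sub>R f x + b *\<^sub>R g x) \<in> H_div \<Omega>"
  using has_weak_div_lincomb[OF assms(1) H_div_L2[OF assms(2)] H_div_weak_div[OF assms(2)]
      H_div_L2[OF assms(3)] H_div_weak_div[OF assms(3)]] L2_lincomb[OF assms(2,3)[THEN H_div_L2]]
  by (auto simp: H_div_def)

lemma weak_div_lincomb:
  assumes "open \<Omega>" "bounded \<Omega>" "f \<in> H_div \<Omega>" "g \<in> H_div \<Omega>"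
  shows "AE x in lebesgue_on \<Omega>. weak_div \<Omega> (\<lambda>x. a *\<^sub>R f x + b *\<^sub>R g x) x
    = a * weak_div \<Omega> f x + b * weak_div \<Omega> g x"
  using bounded_open_lmeasurable[OF assms(1,2)] assms
  by (intro has_weak_div_unique[OF assms(1,2) H_div_weak_div has_weak_div_lincomb] H_div_lincomb H_div_L2 H_div_weak_div)

lemma l2_tendsto_lincomb:
  assumes "(\<lambda>m. l2_norm \<Omega> (\<lambda>x. \<phi> m x - f x)) \<longlonglongrightarrow> 0" "\<And>m. \<phi> m \<in> L2 \<Omega>" "f \<in> L2 \<Omega>"
    and "(\<lambda>m. l2_norm \<Omega> (\<lambda>x. \<psi> m x - g x)) \<longlonglongrightarrow> 0" "\<And>m. \<psi> m \<in> L2 \<Omega>" "g \<in> L2 \<Omega>"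
  shows "(\<lambda>m. l2_norm \<Omega> (\<lambda>x. (a *\<^sub>R \<phi> m x + b *\<^sub>R \<psi> m x) - (a *\<^sub>R f x + b *\<^sub>R g x))) \<longlonglongrightarrow> 0"
proof (rule Lim_null_comparison)
  show "(\<lambda>m. \<bar>a\<bar> * l2_norm \<Omega> (\<lambda>x. \<phi> m x - f x) + \<bar>b\<bar> * l2_norm \<Omega> (\<lambda>x. \<psi> m x - g x)) \<longlonglongrightarrow> 0"
    by (intro tendsto_add_zero tendsto_mult_right_zero assms)
  have "l2_norm \<Omega> (\<lambda>x. (a *\<^sub>R \<phi> m x + b *\<^sub>R \<psi> m x) - (a *\<^sub>R f x + b *\<^sub>R g x))
      \<le> \<bar>a\<bar> * l2_norm \<Omega> (\<lambda>x. \<phi> m x - f x) + \<bar>b\<bar> * l2_norm \<Omega> (\<lambda>x. \<psi> m x - g x)" for m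
  proof -
    have "(\<lambda>x. (a *\<^sub>R \<phi> m x + b *\<^sub>R \<psi> m x) - (a *\<^sub>R f x + b *\<^sub>R g x))
        = (\<lambda>x. a *\<^sub>R (\<phi> m x - f x) + b *\<^sub>R (\<psi> m x - g x))"
      by (simp add: algebra_simps)
    then show ?thesis
      using l2_norm_triangle[OF L2_scaleR[OF L2_diff[OF assms(2,3)]] L2_scaleR[OF L2_diff[OF assms(5,6)]], of a m b m]
      by (simp add: l2_norm_scaleR)
  qed
  then show "\<forall>\<^sub>F m in sequentially. norm (l2_norm \<Omega> (\<lambda>x. (a *\<^sub>R \<phi> m x + b *\<^sub>R \<psi> m x) - (a *\<^sub>R f x + b *\<^sub>R g x)))
      \<le> \<bar>a\<bar> * l2_norm \<Omega> (\<lambda>x. \<phi> m x - f x) + \<bar>b\<bar> * l2_norm \<Omega> (\<lambda>x. \<psi> m x - g x)"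
    by (simp add: l2_norm_nonneg)
qed

lemma H1_0_H1: "f \<in> H1_0 \<Omega> \<Longrightarrow> f \<in> H1 \<Omega>"
  by (simp add: H1_0_def)

lemma H1_0_lincomb:
  assumes \<Omega>: "open \<Omega>" "bounded \<Omega>" and f: "f \<in> H1_0 \<Omega>" and g: "g \<in> H1_0 \<Omega>"
  shows "(\<lambda>x. a * f x + b * g x) \<in> H1_0 \<Omega>"
proof -
  have lm: "\<Omega> \<in> lmeasurable" using \<Omega> by (rule bounded_open_lmeasurable)
  obtain \<phi> where \<phi>: "\<And>m::nat. \<phi> m \<in> test_functions \<Omega>" "(\<lambda>m. l2_norm \<Omega> (\<lambda>x. \<phi> m x - f x)) \<longlonglongrightarrow> 0"
      "(\<lambda>m. l2_norm \<Omega> (\<lambda>x. grad (\<phi> m) x - weak_grad \<Omega> f x)) \<longlonglongrightarrow> 0"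
    using f unfolding H1_0_def by blast
  obtain \<psi> where \<psi>: "\<And>m::nat. \<psi> m \<in> test_functions \<Omega>" "(\<lambda>m. l2_norm \<Omega> (\<lambda>x. \<psi> m x - g x)) \<longlonglongrightarrow> 0"
      "(\<lambda>m. l2_norm \<Omega> (\<lambda>x. grad (\<psi> m) x - weak_grad \<Omega> g x)) \<longlonglongrightarrow> 0"
    using g unfolding H1_0_def by blast
  note f1 = H1_0_H1[OF f] and g1 = H1_0_H1[OF g]
  define h where "h = (\<lambda>x. a * f x + b * g x)"
  have h1: "h \<in> H1 \<Omega>" unfolding h_def by (rule H1_lincomb[OF lm f1 g1])
  define \<Phi> where "\<Phi> m x = a * \<phi> m x + b * \<psi> m x" for m x
  have smc: "smooth (\<lambda>x. c * \<phi>' x)" if "smooth \<phi>'" for c \<phi>'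
    using that by (intro smooth_mult smooth_const)
  have \<Phi>: "\<Phi> m \<in> test_functions \<Omega>" for m
    unfolding \<Phi>_def by (intro test_functions_add test_functions_mult \<phi> \<psi> smooth_const)
  have g\<Phi>: "grad (\<Phi> m) x = a *\<^sub>R grad (\<phi> m) x + b *\<^sub>R grad (\<psi> m) x" for m x
    unfolding \<Phi>_def vec_eq_iff
    using \<phi>(1)[THEN test_functions_smooth] \<psi>(1)[THEN test_functions_smooth]
    by (simp add: grad_add_nth smooth_differentiable smc grad_mult_nth smooth_const grad_const_nth)
  have "(\<lambda>m. l2_norm \<Omega> (\<lambda>x. \<Phi> m x - h x)) \<longlonglongrightarrow> 0"
    using l2_tendsto_lincomb[OF \<phi>(2) test_functions_L2[OF lm \<phi>(1)] H1_L2[OF f1]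
        \<psi>(2) test_functions_L2[OF lm \<psi>(1)] H1_L2[OF g1], of a b]
    by (simp add: \<Phi>_def h_def)
  moreover have "(\<lambda>m. l2_norm \<Omega> (\<lambda>x. grad (\<Phi> m) x - weak_grad \<Omega> h x)) \<longlonglongrightarrow> 0"
  proof -
    \<comment> \<open>The chosen weak gradient is linear only up to a null set, which the norm does
      not see.\<close>
    have "l2_norm \<Omega> (\<lambda>x. grad (\<Phi> m) x - weak_grad \<Omega> h x) = l2_norm \<Omega> (\<lambda>x.
        (a *\<^sub>R grad (\<phi> m) x + b *\<^sub>R grad (\<psi> m) x) - (a *\<^sub>R weak_grad \<Omega> f x + b *\<^sub>R weak_grad \<Omega> g x))" for m
    proof (rule l2_norm_cong_AE)
      show "AE x in lebesgue_on \<Omega>. grad (\<Phi> m) x - weak_grad \<Omega> h x =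
        (a *\<^sub>R grad (\<phi> m) x + b *\<^sub>R grad (\<psi> m) x) - (a *\<^sub>R weak_grad \<Omega> f x + b *\<^sub>R weak_grad \<Omega> g x)"
        using weak_grad_lincomb[OF \<Omega> f1 g1, of a b] unfolding h_def[symmetric]
        by eventually_elim (simp add: g\<Phi>)
    qed (intro L2_diff L2_lincomb grad_L2[OF lm] weak_grad_L2 \<Phi> h1 \<phi> \<psi> f1 g1)+
    then show ?thesis
      using l2_tendsto_lincomb[OF \<phi>(3) grad_L2[OF lm \<phi>(1)] weak_grad_L2[OF f1]
        \<psi>(3) grad_L2[OF lm \<psi>(1)] weak_grad_L2[OF g1], of a b] by simp
  qed
  ultimately show ?thesis
    using h1 \<Phi> unfolding H1_0_def h_def by blast
qed

text \<open>Obtained by adding the defining identities of the diagonal derivatives; it places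
  \<open>V_h\<close> inside \<open>H_div\<close>.\<close>

lemma H1_has_weak_div:
  assumes lm: "\<Omega> \<in> lmeasurable" and u: "\<And>i. (\<lambda>x. u x $ i) \<in> H1 \<Omega>"
  shows "has_weak_div \<Omega> u (\<lambda>x. \<Sum>i\<in>UNIV. weak_grad \<Omega> (\<lambda>y. u y $ i) x $ i)"
  unfolding has_weak_div_def
proof (intro conjI ballI)
  show "(\<lambda>x. \<Sum>i\<in>UNIV. weak_grad \<Omega> (\<lambda>y. u y $ i) x $ i) \<in> L2 \<Omega>"
    by (intro L2_sum L2_nth weak_grad_L2 u)
  fix \<phi> assume \<phi>: "\<phi> \<in> test_functions \<Omega>"
  have "integrable (lebesgue_on \<Omega>) (\<lambda>x. u x $ i * grad \<phi> x $ i)"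
    "integrable (lebesgue_on \<Omega>) (\<lambda>x. weak_grad \<Omega> (\<lambda>y. u y $ i) x $ i * \<phi> x)" for i
    by (intro L2_mult_integrable H1_L2[OF u] L2_nth weak_grad_L2 u grad_L2[OF lm \<phi>] test_functions_L2[OF lm \<phi>])+
  then show "(LINT x|lebesgue_on \<Omega>. u x \<bullet> grad \<phi> x)
      = - (LINT x|lebesgue_on \<Omega>. (\<Sum>i\<in>UNIV. weak_grad \<Omega> (\<lambda>y. u y $ i) x $ i) * \<phi> x)"
    using H1_weak_grad[OF u] \<phi>
    by (simp add: has_weak_grad_def inner_vec_def sum_distrib_right sum_negf)
qed

lemma H1_H_div: "\<Omega> \<in> lmeasurable \<Longrightarrow> (\<And>i. (\<lambda>x. u x $ i) \<in> H1 \<Omega>) \<Longrightarrow> u \<in> H_div \<Omega>"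
  using H1_has_weak_div[of \<Omega> u] L2_vecI[OF H1_L2, of u \<Omega>] by (auto simp: H_div_def)

text \<open>Makes div u piecewise constant for u in \<open>V_h\<close>. Test functions supported in
  the open cell are admissible on the whole domain, and there u is a smooth affine field, so
  integration by parts produces the trace of \<open>A\<close>.\<close>

lemma weak_div_affine_cell:
  fixes u :: "real^'d \<Rightarrow> real^'d" and A :: "real^'d^'d"
  assumes \<Omega>: "open \<Omega>" "bounded \<Omega>" and u: "u \<in> H_div \<Omega>"
    and K: "convex K" "interior K \<subseteq> \<Omega>" "compact K"
    and eq: "AE x in lebesgue_on K. u x = a + A *v x"
  shows "AE x in lebesgue_on K. weak_div \<Omega> u x = trace A"
proof -
  define I where "I = interior K"
  have I: "open I" "bounded I" "I \<subseteq> \<Omega>" using K(2) \<Omega>(2) by (auto simp: I_def bounded_subset)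
  have lm: "\<Omega> \<in> lmeasurable" "I \<in> lmeasurable"
    using \<Omega> I by (auto intro: bounded_open_lmeasurable)
  have ls: "\<Omega> \<in> sets lebesgue" "I \<in> sets lebesgue" using lm by auto
  define w where "w = weak_div \<Omega> u"
  have w: "w \<in> L2 I" using L2_mono[OF weak_div_L2[OF u] I(3) ls(2,1)] by (simp add: w_def)
  have uI: "u \<in> L2 I" using L2_mono[OF H_div_L2[OF u] I(3) ls(2,1)] .
  have fr: "negligible (frontier K)" using K(1) by (rule negligible_convex_frontier)
  have Kl: "K \<in> sets lebesgue" using lmeasurable_compact[OF K(3)] by auto
  have eqI: "AE x in lebesgue_on I. u x = a + A *v x"
    using eq ls Kl interior_subset[of K]
    by (auto simp: AE_restrict_space_iff I_def elim!: eventually_mono)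
  have "AE x in lebesgue_on I. w x - trace A = 0"
  proof (rule fundamental_lemma[OF I(1,2)])
    have cL: "(\<lambda>x. c) \<in> L2 I" for c :: real by (rule L2_bounded[OF lm(2)]) auto
    then show "(\<lambda>x. w x - trace A) \<in> L2 I" by (intro L2_diff w)
    fix \<phi> assume \<phi>: "\<phi> \<in> test_functions I"
    then have \<phi>\<Omega>: "\<phi> \<in> test_functions \<Omega>" using test_functions_mono[OF I(3)] by blast
    note sm = test_functions_smooth[OF \<phi>]
    obtain S where S: "compact S" "S \<subseteq> I" "\<And>x. x \<notin> S \<Longrightarrow> \<phi> x = 0" "\<And>x i. x \<notin> S \<Longrightarrow> grad \<phi> x $ i = 0"
      using test_functions_support[OF \<phi>] by metis
    have "(LINT x|lebesgue_on I. w x * \<phi> x) = (LINT x|lebesgue_on \<Omega>. w x * \<phi> x)"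
      using S(2,3) by (intro integral_lebesgue_on_support[symmetric] I ls) auto
    also have "\<dots> = - (LINT x|lebesgue_on \<Omega>. u x \<bullet> grad \<phi> x)"
      using H_div_weak_div[OF u] \<phi>\<Omega> by (simp add: has_weak_div_def w_def)
    also have "(LINT x|lebesgue_on \<Omega>. u x \<bullet> grad \<phi> x) = (LINT x|lebesgue_on I. u x \<bullet> grad \<phi> x)"
      using S(4) subsetD[OF S(2)]
      by (intro integral_lebesgue_on_support I ls) (force simp: inner_vec_def intro!: sum.neutral)
    also have "\<dots> = (LINT x|lebesgue_on I. (\<Sum>i\<in>UNIV. (a + A *v x) $ i * grad \<phi> x $ i))"
    proof (rule integral_cong_AE)
      have g: "grad \<phi> \<in> borel_measurable (lebesgue_on I)"
        using L2_measurable[OF grad_L2[OF lm(2) \<phi>]] .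
      show "(\<lambda>x. u x \<bullet> grad \<phi> x) \<in> borel_measurable (lebesgue_on I)"
        using L2_measurable[OF uI] g by (intro borel_measurable_inner)
      have "continuous_on UNIV (\<lambda>x. \<Sum>i\<in>UNIV. (a + A *v x) $ i * grad \<phi> x $ i)"
        by (intro continuous_intros smooth_continuous[OF smooth_grad[OF sm]] matrix_vector_mult_linear_continuous_on)
      then show "(\<lambda>x. \<Sum>i\<in>UNIV. (a + A *v x) $ i * grad \<phi> x $ i) \<in> borel_measurable (lebesgue_on I)"
        by (rule continuous_measurable_lebesgue_on)
      show "AE x in lebesgue_on I. u x \<bullet> grad \<phi> x = (\<Sum>i\<in>UNIV. (a + A *v x) $ i * grad \<phi> x $ i)"
        using eqI by eventually_elim (simp add: inner_vec_def)
    qed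
    also have "\<dots> = (LINT x|lebesgue_on I. - trace A * \<phi> x)"
    proof -
      define l where "l i x = a $ i + (\<Sum>j\<in>UNIV. A $ i $ j * x $ j)" for i and x :: "real^'d"
      have l: "(a + A *v x) $ i = l i x" for i x
        by (simp add: l_def matrix_vector_mult_def)
      have sl: "smooth (l i)" for i
        unfolding l_def by (intro smooth_add smooth_sum smooth_mult smooth_const smooth_nth)
      have gl: "grad (l i) x $ i = A $ i $ i" for i x
      proof -
        have "(l i has_derivative (\<lambda>h. (\<Sum>j\<in>UNIV. A $ i $ j * h $ j))) (at x)"
          unfolding l_def by (auto intro!: derivative_eq_intros bounded_linear_imp_has_derivative)
        from grad_nth_eq[OF this] show ?thesis
          by (simp add: axis_def if_distrib[where f = "\<lambda>v. _ * v"] cong: if_cong)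
      qed
      have int: "integrable (lebesgue_on I) (\<lambda>x. l i x * grad \<phi> x $ i)"
        "integrable (lebesgue_on I) (\<lambda>x. A $ i $ i * \<phi> x)" for i
        using L2_imp_integrable[OF lm(2) test_functions_L2[OF lm(2) test_functions_mult[OF test_functions_grad[OF \<phi>] sl]]]
          L2_imp_integrable[OF lm(2) test_functions_L2[OF lm(2) test_functions_mult[OF \<phi> smooth_const]]] by auto
      have "(LINT x|lebesgue_on I. l i x * grad \<phi> x $ i) = - (LINT x|lebesgue_on I. A $ i $ i * \<phi> x)" for i
      proof -
        \<comment> \<open>The integrand is the i-th derivative of the test function
          \<open>l i x * \<phi> x\<close>.\<close>
        have "(LINT x|lebesgue_on I. l i x * grad \<phi> x $ i + A $ i $ i * \<phi> x) = 0"
          using integral_grad_test_function[OF test_functions_mult[OF \<phi> sl] ls(2), of i i]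
          by (simp add: grad_mult_nth smooth_differentiable sl sm gl)
        then show ?thesis using int[of i] by simp
      qed
      moreover have "(LINT x|lebesgue_on I. (\<Sum>i\<in>UNIV. l i x * grad \<phi> x $ i))
          = (\<Sum>i\<in>UNIV. LINT x|lebesgue_on I. l i x * grad \<phi> x $ i)"
        by (rule Bochner_Integration.integral_sum) (rule int(1))
      moreover have "(LINT x|lebesgue_on I. (\<Sum>i\<in>UNIV. A $ i $ i * \<phi> x))
          = (\<Sum>i\<in>UNIV. LINT x|lebesgue_on I. A $ i $ i * \<phi> x)"
        by (rule Bochner_Integration.integral_sum) (rule int(2))
      ultimately have "(LINT x|lebesgue_on I. (\<Sum>i\<in>UNIV. l i x * grad \<phi> x $ i))
          = - (LINT x|lebesgue_on I. (\<Sum>i\<in>UNIV. A $ i $ i * \<phi> x))"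
        by (simp only: sum_negf)
      moreover have "(\<lambda>x. - trace A * \<phi> x) = (\<lambda>x. - (\<Sum>i\<in>UNIV. A $ i $ i * \<phi> x))"
        by (simp add: trace_def sum_distrib_right)
      ultimately show ?thesis by (simp only: l Bochner_Integration.integral_minus)
    qed
    finally have "(LINT x|lebesgue_on I. w x * \<phi> x) = (LINT x|lebesgue_on I. trace A * \<phi> x)"
      by simp
    moreover have "integrable (lebesgue_on I) (\<lambda>x. w x * \<phi> x)" "integrable (lebesgue_on I) (\<lambda>x. trace A * \<phi> x)"
      by (intro L2_mult_integrable w cL test_functions_L2[OF lm(2) \<phi>])+
    ultimately show "(LINT x|lebesgue_on I. (w x - trace A) * \<phi> x) = 0"
      by (simp add: left_diff_distrib)
  qed
  then have "AE x in lebesgue. x \<in> I \<longrightarrow> w x = trace A"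
    using ls by (simp add: AE_restrict_space_iff)
  \<comment> \<open>The boundary of a convex set is null, so the open cell may be replaced by the
    closed one.\<close>
  moreover have "AE x in lebesgue. x \<notin> frontier K"
    using fr by (intro AE_not_in) (simp add: negligible_iff_null_sets)
  ultimately have "AE x in lebesgue. x \<in> K \<longrightarrow> w x = trace A"
    by eventually_elim (use closure_subset in \<open>auto simp: I_def frontier_def\<close>)
  then show ?thesis using Kl by (simp add: AE_restrict_space_iff w_def)
qed

text \<open>Once grad u_j is orthogonal to all gradients of test functions, approximation in H^1_0
  gives grad u_j = 0. That u_j itself vanishes follows by testing with x_i phi, in place of a
  Poincare inequality.\<close>

lemma strain_eq_0_imp_eq_0:
  fixes u :: "real^'d \<Rightarrow> real^'d"
  assumes \<Omega>: "open \<Omega>" "bounded \<Omega>" and u: "\<And>i. (\<lambda>x. u x $ i) \<in> H1_0 \<Omega>"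
    and strain: "AE x in lebesgue_on \<Omega>. strain \<Omega> u x = 0"
  shows "AE x in lebesgue_on \<Omega>. u x = 0"
proof -
  have lm: "\<Omega> \<in> lmeasurable" using \<Omega> by (rule bounded_open_lmeasurable)
  define G where "G i = weak_grad \<Omega> (\<lambda>x. u x $ i)" for i
  note u1 = H1_0_H1[OF u]
  have G: "has_weak_grad \<Omega> (\<lambda>x. u x $ i) (G i)" for i
    unfolding G_def by (rule H1_weak_grad[OF u1])
  have GL: "G i \<in> L2 \<Omega>" for i unfolding G_def by (rule weak_grad_L2[OF u1])
  have skew: "AE x in lebesgue_on \<Omega>. \<forall>i j. G i x $ j = - G j x $ i"
    using strain
  proof eventually_elim
    case (elim x)
    have "(G i x $ j + G j x $ i) / 2 = 0" for i j
    proof -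
      have "strain \<Omega> u x $ i $ j = (G i x $ j + G j x $ i) / 2"
        by (simp add: strain_def weak_jacobian_def transpose_def G_def)
      then show ?thesis using elim by simp
    qed
    then have "G i x $ j + G j x $ i = 0" for i j by simp
    then show ?case by (intro allI) (rule eq_neg_iff_add_eq_0[THEN iffD2])
  qed
  \<comment> \<open>Both sides are, up to the same sign, the integral of u_i against one mixed
    second derivative of the test function.\<close>
  have swap: "(LINT x|lebesgue_on \<Omega>. G i x $ j * grad \<phi> x $ i) = (LINT x|lebesgue_on \<Omega>. G i x $ i * grad \<phi> x $ j)"
    if "\<phi> \<in> test_functions \<Omega>" for \<phi> i j
  proof -
    have "(LINT x|lebesgue_on \<Omega>. u x $ i * grad (\<lambda>x. grad \<phi> x $ i) x $ j) = - (LINT x|lebesgue_on \<Omega>. G i x $ j * grad \<phi> x $ i)"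
      using G[of i] test_functions_grad[OF that, of i] unfolding has_weak_grad_def by blast
    moreover have "(LINT x|lebesgue_on \<Omega>. u x $ i * grad (\<lambda>x. grad \<phi> x $ j) x $ i) = - (LINT x|lebesgue_on \<Omega>. G i x $ i * grad \<phi> x $ j)"
      using G[of i] test_functions_grad[OF that, of j] unfolding has_weak_grad_def by blast
    ultimately show ?thesis
      by (simp add: smooth_grad_commute[OF test_functions_smooth[OF that], of i _ j])
  qed
  have orth: "l2_inner \<Omega> (grad \<phi>) (G j) = 0" if \<phi>: "\<phi> \<in> test_functions \<Omega>" for \<phi> j
  proof -
    have int: "integrable (lebesgue_on \<Omega>) (\<lambda>x. G i x $ k * grad \<phi> x $ l)" for i k l
      by (intro L2_mult_integrable L2_nth GL grad_L2[OF lm \<phi>])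
    have m: "(\<lambda>x. G i x $ k * grad \<phi> x $ l) \<in> borel_measurable (lebesgue_on \<Omega>)" for i k l
      using int by (rule borel_measurable_integrable)
    have "(LINT x|lebesgue_on \<Omega>. G j x $ i * grad \<phi> x $ i) = 0" for i
    proof -
      have "(LINT x|lebesgue_on \<Omega>. G j x $ i * grad \<phi> x $ i) = (LINT x|lebesgue_on \<Omega>. - (G i x $ j * grad \<phi> x $ i))"
      proof (intro integral_cong_AE borel_measurable_uminus m)
        show "AE x in lebesgue_on \<Omega>. G j x $ i * grad \<phi> x $ i = - (G i x $ j * grad \<phi> x $ i)"
          using skew
        proof eventually_elim
          case (elim x)
          then have "G j x $ i = - G i x $ j" by blast
          then show ?case by simp
        qed
      qed
      also have "\<dots> = - (LINT x|lebesgue_on \<Omega>. G i x $ i * grad \<phi> x $ j)"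
        using swap[OF \<phi>, of i j] by simp
      \<comment> \<open>The diagonal entries of a skew matrix vanish.\<close>
      also have "AE x in lebesgue_on \<Omega>. G i x $ i * grad \<phi> x $ j = 0"
        using skew
        proof eventually_elim
          case (elim x)
          then have "G i x $ i = - G i x $ i" by blast
          then show ?case by simp
        qed
      then have "(LINT x|lebesgue_on \<Omega>. G i x $ i * grad \<phi> x $ j) = 0"
        by (rule integral_eq_zero_AE)
      finally show ?thesis by simp
    qed
    then show ?thesis
      using int by (simp add: l2_inner_def inner_vec_def mult.commute[of "grad \<phi> _ $ _"])
  qed
  have "AE x in lebesgue_on \<Omega>. u x $ j = 0" for j
  proof -
    obtain \<phi> where \<phi>: "\<And>m::nat. \<phi> m \<in> test_functions \<Omega>" "(\<lambda>m. l2_norm \<Omega> (\<lambda>x. \<phi> m x - u x $ j)) \<longlonglongrightarrow> 0"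
      "(\<lambda>m. l2_norm \<Omega> (\<lambda>x. grad (\<phi> m) x - G j x)) \<longlonglongrightarrow> 0"
      using u[of j] unfolding H1_0_def G_def by blast
    \<comment> \<open>The gradients orthogonal to \<open>G j\<close> converge to \<open>G j\<close>
      itself.\<close>
    have "(\<lambda>m. l2_inner \<Omega> (grad (\<phi> m)) (G j)) \<longlonglongrightarrow> l2_inner \<Omega> (G j) (G j)"
      by (rule l2_tendsto_inner[OF \<phi>(3) grad_L2[OF lm \<phi>(1)] GL GL])
    then have "l2_inner \<Omega> (G j) (G j) = 0"
      by (simp add: orth[OF \<phi>(1)] LIMSEQ_const_iff)
    then have G0: "AE x in lebesgue_on \<Omega>. G j x = 0" by (simp add: l2_inner_eq_0_iff[OF GL])
    obtain R where R: "\<And>x. x \<in> \<Omega> \<Longrightarrow> norm x \<le> R" using \<Omega>(2) unfolding bounded_iff by blast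
    \<comment> \<open>Any coordinate direction serves.\<close>
    define i :: 'd where "i = undefined"
    have xu: "(\<lambda>x. x $ i *\<^sub>R u x $ j) \<in> L2 \<Omega>"
    proof (rule L2_bounded_mult[OF H1_L2[OF u1]])
      show "(\<lambda>x. x $ i) \<in> borel_measurable (lebesgue_on \<Omega>)"
        by (intro continuous_measurable_lebesgue_on continuous_intros)
      show "\<bar>x $ i\<bar> \<le> R" if "x \<in> \<Omega>" for x using R[OF that] component_le_norm_cart[of x i] by linarith
    qed
    have g: "(\<lambda>x. (x $ i * u x $ j) *\<^sub>R (axis i 1 :: real^'d)) \<in> L2 \<Omega>"
      using L2_linear[OF bounded_linear_scaleR_left xu, of "axis i 1"] by simp
    have "(\<lambda>m. l2_inner \<Omega> (grad (\<phi> m)) (\<lambda>x. (x $ i * u x $ j) *\<^sub>R (axis i 1)))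
        \<longlonglongrightarrow> l2_inner \<Omega> (G j) (\<lambda>x. (x $ i * u x $ j) *\<^sub>R (axis i 1))"
      by (rule l2_tendsto_inner[OF \<phi>(3) grad_L2[OF lm \<phi>(1)] GL g])
    moreover have "l2_inner \<Omega> (G j) (\<lambda>x. (x $ i * u x $ j) *\<^sub>R (axis i 1)) = 0"
      unfolding l2_inner_def using G0 by (intro integral_eq_zero_AE) (auto elim!: eventually_mono)
    moreover have "l2_inner \<Omega> (grad (\<phi> m)) (\<lambda>x. (x $ i * u x $ j) *\<^sub>R (axis i 1))
        = - l2_inner \<Omega> (\<phi> m) (\<lambda>x. u x $ j)" for m
    proof -
      note sm = test_functions_smooth[OF \<phi>(1)[of m]]
      \<comment> \<open>As u_j has zero gradient, it is orthogonal to the i-th derivative of x_i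
        phi_m, that is, to phi_m + x_i d_i phi_m.\<close>
      have "(LINT x|lebesgue_on \<Omega>. u x $ j * grad (\<lambda>x. x $ i * \<phi> m x) x $ i)
          = - (LINT x|lebesgue_on \<Omega>. G j x $ i * (x $ i * \<phi> m x))"
        using G[of j] test_functions_mult[OF \<phi>(1) smooth_nth[of i], of m] unfolding has_weak_grad_def by blast
      also have "(LINT x|lebesgue_on \<Omega>. G j x $ i * (x $ i * \<phi> m x)) = 0"
        using G0 by (intro integral_eq_zero_AE) (auto elim!: eventually_mono)
      finally have "(LINT x|lebesgue_on \<Omega>. u x $ j * grad (\<lambda>x. x $ i * \<phi> m x) x $ i) = 0" by simp
      moreover have "grad (\<lambda>x::real^'d. x $ i) x $ i = 1" for x
        using grad_nth_eq[OF bounded_linear_imp_has_derivative[OF bounded_linear_vec_nth], of i x i] by simp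
      ultimately have "(LINT x|lebesgue_on \<Omega>. grad (\<phi> m) x $ i * (x $ i * u x $ j) + \<phi> m x * u x $ j) = 0"
        by (simp add: grad_mult_nth smooth_differentiable sm smooth_nth algebra_simps)
      moreover have "integrable (lebesgue_on \<Omega>) (\<lambda>x. grad (\<phi> m) x $ i * (x $ i * u x $ j))"
        using L2_mult_integrable[OF test_functions_L2[OF lm test_functions_grad[OF \<phi>(1)]] xu, of m i] by simp
      moreover have "integrable (lebesgue_on \<Omega>) (\<lambda>x. \<phi> m x * u x $ j)"
        by (intro L2_mult_integrable test_functions_L2[OF lm \<phi>(1)] H1_L2 u1)
      ultimately show ?thesis
        by (simp add: l2_inner_def inner_axis mult.commute[of _ "grad (\<phi> m) _ $ _"])
    qed
    \<comment> \<open>The inner products (phi_m, u_j) tend to 0 because grad phi_m tends to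
      \<open>G j\<close>, which is zero; their limit is also |u_j|^2.\<close>
    ultimately have "(\<lambda>m. l2_inner \<Omega> (\<phi> m) (\<lambda>x. u x $ j)) \<longlonglongrightarrow> 0"
      using tendsto_minus by fastforce
    moreover have "(\<lambda>m. l2_inner \<Omega> (\<phi> m) (\<lambda>x. u x $ j)) \<longlonglongrightarrow> l2_inner \<Omega> (\<lambda>x. u x $ j) (\<lambda>x. u x $ j)"
      by (rule l2_tendsto_inner[OF \<phi>(2) test_functions_L2[OF lm \<phi>(1)] H1_L2[OF u1] H1_L2[OF u1]])
    ultimately have "l2_inner \<Omega> (\<lambda>x. u x $ j) (\<lambda>x. u x $ j) = 0" using LIMSEQ_unique by blast
    then show ?thesis by (simp add: l2_inner_eq_0_iff[OF H1_L2[OF u1]])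
  qed
  then have "AE x in lebesgue_on \<Omega>. \<forall>j. u x $ j = 0" by (rule eventually_all_finite)
  then show ?thesis by eventually_elim (simp add: vec_eq_iff)
qed

section \<open>Finite element spaces\<close>

lemma weak_div_diff:
  assumes "open \<Omega>" "bounded \<Omega>" "f \<in> H_div \<Omega>" "g \<in> H_div \<Omega>"
  shows "AE x in lebesgue_on \<Omega>. weak_div \<Omega> (\<lambda>x. f x - g x) x = weak_div \<Omega> f x - weak_div \<Omega> g x"
  using weak_div_lincomb[OF assms, of 1 "-1"] by simp

text \<open>Used for definiteness: the norm must vanish on every representative of the zero
  class.\<close>

lemma weak_div_AE_0:
  assumes "open \<Omega>" "bounded \<Omega>" "z \<in> H_div \<Omega>" "AE x in lebesgue_on \<Omega>. z x = 0"
  shows "AE x in lebesgue_on \<Omega>. weak_div \<Omega> z x = 0"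
proof (rule has_weak_div_unique[OF assms(1,2) H_div_weak_div[OF assms(3)]])
  have "(LINT x|lebesgue_on \<Omega>. z x \<bullet> grad \<phi> x) = 0" for \<phi>
    using assms(4) by (intro integral_eq_zero_AE) (auto elim!: eventually_mono)
  then show "has_weak_div \<Omega> z (\<lambda>x. 0)" by (simp add: has_weak_div_def L2_zero)
qed

lemma weak_grad_AE_0:
  assumes "open \<Omega>" "bounded \<Omega>" "f \<in> H1 \<Omega>" "AE x in lebesgue_on \<Omega>. f x = 0"
  shows "AE x in lebesgue_on \<Omega>. weak_grad \<Omega> f x = 0"
proof (rule has_weak_grad_unique[OF assms(1,2) H1_weak_grad[OF assms(3)]])
  have "(LINT x|lebesgue_on \<Omega>. f x * grad \<phi> x $ i) = 0" for \<phi> i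
    using assms(4) by (intro integral_eq_zero_AE) (auto elim!: eventually_mono)
  then show "has_weak_grad \<Omega> f (\<lambda>x. 0)" by (simp add: has_weak_grad_def L2_zero)
qed

lemma strain_nth:
  "strain \<Omega> u x $ i $ j = (weak_grad \<Omega> (\<lambda>y. u y $ i) x $ j + weak_grad \<Omega> (\<lambda>y. u y $ j) x $ i) / 2"
  by (simp add: strain_def weak_jacobian_def transpose_def)

lemma strain_L2:
  assumes "\<And>i. (\<lambda>x. u x $ i) \<in> H1 \<Omega>"
  shows "strain \<Omega> u \<in> L2 \<Omega>"
proof (intro L2_vecI)
  fix i j
  have "(\<lambda>x. (1/2) * (weak_grad \<Omega> (\<lambda>y. u y $ i) x $ j + weak_grad \<Omega> (\<lambda>y. u y $ j) x $ i)) \<in> L2 \<Omega>"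
    by (intro L2_cmult L2_add L2_nth weak_grad_L2 assms)
  then show "(\<lambda>x. strain \<Omega> u x $ i $ j) \<in> L2 \<Omega>"
    by (simp add: strain_nth)
qed

lemma strain_lincomb:
  fixes u v :: "real^'d \<Rightarrow> real^'d"
  assumes \<Omega>: "open \<Omega>" "bounded \<Omega>" and u: "\<And>i. (\<lambda>x. u x $ i) \<in> H1 \<Omega>" and v: "\<And>i. (\<lambda>x. v x $ i) \<in> H1 \<Omega>"
  shows "AE x in lebesgue_on \<Omega>. strain \<Omega> (\<lambda>x. a *\<^sub>R u x + b *\<^sub>R v x) x = a *\<^sub>R strain \<Omega> u x + b *\<^sub>R strain \<Omega> v x"
proof -
  have "AE x in lebesgue_on \<Omega>. \<forall>i. weak_grad \<Omega> (\<lambda>y. a * u y $ i + b * v y $ i) x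
      = a *\<^sub>R weak_grad \<Omega> (\<lambda>y. u y $ i) x + b *\<^sub>R weak_grad \<Omega> (\<lambda>y. v y $ i) x"
    by (intro eventually_all_finite weak_grad_lincomb \<Omega> u v)
  then show ?thesis
    by eventually_elim (simp add: vec_eq_iff strain_nth field_simps)
qed

lemma strain_AE_0:
  fixes u :: "real^'d \<Rightarrow> real^'d"
  assumes \<Omega>: "open \<Omega>" "bounded \<Omega>" and u: "\<And>i. (\<lambda>x. u x $ i) \<in> H1 \<Omega>"
    and 0: "AE x in lebesgue_on \<Omega>. u x = 0"
  shows "AE x in lebesgue_on \<Omega>. strain \<Omega> u x = 0"
proof -
  have "AE x in lebesgue_on \<Omega>. u x $ i = 0" for i
    using 0 by eventually_elim simp
  then have "AE x in lebesgue_on \<Omega>. \<forall>i. weak_grad \<Omega> (\<lambda>y. u y $ i) x = 0"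
    by (intro eventually_all_finite weak_grad_AE_0 \<Omega> u)
  then show ?thesis
    by eventually_elim (simp add: vec_eq_iff strain_nth)
qed

text \<open>Lets the parts of the energy be combined into a single square integrable
  function.\<close>

lemma L2_Pair:
  assumes "f \<in> L2 \<Omega>" "g \<in> L2 \<Omega>"
  shows "(\<lambda>x. (f x, g x)) \<in> L2 \<Omega>"
proof -
  have "bounded_linear (\<lambda>y::'b. (y, 0::'c))" "bounded_linear (\<lambda>y::'c. (0::'b, y))"
    by (intro bounded_linear_Pair bounded_linear_ident bounded_linear_zero)+
  then have "(\<lambda>x. (f x, 0) + (0, g x)) \<in> L2 \<Omega>"
    by (intro L2_add L2_linear[where T = "\<lambda>y::'b. (y, 0::'c)"] L2_linear[where T = "\<lambda>y::'c. (0::'b, y)"] assms)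
  then show ?thesis by simp
qed

lemma l2_inner_Pair:
  assumes "f \<in> L2 \<Omega>" "g \<in> L2 \<Omega>" "f' \<in> L2 \<Omega>" "g' \<in> L2 \<Omega>"
  shows "l2_inner \<Omega> (\<lambda>x. (f x, g x)) (\<lambda>x. (f' x, g' x)) = l2_inner \<Omega> f f' + l2_inner \<Omega> g g'"
  using L2_inner_integrable[OF assms(1,3)] L2_inner_integrable[OF assms(2,4)]
  by (simp add: l2_inner_def)

section \<open>Piecewise polynomial spaces on a fixed mesh\<close>

locale fem_mesh =
  fixes \<Omega> :: "(real^'d) set" and \<T> :: "(real^'d) set set"
  assumes open_\<Omega>: "open \<Omega>" and bounded_\<Omega>: "bounded \<Omega>" and mesh: "simplicial_mesh \<Omega> \<T>"
begin

lemma lm: "\<Omega> \<in> lmeasurable"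
  using open_\<Omega> bounded_\<Omega> by (rule bounded_open_lmeasurable)

lemma ls: "\<Omega> \<in> sets lebesgue"
  using lm by auto

lemma finite_mesh: "finite \<T>"
  using mesh by (simp add: simplicial_mesh_def triangulation_def)

lemma cell:
  assumes "K \<in> \<T>"
  shows "compact K" "convex K" "interior K \<subseteq> \<Omega>" "interior K \<noteq> {}" "K \<in> sets lebesgue"
proof -
  have s: "int CARD('d) simplex K" using mesh assms by (simp add: simplicial_mesh_def)
  then show c: "compact K" "convex K" by (auto intro: compact_simplex convex_simplex)
  show "interior K \<subseteq> \<Omega>" using mesh assms by (simp add: simplicial_mesh_def)
  \<comment> \<open>A simplex of dimension d has full affine hull, so its relative interior, which
    is nonempty, is its interior.\<close>
  have "aff_dim K = int DIM(real^'d)" using aff_dim_simplex[OF s] by simp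
  then have "affine hull K = UNIV" "K \<noteq> {}" using aff_dim_eq_full[of K] by auto
  then show "interior K \<noteq> {}"
    using rel_interior_interior rel_interior_eq_empty[OF c(2)] by metis
  show "K \<in> sets lebesgue" using lmeasurable_compact[OF c(1)] by auto
qed

text \<open>Finitely many closed cells cover the domain, so only finitely many null sets are
  discarded; the overlap along faces does no harm.\<close>

lemma AE_cells:
  assumes "\<And>K. K \<in> \<T> \<Longrightarrow> AE x in lebesgue_on K. P x"
  shows "AE x in lebesgue_on \<Omega>. P x"
proof -
  have "AE x in lebesgue. \<forall>K\<in>\<T>. x \<in> K \<longrightarrow> P x"
    using finite_mesh assms cell(5) by (intro AE_finite_allI) (auto simp: AE_restrict_space_iff)
  moreover have "\<Omega> \<subseteq> \<Union>\<T>"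
    using mesh closure_subset by (auto simp: simplicial_mesh_def)
  ultimately show ?thesis
    using ls by (auto simp: AE_restrict_space_iff elim!: eventually_mono)
qed

lemma piecewise_constant_bounded:
  fixes w :: "real^'d \<Rightarrow> real"
  assumes "\<And>K. K \<in> \<T> \<Longrightarrow> \<exists>a. AE x in lebesgue_on K. w x = a"
  obtains B where "AE x in lebesgue_on \<Omega>. \<bar>w x\<bar> \<le> B"
proof -
  obtain a where a: "\<And>K. K \<in> \<T> \<Longrightarrow> AE x in lebesgue_on K. w x = a K"
    using assms by metis
  have "AE x in lebesgue_on K. \<bar>w x\<bar> \<le> (\<Sum>K\<in>\<T>. \<bar>a K\<bar>)" if K: "K \<in> \<T>" for K
  proof -
    have "\<bar>a K\<bar> \<le> (\<Sum>K\<in>\<T>. \<bar>a K\<bar>)"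
      by (rule member_le_sum[OF K _ finite_mesh]) simp
    with a[OF K] show ?thesis by (auto elim: eventually_mono)
  qed
  then show ?thesis using AE_cells that by blast
qed

lemma W_hI:
  assumes "w \<in> borel_measurable (lebesgue_on \<Omega>)" "\<And>K. K \<in> \<T> \<Longrightarrow> \<exists>a. AE x in lebesgue_on K. w x = a"
  shows "w \<in> W_h \<Omega> \<T>"
proof -
  obtain B where "AE x in lebesgue_on \<Omega>. \<bar>w x\<bar> \<le> B"
    using piecewise_constant_bounded[OF assms(2)] by blast
  then have "w \<in> L2 \<Omega>" using L2_bounded[OF lm assms(1), of B] by simp
  with assms(2) show ?thesis by (simp add: W_h_def)
qed

lemma W_h_L2: "w \<in> W_h \<Omega> \<T> \<Longrightarrow> w \<in> L2 \<Omega>"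
  by (simp add: W_h_def)

text \<open>Continuous nonlinear operations act cell by cell on constants. This is what makes b(p),
  c(div u) and their linearizations square integrable.\<close>

lemma W_h_comp2:
  fixes f :: "real \<Rightarrow> real \<Rightarrow> real"
  assumes w: "w \<in> W_h \<Omega> \<T>" "w' \<in> W_h \<Omega> \<T>" and f: "continuous_on UNIV (\<lambda>y. f (fst y) (snd y))"
  shows "(\<lambda>x. f (w x) (w' x)) \<in> W_h \<Omega> \<T>"
proof (rule W_hI)
  show "(\<lambda>x. f (w x) (w' x)) \<in> borel_measurable (lebesgue_on \<Omega>)"
    by (rule borel_measurable_continuous_Pair[OF w[THEN W_h_L2, THEN L2_measurable] f])
  fix K assume K: "K \<in> \<T>"
  obtain a where "AE x in lebesgue_on K. w x = a"
    using w(1) K by (auto simp: W_h_def)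
  moreover obtain a' where "AE x in lebesgue_on K. w' x = a'"
    using w(2) K by (auto simp: W_h_def)
  ultimately have "AE x in lebesgue_on K. f (w x) (w' x) = f a a'"
    by eventually_elim simp
  then show "\<exists>c. AE x in lebesgue_on K. f (w x) (w' x) = c" by blast
qed

lemma W_h_comp: "w \<in> W_h \<Omega> \<T> \<Longrightarrow> continuous_on UNIV f \<Longrightarrow> (\<lambda>x. f (w x)) \<in> W_h \<Omega> \<T>"
  for f :: "real \<Rightarrow> real"
  by (rule W_h_comp2[of w w "\<lambda>s t. f s"]) (auto intro!: continuous_intros elim: continuous_on_subset
      intro: continuous_on_compose2[of UNIV f])

lemma W_h_add: "w \<in> W_h \<Omega> \<T> \<Longrightarrow> w' \<in> W_h \<Omega> \<T> \<Longrightarrow> (\<lambda>x. w x + w' x) \<in> W_h \<Omega> \<T>"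
  and W_h_diff: "w \<in> W_h \<Omega> \<T> \<Longrightarrow> w' \<in> W_h \<Omega> \<T> \<Longrightarrow> (\<lambda>x. w x - w' x) \<in> W_h \<Omega> \<T>"
  and W_h_mult: "w \<in> W_h \<Omega> \<T> \<Longrightarrow> w' \<in> W_h \<Omega> \<T> \<Longrightarrow> (\<lambda>x. w x * w' x) \<in> W_h \<Omega> \<T>"
  by (erule (1) W_h_comp2, intro continuous_intros)+

lemma W_h_cmult: "w \<in> W_h \<Omega> \<T> \<Longrightarrow> (\<lambda>x. a * w x) \<in> W_h \<Omega> \<T>"
  by (erule W_h_comp) (intro continuous_intros)

lemma V_h_H1_0: "v \<in> V_h \<Omega> \<T> \<Longrightarrow> (\<lambda>x. v x $ i) \<in> H1_0 \<Omega>"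
  by (simp add: V_h_def)

lemma V_h_H1: "v \<in> V_h \<Omega> \<T> \<Longrightarrow> (\<lambda>x. v x $ i) \<in> H1 \<Omega>"
  by (intro H1_0_H1 V_h_H1_0)

lemma V_h_H_div: "v \<in> V_h \<Omega> \<T> \<Longrightarrow> v \<in> H_div \<Omega>"
  by (intro H1_H_div[OF lm] V_h_H1)

lemma V_h_strain_L2: "v \<in> V_h \<Omega> \<T> \<Longrightarrow> strain \<Omega> v \<in> L2 \<Omega>"
  by (intro strain_L2 V_h_H1)

lemma Z_h_H_div: "z \<in> Z_h \<Omega> \<T> \<Longrightarrow> z \<in> H_div \<Omega>"
  by (simp add: Z_h_def)

lemma V_h_lincomb:
  assumes "u \<in> V_h \<Omega> \<T>" "v \<in> V_h \<Omega> \<T>"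
  shows "(\<lambda>x. r *\<^sub>R u x + s *\<^sub>R v x) \<in> V_h \<Omega> \<T>"
  unfolding V_h_def mem_Collect_eq
proof (intro conjI allI ballI)
  show "(\<lambda>x. (r *\<^sub>R u x + s *\<^sub>R v x) $ i) \<in> H1_0 \<Omega>" for i
    using H1_0_lincomb[OF open_\<Omega> bounded_\<Omega> V_h_H1_0[OF assms(1)] V_h_H1_0[OF assms(2)]] by simp
  fix K assume "K \<in> \<T>"
  then obtain A B :: "real^'d^'d" and a b where
    "AE x in lebesgue_on K. u x = a + A *v x" "AE x in lebesgue_on K. v x = b + B *v x"
    using assms unfolding V_h_def by blast
  then have "AE x in lebesgue_on K. r *\<^sub>R u x + s *\<^sub>R v x
      = (r *\<^sub>R a + s *\<^sub>R b) + (r *\<^sub>R A + s *\<^sub>R B) *v x"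
    by eventually_elim (simp add: scaleR_add_right matrix_vector_mult_add_rdistrib scaleR_matrix_vector_assoc)
  then show "\<exists>(A::real^'d^'d) a. AE x in lebesgue_on K. r *\<^sub>R u x + s *\<^sub>R v x = a + A *v x" by blast
qed

lemma V_h_diff: "u \<in> V_h \<Omega> \<T> \<Longrightarrow> v \<in> V_h \<Omega> \<T> \<Longrightarrow> (\<lambda>x. u x - v x) \<in> V_h \<Omega> \<T>"
  using V_h_lincomb[of u v 1 "-1"] by simp

lemma Z_h_lincomb:
  assumes "u \<in> Z_h \<Omega> \<T>" "v \<in> Z_h \<Omega> \<T>"
  shows "(\<lambda>x. r *\<^sub>R u x + s *\<^sub>R v x) \<in> Z_h \<Omega> \<T>"
  unfolding Z_h_def mem_Collect_eq
proof (intro conjI ballI)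
  show "(\<lambda>x. r *\<^sub>R u x + s *\<^sub>R v x) \<in> H_div \<Omega>"
    by (intro H_div_lincomb lm Z_h_H_div assms)
  fix K assume "K \<in> \<T>"
  then obtain a b a' b' where
    "AE x in lebesgue_on K. u x = a + b *\<^sub>R x" "AE x in lebesgue_on K. v x = a' + b' *\<^sub>R x"
    using assms unfolding Z_h_def by blast
  then have "AE x in lebesgue_on K. r *\<^sub>R u x + s *\<^sub>R v x = (r *\<^sub>R a + s *\<^sub>R a') + (r * b + s * b') *\<^sub>R x"
    by eventually_elim (simp add: algebra_simps)
  then show "\<exists>a b. AE x in lebesgue_on K. r *\<^sub>R u x + s *\<^sub>R v x = a + b *\<^sub>R x" by blast
qed

lemma Z_h_diff: "u \<in> Z_h \<Omega> \<T> \<Longrightarrow> v \<in> Z_h \<Omega> \<T> \<Longrightarrow> (\<lambda>x. u x - v x) \<in> Z_h \<Omega> \<T>"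
  using Z_h_lincomb[of u v 1 "-1"] by simp

lemma weak_div_V_h: "v \<in> V_h \<Omega> \<T> \<Longrightarrow> weak_div \<Omega> v \<in> W_h \<Omega> \<T>"
proof (rule W_hI)
  assume v: "v \<in> V_h \<Omega> \<T>"
  show "weak_div \<Omega> v \<in> borel_measurable (lebesgue_on \<Omega>)"
    by (rule L2_measurable[OF weak_div_L2[OF V_h_H_div[OF v]]])
  fix K assume K: "K \<in> \<T>"
  then obtain A :: "real^'d^'d" and a where "AE x in lebesgue_on K. v x = a + A *v x"
    using v unfolding V_h_def by blast
  from weak_div_affine_cell[OF open_\<Omega> bounded_\<Omega> V_h_H_div[OF v] cell(2,3,1)[OF K] this]
  show "\<exists>a. AE x in lebesgue_on K. weak_div \<Omega> v x = a" by blast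
qed

text \<open>An inverse estimate: a constant on a cell is controlled by its \<open>L2\<close> norm
  there, at a cost that depends on the measure of the cell. The mesh dependence of the step size
  bound comes from here.\<close>

lemma W_h_sup_bound:
  obtains C where "C \<ge> 0" "\<And>w. w \<in> W_h \<Omega> \<T> \<Longrightarrow> AE x in lebesgue_on \<Omega>. \<bar>w x\<bar> \<le> C * l2_norm \<Omega> w"
proof -
  define m where "m K = measure lebesgue (interior K)" for K :: "(real^'d) set"
  have mpos: "m K > 0" if "K \<in> \<T>" for K
  proof -
    have "interior K \<in> lmeasurable"
      using cell(1)[OF that] by (intro bounded_open_lmeasurable) (auto intro: compact_imp_bounded bounded_interior)
    moreover have "\<not> negligible (interior K)"
      using cell(4)[OF that] open_not_negligible by blast
    ultimately show ?thesis
      by (simp add: m_def negligible_iff_measure order_less_le)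
  qed
  \<comment> \<open>The sum dominates the factor of each single cell.\<close>
  define C where "C = (\<Sum>K\<in>\<T>. 1 / sqrt (m K))"
  have C0: "C \<ge> 0" unfolding C_def using mpos by (intro sum_nonneg) (auto intro: less_imp_le)
  show ?thesis
  proof (rule that[OF C0], rule AE_cells)
    fix w K assume w: "w \<in> W_h \<Omega> \<T>" and K: "K \<in> \<T>"
    then obtain a where a: "AE x in lebesgue_on K. w x = a" by (auto simp: W_h_def)
    have wL: "w \<in> L2 \<Omega>" using w by (rule W_h_L2)
    have Il: "interior K \<in> lmeasurable"
      using cell(1)[OF K] by (intro bounded_open_lmeasurable) (auto intro: compact_imp_bounded bounded_interior)
    have "a\<^sup>2 * m K = (LINT x|lebesgue. indicat_real (interior K) x *\<^sub>R a\<^sup>2)"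
      by (simp add: m_def)
    also have "\<dots> \<le> (LINT x|lebesgue. indicat_real \<Omega> x *\<^sub>R (w x * w x))"
    proof (rule integral_mono_AE)
      show "integrable lebesgue (\<lambda>x. indicat_real (interior K) x *\<^sub>R a\<^sup>2)"
        using Il by (intro integrable_scaleR_left integrable_real_indicator) (auto simp: fmeasurable_def)
      show "integrable lebesgue (\<lambda>x. indicat_real \<Omega> x *\<^sub>R (w x * w x))"
        using L2_mult_integrable[OF wL wL] ls by (simp add: integrable_restrict_space)
      have "AE x in lebesgue. x \<in> K \<longrightarrow> w x = a"
        using a cell(5)[OF K] by (simp add: AE_restrict_space_iff)
      then show "AE x in lebesgue. indicat_real (interior K) x *\<^sub>R a\<^sup>2 \<le> indicat_real \<Omega> x *\<^sub>R (w x * w x)"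
        by eventually_elim (use cell(3)[OF K] interior_subset[of K] in
            \<open>auto simp: indicator_def power2_eq_square\<close>)
    qed
    also have "\<dots> = (l2_norm \<Omega> w)\<^sup>2"
      using ls by (simp add: l2_norm_square l2_inner_def integral_restrict_space)
    finally have "sqrt (a\<^sup>2 * m K) \<le> l2_norm \<Omega> w"
      by (intro real_le_lsqrt) (auto simp: l2_norm_nonneg)
    then have "\<bar>a\<bar> \<le> 1 / sqrt (m K) * l2_norm \<Omega> w"
      using mpos[OF K] by (simp add: real_sqrt_mult field_simps)
    also have "\<dots> \<le> C * l2_norm \<Omega> w"
      unfolding C_def using mpos
      by (intro mult_right_mono member_le_sum[OF K _ finite_mesh]) (auto simp: l2_norm_nonneg less_imp_le)
    finally have "\<bar>a\<bar> \<le> C * l2_norm \<Omega> w" .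
    with a show "AE x in lebesgue_on K. \<bar>w x\<bar> \<le> C * l2_norm \<Omega> w"
      by (auto elim: eventually_mono)
  qed
qed

end

section \<open>Energy estimates\<close>

text \<open>\<open>matrix_inv\<close> is a chosen inverse, so \<open>mat (1 / a)\<close> is
  exhibited first to make its defining equations available.\<close>

lemma matrix_inv_mat_vector_mult:
  fixes v :: "real^'d"
  assumes "a \<noteq> 0"
  shows "matrix_inv (mat a) *v v = (1 / a) *\<^sub>R v"
proof -
  have mm: "mat b ** mat c = (mat (b * c) :: real^'d^'d)" for b c
    by (simp add: matrix_matrix_mult_def mat_def vec_eq_iff if_distrib[where f = "\<lambda>y. y * _"]
        if_distrib[where f = "\<lambda>y. _ * y"] cong: if_cong)
  have mv: "mat b *v w = b *\<^sub>R w" for b and w :: "real^'d"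
    by (simp add: matrix_vector_mult_def mat_def vec_eq_iff if_distrib[where f = "\<lambda>y. y * _"] cong: if_cong)
  define B where "B = matrix_inv (mat a :: real^'d^'d)"
  have "\<exists>A'. mat a ** A' = (mat 1 :: real^'d^'d) \<and> A' ** mat a = mat 1"
    using mm[of a "1 / a"] mm[of "1 / a" a] assms by (intro exI[of _ "mat (1 / a)"]) simp
  then have B: "mat a ** B = mat 1"
    unfolding B_def matrix_inv_def by (rule someI2_ex) simp
  have "mat a *v (B *v v) = v"
    using B by (simp add: matrix_vector_mul_assoc)
  then have "a *\<^sub>R (B *v v) = v" by (simp only: mv)
  then have "(1 / a) *\<^sub>R v = (1 / a) *\<^sub>R (a *\<^sub>R (B *v v))" by simp
  then show ?thesis using assms by (simp add: B_def)
qed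

text \<open>Here y is the exact value, x the previous iterate and z the new one. Writing f y - f x
  as f'(xi) times y - x splits the linearization error into f'(x) times z - y and a remainder f'(x)
  - f'(xi) times y - x, which is quadratic in x - y by the Lipschitz bound.\<close>

lemma newton_remainder:
  fixes f :: "real \<Rightarrow> real"
  assumes f: "\<And>t. (f has_real_derivative f' t) (at t)" and L: "\<And>s t. \<bar>f' s - f' t\<bar> \<le> L * \<bar>s - t\<bar>" "L \<ge> 0"
    and a: "\<And>t. a \<le> f' t"
  shows "a * (z - y)\<^sup>2 - L * (x - y)\<^sup>2 * \<bar>z - y\<bar> \<le> (f x + f' x * (z - x) - f y) * (z - y)"
proof -
  obtain \<xi> where \<xi>: "f y - f x = (y - x) * f' \<xi>" "\<bar>x - \<xi>\<bar> \<le> \<bar>x - y\<bar>"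
  proof (cases x y rule: linorder_cases)
    case less
    obtain z where "x < z" "z < y" "f y - f x = (y - x) * f' z" using MVT2[OF less f] by blast
    then show ?thesis using that[of z] by auto
  next
    case equal
    then show ?thesis using that[of x] by simp
  next
    case greater
    obtain z where "y < z" "z < x" "f x - f y = (x - y) * f' z" using MVT2[OF greater f] by blast
    then show ?thesis using that[of z] by (auto simp: algebra_simps)
  qed
  have "f x + f' x * (z - x) - f y = f' x * (z - y) + (f' x - f' \<xi>) * (y - x)"
    using \<xi>(1) by (simp add: algebra_simps)
  then have "(f x + f' x * (z - x) - f y) * (z - y) = (f' x * (z - y) + (f' x - f' \<xi>) * (y - x)) * (z - y)"
    by simp
  then have eq: "(f x + f' x * (z - x) - f y) * (z - y) = f' x * (z - y)\<^sup>2 + (f' x - f' \<xi>) * (y - x) * (z - y)"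
    by (simp only: distrib_right power2_eq_square mult.assoc)
  have "\<bar>(f' x - f' \<xi>) * (y - x) * (z - y)\<bar> \<le> L * (x - y)\<^sup>2 * \<bar>z - y\<bar>"
  proof -
    have "\<bar>f' x - f' \<xi>\<bar> \<le> L * \<bar>x - y\<bar>"
      using L(1)[of x \<xi>] mult_left_mono[OF \<xi>(2) L(2)] by linarith
    then have "\<bar>f' x - f' \<xi>\<bar> * \<bar>y - x\<bar> * \<bar>z - y\<bar> \<le> L * \<bar>x - y\<bar> * \<bar>y - x\<bar> * \<bar>z - y\<bar>"
      by (intro mult_right_mono) auto
    then show ?thesis by (simp add: abs_mult abs_minus_commute[of y x] power2_eq_square mult.assoc)
  qed
  moreover have "a * (z - y)\<^sup>2 \<le> f' x * (z - y)\<^sup>2" using a by (intro mult_right_mono) auto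
  ultimately show ?thesis unfolding eq by linarith
qed

text \<open>The counterpart of \<open>newton_remainder\<close> for the time step, where nothing is
  linearized.\<close>

lemma derivative_lower_bound_monotone:
  fixes f :: "real \<Rightarrow> real"
  assumes f: "\<And>t. (f has_real_derivative f' t) (at t)" and a: "\<And>t. a \<le> f' t"
  shows "a * (y - x)\<^sup>2 \<le> (f y - f x) * (y - x)"
proof -
  have *: "a * (y - x)\<^sup>2 \<le> (f y - f x) * (y - x)" if less: "x < y" for x y
  proof -
    obtain z where "f y - f x = (y - x) * f' z" using MVT2[OF less f] by blast
    then have "(f y - f x) * (y - x) = f' z * (y - x)\<^sup>2" by (simp add: power2_eq_square)
    then show ?thesis using a[of z] by (simp add: mult_right_mono)
  qed
  show ?thesis using *[of x y] *[of y x]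
    by (cases x y rule: linorder_cases) (auto simp: power2_commute[of x y] algebra_simps)
qed

text \<open>The stabilization absorbs the coupling: since \<open>Ls \<ge> \<alpha>\<^sup>2 / ab\<close>, the quadratic form
  \<open>Ls/2 (d - d')\<^sup>2 - \<alpha> r (d - d') + ab/2 r\<^sup>2\<close> is nonnegative.\<close>

lemma pointwise_energy_inequality:
  fixes r r' d d' :: real
  assumes ab: "ab > 0" "Ls \<ge> \<alpha>\<^sup>2 / ab"
    and Fb: "ab * r\<^sup>2 - L * r'\<^sup>2 * \<bar>r\<bar> \<le> Fb" and Fc: "ac * d\<^sup>2 - L * d'\<^sup>2 * \<bar>d\<bar> \<le> Fc"
    and M: "\<bar>r'\<bar> \<le> M" "\<bar>d'\<bar> \<le> M" "L \<ge> 0" "L * M \<le> \<eta>"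
  shows "(ab / 2 - \<eta>) * r\<^sup>2 + (ac + Ls / 2 - \<eta>) * d\<^sup>2 - (Ls / 2 + \<eta>) * d'\<^sup>2 - \<eta> * r'\<^sup>2
    \<le> Fb + \<alpha> * d' * r + Fc + Ls * (d - d') * d - \<alpha> * r * d"
proof -
  \<comment> \<open>One factor of the quadratic remainder is bounded by M, which leaves a quadratic
    form with the small coefficient \<open>\<eta>\<close>.\<close>
  have rem: "L * s'\<^sup>2 * \<bar>s\<bar> \<le> \<eta> * (s\<^sup>2 + s'\<^sup>2)" if "\<bar>s'\<bar> \<le> M" for s s' :: real
  proof -
    have "L * s'\<^sup>2 * \<bar>s\<bar> = (L * \<bar>s'\<bar>) * (\<bar>s'\<bar> * \<bar>s\<bar>)"
      by (metis (no_types, lifting) abs_mult_self_eq mult.assoc power2_eq_square)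
    also have "\<dots> \<le> \<eta> * (\<bar>s'\<bar> * \<bar>s\<bar>)"
      using mult_left_mono[OF that M(3)] M(4) by (intro mult_right_mono) auto
    also have "\<dots> \<le> \<eta> * (s\<^sup>2 + s'\<^sup>2)"
    proof (rule mult_left_mono)
      have "0 \<le> (\<bar>s\<bar> - \<bar>s'\<bar>)\<^sup>2" "0 \<le> \<bar>s'\<bar> * \<bar>s\<bar>" by simp_all
      then show "\<bar>s'\<bar> * \<bar>s\<bar> \<le> s\<^sup>2 + s'\<^sup>2"
        unfolding power2_diff power2_abs mult.commute[of "\<bar>s'\<bar>" "\<bar>s\<bar>"] by linarith
      have "0 \<le> L * M" using M(1,3) by (intro mult_nonneg_nonneg) auto
      then show "0 \<le> \<eta>" using M(4) by linarith
    qed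
    finally show ?thesis .
  qed
  have "0 \<le> Ls / 2 * (d - d')\<^sup>2 - \<alpha> * r * (d - d') + ab / 2 * r\<^sup>2"
  proof -
    have "0 \<le> (\<alpha> * (d - d') - ab * r)\<^sup>2 / (2 * ab)" using ab by simp
    also have "\<dots> = \<alpha>\<^sup>2 / ab / 2 * (d - d')\<^sup>2 - \<alpha> * r * (d - d') + ab / 2 * r\<^sup>2"
      using ab by (simp add: field_simps power2_eq_square)
    also have "\<dots> \<le> Ls / 2 * (d - d')\<^sup>2 - \<alpha> * r * (d - d') + ab / 2 * r\<^sup>2"
      using mult_right_mono[OF ab(2), of "(d - d')\<^sup>2"] by simp
    finally show ?thesis .
  qed
  \<comment> \<open>The stabilization term yields the square of the increment, which pays for the
    coupling, and a difference of squares between new and old iterate.\<close>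
  moreover have "Ls * (d - d') * d = Ls / 2 * (d - d')\<^sup>2 + Ls / 2 * d\<^sup>2 - Ls / 2 * d'\<^sup>2"
    by (simp add: power2_eq_square field_simps)
  moreover note rem[OF M(1), of r] rem[OF M(2), of d] Fb Fc
  ultimately show ?thesis
    by (simp add: algebra_simps)
qed

section \<open>Error and energy identities for the discrete Biot system\<close>

locale biot = fem_mesh \<Omega> \<T> for \<Omega> :: "(real^'d) set" and \<T> +
  fixes \<bb> \<cc> :: "real \<Rightarrow> real" and k :: "real^'d \<Rightarrow> real"
    and \<alpha> \<alpha>\<^sub>b \<alpha>\<^sub>c k\<^sub>m Ls L :: real
    and fb ff :: "real^'d \<Rightarrow> real^'d" and Sf :: "real^'d \<Rightarrow> real"
  assumes b_deriv: "\<And>t. (\<bb> has_real_derivative deriv \<bb> t) (at t)"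
    and c_deriv: "\<And>t. (\<cc> has_real_derivative deriv \<cc> t) (at t)"
    and b_lip: "\<And>s t. \<bar>deriv \<bb> s - deriv \<bb> t\<bar> \<le> L * \<bar>s - t\<bar>"
    and c_lip: "\<And>s t. \<bar>deriv \<cc> s - deriv \<cc> t\<bar> \<le> L * \<bar>s - t\<bar>"
    and L_nonneg: "L \<ge> 0"
    and ac: "\<alpha>\<^sub>c > 0" "\<And>t. \<alpha>\<^sub>c \<le> deriv \<cc> t"
    and ab: "\<alpha>\<^sub>b > 0" "\<And>t. \<alpha>\<^sub>b \<le> deriv \<bb> t"
    and k: "k \<in> borel_measurable (lebesgue_on \<Omega>)" "k\<^sub>m > 0" "\<And>x. x \<in> \<Omega> \<Longrightarrow> k\<^sub>m \<le> k x"
    and Sf_L2: "Sf \<in> L2 \<Omega>"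
    and stab: "Ls \<ge> 0" "Ls \<ge> \<alpha>\<^sup>2 / \<alpha>\<^sub>b"
begin

abbreviation inn :: "(real^'d \<Rightarrow> 'b::euclidean_space) \<Rightarrow> (real^'d \<Rightarrow> 'b) \<Rightarrow> real" where
  "inn \<equiv> l2_inner \<Omega>"

abbreviation V where "V \<equiv> V_h \<Omega> \<T>"
abbreviation Z where "Z \<equiv> Z_h \<Omega> \<T>"
abbreviation W where "W \<equiv> W_h \<Omega> \<T>"
abbreviation dv :: "(real^'d \<Rightarrow> real^'d) \<Rightarrow> real^'d \<Rightarrow> real" where "dv \<equiv> weak_div \<Omega>"

text \<open>K^(-1/2) applied to q, so that the flux term of the Darcy equation becomes an
  \<open>L2\<close> inner product.\<close>

definition sq :: "(real^'d \<Rightarrow> real^'d) \<Rightarrow> real^'d \<Rightarrow> real^'d" where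
  "sq q x = sqrt (1 / k x) *\<^sub>R q x"

lemma sq_L2: "q \<in> L2 \<Omega> \<Longrightarrow> sq q \<in> L2 \<Omega>"
  unfolding sq_def[abs_def]
proof (rule L2_bounded_mult[where B = "sqrt (1 / k\<^sub>m)"])
  show "(\<lambda>x. sqrt (1 / k x)) \<in> borel_measurable (lebesgue_on \<Omega>)"
    using k(1) by measurable
  fix x assume "x \<in> \<Omega>"
  then show "\<bar>sqrt (1 / k x)\<bar> \<le> sqrt (1 / k\<^sub>m)"
    using k(2) k(3)[of x] by (simp add: frac_le)
qed

lemma Z_L2: "q \<in> Z \<Longrightarrow> q \<in> L2 \<Omega>"
  by (intro H_div_L2 Z_h_H_div)

lemma sq_Z_L2: "q \<in> Z \<Longrightarrow> sq q \<in> L2 \<Omega>"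
  by (intro sq_L2 Z_L2)

lemma sq_diff: "sq (\<lambda>x. q x - q' x) = (\<lambda>x. sq q x - sq q' x)"
  by (simp add: sq_def fun_eq_iff scaleR_diff_right)

lemma inn_matrix_inv: "inn (\<lambda>x. matrix_inv (mat (k x)) *v q x) z = inn (sq q) (sq z)"
  unfolding l2_inner_def
proof (rule Bochner_Integration.integral_cong)
  fix x assume "x \<in> space (lebesgue_on \<Omega>)"
  then have "k x > 0" using k(2) k(3)[of x] by simp
  then show "(matrix_inv (mat (k x)) *v q x) \<bullet> z x = sq q x \<bullet> sq z x"
    by (simp add: matrix_inv_mat_vector_mult sq_def real_sqrt_divide flip: real_sqrt_mult)
qed simp

lemma W_L2: "p \<in> W \<Longrightarrow> p \<in> L2 \<Omega>"
  by (rule W_h_L2)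

lemma b_cont: "continuous_on UNIV \<bb>" and c_cont: "continuous_on UNIV \<cc>"
  by (intro continuous_at_imp_continuous_on ballI DERIV_isCont[OF b_deriv] DERIV_isCont[OF c_deriv])+

lemma lipschitz_cont: "(\<And>s t. \<bar>f s - f t\<bar> \<le> L * \<bar>s - t\<bar>) \<Longrightarrow> continuous_on UNIV f" for f :: "real \<Rightarrow> real"
  using L_nonneg by (intro lipschitz_on_continuous_on[of L]) (auto intro!: lipschitz_onI simp: dist_real_def)

lemma b'_cont: "continuous_on UNIV (deriv \<bb>)" and c'_cont: "continuous_on UNIV (deriv \<cc>)"
  by (intro lipschitz_cont b_lip c_lip)+

lemmas W_intros = W_h_comp[OF _ b_cont] W_h_comp[OF _ c_cont] W_h_comp[OF _ b'_cont] W_h_comp[OF _ c'_cont]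
  W_h_add W_h_diff W_h_mult W_h_cmult weak_div_V_h V_h_diff

lemma dv_diff_V: "u \<in> V \<Longrightarrow> v \<in> V \<Longrightarrow> AE x in lebesgue_on \<Omega>. dv (\<lambda>x. u x - v x) x = dv u x - dv v x"
  by (intro weak_div_diff open_\<Omega> bounded_\<Omega> V_h_H_div)

lemma strain_diff_V:
  "u \<in> V \<Longrightarrow> v \<in> V \<Longrightarrow> AE x in lebesgue_on \<Omega>. strain \<Omega> (\<lambda>x. u x - v x) x = strain \<Omega> u x - strain \<Omega> v x"
  using strain_lincomb[OF open_\<Omega> bounded_\<Omega> V_h_H1 V_h_H1, of u v 1 "-1"] by simp

text \<open>The chosen weak divergence is additive only almost everywhere; after testing, the
  identity is exact.\<close>

lemma inn_dv_diff:
  assumes "u \<in> H_div \<Omega>" "v \<in> H_div \<Omega>" "w \<in> L2 \<Omega>"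
  shows "inn (dv (\<lambda>x. u x - v x)) w = inn (dv u) w - inn (dv v) w"
proof -
  have h: "(\<lambda>x. u x - v x) \<in> H_div \<Omega>" using H_div_lincomb[OF lm assms(1,2), of 1 "-1"] by simp
  have "inn (dv (\<lambda>x. u x - v x)) w = inn (\<lambda>x. dv u x - dv v x) w"
  proof (rule l2_inner_cong_AE)
    show "AE x in lebesgue_on \<Omega>. dv (\<lambda>x. u x - v x) x \<bullet> w x = (dv u x - dv v x) \<bullet> w x"
      using weak_div_diff[OF open_\<Omega> bounded_\<Omega> assms(1,2)] by eventually_elim simp
  qed (intro weak_div_L2 L2_diff assms h)+
  then show ?thesis by (simp add: l2_inner_diff_left weak_div_L2 assms)
qed

lemma inn_strain_diff:
  assumes "u \<in> V" "v \<in> V" "e = (\<lambda>x. u x - v x)"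
  shows "inn (strain \<Omega> u) (strain \<Omega> e) - inn (strain \<Omega> v) (strain \<Omega> e) = inn (strain \<Omega> e) (strain \<Omega> e)"
proof -
  have e: "e \<in> V" unfolding assms(3) by (intro V_h_diff assms)
  have "inn (strain \<Omega> e) (strain \<Omega> e) = inn (\<lambda>x. strain \<Omega> u x - strain \<Omega> v x) (strain \<Omega> e)"
  proof (rule l2_inner_cong_AE)
    show "AE x in lebesgue_on \<Omega>. strain \<Omega> e x \<bullet> strain \<Omega> e x = (strain \<Omega> u x - strain \<Omega> v x) \<bullet> strain \<Omega> e x"
      using strain_diff_V[OF assms(1,2)] unfolding assms(3)[symmetric] by eventually_elim simp
  qed (intro L2_diff V_h_strain_L2 assms e)+
  then show ?thesis by (simp add: l2_inner_diff_left V_h_strain_L2 assms(1,2) e)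
qed

text \<open>The gravity term cancels. With the flux error as z, the pairing of its divergence with
  the pressure error becomes a square.\<close>

lemma darcy_diff:
  assumes "darcy_eq \<Omega> \<T> k ff q p" "darcy_eq \<Omega> \<T> k ff q' p'" "q \<in> Z" "q' \<in> Z" "p \<in> W" "p' \<in> W" "z \<in> Z"
  shows "inn (sq (\<lambda>x. q x - q' x)) (sq z) = inn (dv z) (\<lambda>x. p x - p' x)"
proof -
  have "inn (sq q) (sq z) - inn p (dv z) = inn (sq q') (sq z) - inn p' (dv z)"
    using assms(1,2,7) unfolding darcy_eq_def inn_matrix_inv by metis
  then show ?thesis
    using assms weak_div_L2[OF Z_h_H_div[OF assms(7)]]
    by (simp add: sq_diff l2_inner_diff_left l2_inner_diff_right sq_Z_L2 W_L2 l2_inner_commute[of _ "dv z"])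
qed

text \<open>The divergence weight lies between \<open>\<alpha>\<^sub>c + Ls / 2\<close>, gained for
  the new iterate, and \<open>Ls / 2\<close>, charged for the old one. The pressure weight is half
  of the \<open>\<alpha>\<^sub>b / 2\<close> left after the coupling is absorbed. The gaps leave
  room for the Newton remainders.\<close>

definition energy :: "real \<Rightarrow> (real^'d \<Rightarrow> real^'d) \<Rightarrow> (real^'d \<Rightarrow> real^'d) \<Rightarrow> (real^'d \<Rightarrow> real) \<Rightarrow> real" where
  "energy \<tau> u q p = inn (strain \<Omega> u) (strain \<Omega> u) + \<tau> * inn (sq q) (sq q)
    + \<alpha>\<^sub>b / 4 * inn p p + (\<alpha>\<^sub>c / 2 + Ls / 2) * inn (dv u) (dv u)"

lemma energy_bounds:
  assumes "\<tau> \<ge> 0"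
  shows "0 \<le> energy \<tau> u q p" "\<alpha>\<^sub>b / 4 * inn p p \<le> energy \<tau> u q p" "\<alpha>\<^sub>c / 2 * inn (dv u) (dv u) \<le> energy \<tau> u q p"
proof -
  have "0 \<le> inn (strain \<Omega> u) (strain \<Omega> u)" "0 \<le> \<tau> * inn (sq q) (sq q)"
    "0 \<le> \<alpha>\<^sub>b / 4 * inn p p" "0 \<le> \<alpha>\<^sub>c / 2 * inn (dv u) (dv u)" "0 \<le> Ls / 2 * inn (dv u) (dv u)"
    using assms ab ac stab by (auto simp: l2_inner_self_nonneg)
  then show "0 \<le> energy \<tau> u q p" "\<alpha>\<^sub>b / 4 * inn p p \<le> energy \<tau> u q p" "\<alpha>\<^sub>c / 2 * inn (dv u) (dv u) \<le> energy \<tau> u q p"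
    by (simp_all add: energy_def distrib_right)
qed

text \<open>The flow error equation is tested with \<open>r\<close>, the mechanics error equation
  with \<open>e\<close>, and the two are added; what remains is a pointwise estimate.\<close>

lemma newton_energy_inequality:
  assumes sol: "discrete_step \<Omega> \<T> \<bb> \<cc> k \<alpha> fb ff Sf \<tau> u' p' u q p"
    and flow: "newton_flow_step \<Omega> \<T> \<bb> k \<alpha> ff Sf \<tau> u' p' ui po qn pn"
    and mech: "newton_mechanics_step \<Omega> \<T> \<cc> \<alpha> Ls fb ui un pn"
    and prev: "u' \<in> V" "p' \<in> W" "ui \<in> V" "po \<in> W"
    and M: "AE x in lebesgue_on \<Omega>. \<bar>po x - p x\<bar> \<le> M" "AE x in lebesgue_on \<Omega>. \<bar>dv (\<lambda>x. ui x - u x) x\<bar> \<le> M"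
      "L * M \<le> \<eta>"
  defines "r \<equiv> \<lambda>x. pn x - p x" and "r' \<equiv> \<lambda>x. po x - p x"
    and "e \<equiv> \<lambda>x. un x - u x" and "e' \<equiv> \<lambda>x. ui x - u x" and "eq \<equiv> \<lambda>x. qn x - q x"
  shows "inn (strain \<Omega> e) (strain \<Omega> e) + \<tau> * inn (sq eq) (sq eq)
      + (\<alpha>\<^sub>b / 2 - \<eta>) * inn r r + (\<alpha>\<^sub>c + Ls / 2 - \<eta>) * inn (dv e) (dv e)
    \<le> (Ls / 2 + \<eta>) * inn (dv e') (dv e') + \<eta> * inn r' r'"
proof -
  have uq: "u \<in> V" "q \<in> Z" "p \<in> W" "mechanics_eq \<Omega> \<T> \<cc> \<alpha> fb u p" "darcy_eq \<Omega> \<T> k ff q p"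
    "mass_balance_eq \<Omega> \<T> \<bb> \<alpha> Sf \<tau> u' p' u q p"
    using sol by (auto simp: discrete_step_def)
  have qn: "qn \<in> Z" "pn \<in> W" "darcy_eq \<Omega> \<T> k ff qn pn" using flow by (auto simp: newton_flow_step_def)
  have un: "un \<in> V" using mech by (auto simp: newton_mechanics_step_def)
  have eV: "e \<in> V" "e' \<in> V" unfolding e_def e'_def by (intro V_h_diff un uq prev)+
  have eZ: "eq \<in> Z" unfolding eq_def by (intro Z_h_diff qn uq)
  have rW: "r \<in> W" "r' \<in> W" unfolding r_def r'_def by (intro W_h_diff qn uq prev)+
  note W1 = W_L2[OF rW(1)]
  define d d' where "d = dv e" and "d' = dv e'"
  have dW: "d \<in> W" "d' \<in> W" unfolding d_def d'_def by (intro weak_div_V_h eV)+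
  have ae_d: "AE x in lebesgue_on \<Omega>. d x = dv un x - dv u x"
    unfolding d_def e_def by (intro dv_diff_V un uq)
  have ae_d': "AE x in lebesgue_on \<Omega>. d' x = dv ui x - dv u x"
    unfolding d'_def e'_def by (intro dv_diff_V prev uq)
  have ae_dd: "AE x in lebesgue_on \<Omega>. dv (\<lambda>y. un y - ui y) x = dv un x - dv ui x"
    by (intro dv_diff_V prev un)
  define Fb where "Fb x = \<bb> (po x) + deriv \<bb> (po x) * (pn x - po x) - \<bb> (p x)" for x
  define Fc where "Fc x = \<cc> (dv ui x) + deriv \<cc> (dv ui x) * dv (\<lambda>y. un y - ui y) x - \<cc> (dv u x)" for x
  have Wc: "(\<lambda>x. \<cc> (dv ui x) + deriv \<cc> (dv ui x) * dv (\<lambda>y. un y - ui y) x) \<in> W" "(\<lambda>x. \<cc> (dv u x)) \<in> W"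
    "(\<lambda>x. Ls * dv (\<lambda>y. un y - ui y) x) \<in> W"
    by (intro W_intros prev un uq)+
  have Wb: "(\<lambda>x. \<bb> (po x) + deriv \<bb> (po x) * (pn x - po x) - \<bb> (p' x)) \<in> W" "(\<lambda>x. \<bb> (p x) - \<bb> (p' x)) \<in> W"
    by (intro W_intros prev qn uq)+
  have FW: "Fb \<in> W" "Fc \<in> W" unfolding Fb_def[abs_def] Fc_def[abs_def]
    by (intro W_intros prev un qn uq)+
  \<comment> \<open>The flow step uses the previous displacement, hence \<open>d'\<close> in this
    coupling term against \<open>d\<close> in the mechanics identity.\<close>
  have flow_id: "inn Fb r + \<tau> * inn (sq eq) (sq eq) + \<alpha> * inn d' r = 0"
  proof -
    have 1: "inn (\<lambda>x. \<bb> (po x) + deriv \<bb> (po x) * (pn x - po x) - \<bb> (p' x)) r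
        + \<tau> * inn (dv qn) r + \<alpha> * inn (dv (\<lambda>x. ui x - u' x)) r = \<tau> * inn Sf r"
      using flow rW(1) unfolding newton_flow_step_def by blast
    have 2: "inn (\<lambda>x. \<bb> (p x) - \<bb> (p' x)) r + \<alpha> * inn (dv (\<lambda>x. u x - u' x)) r + \<tau> * inn (dv q) r = \<tau> * inn Sf r"
      using uq(6) rW(1) unfolding mass_balance_eq_def by blast
    have 3: "inn (dv qn) r - inn (dv q) r = inn (sq eq) (sq eq)"
      using inn_dv_diff[OF Z_h_H_div[OF qn(1)] Z_h_H_div[OF uq(2)] W1]
        darcy_diff[OF qn(3) uq(5) qn(1) uq(2) qn(2) uq(3) eZ] by (simp add: eq_def r_def)
    have 4: "inn (dv (\<lambda>x. ui x - u' x)) r - inn (dv (\<lambda>x. u x - u' x)) r = inn d' r"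
      unfolding d'_def e'_def
      by (simp add: inn_dv_diff V_h_H_div prev uq(1) W1)
    have 5: "inn (\<lambda>x. \<bb> (po x) + deriv \<bb> (po x) * (pn x - po x) - \<bb> (p' x)) r
        - inn (\<lambda>x. \<bb> (p x) - \<bb> (p' x)) r = inn Fb r"
    proof -
      have "Fb = (\<lambda>x. (\<bb> (po x) + deriv \<bb> (po x) * (pn x - po x) - \<bb> (p' x)) - (\<bb> (p x) - \<bb> (p' x)))"
        by (simp add: Fb_def fun_eq_iff)
      then show ?thesis
        using l2_inner_diff_left[OF W_L2[OF Wb(1)] W_L2[OF Wb(2)] W1] by simp
    qed
    from 1 2 have "(inn (\<lambda>x. \<bb> (po x) + deriv \<bb> (po x) * (pn x - po x) - \<bb> (p' x)) r
        - inn (\<lambda>x. \<bb> (p x) - \<bb> (p' x)) r) + \<tau> * (inn (dv qn) r - inn (dv q) r)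
        + \<alpha> * (inn (dv (\<lambda>x. ui x - u' x)) r - inn (dv (\<lambda>x. u x - u' x)) r) = 0"
      by (simp add: right_diff_distrib)
    then show ?thesis by (simp only: 3 4 5)
  qed
  have mech_id: "inn (strain \<Omega> e) (strain \<Omega> e) + inn Fc d + inn (\<lambda>x. Ls * dv (\<lambda>y. un y - ui y) x) d - \<alpha> * inn r d = 0"
  proof -
    have 1: "inn (strain \<Omega> un) (strain \<Omega> e)
        + inn (\<lambda>x. \<cc> (dv ui x) + deriv \<cc> (dv ui x) * dv (\<lambda>y. un y - ui y) x) d
        + inn (\<lambda>x. Ls * dv (\<lambda>y. un y - ui y) x) d - \<alpha> * inn pn d = inn fb e"
      using mech eV(1) unfolding newton_mechanics_step_def d_def by blast
    have 2: "inn (strain \<Omega> u) (strain \<Omega> e) + inn (\<lambda>x. \<cc> (dv u x)) d - \<alpha> * inn p d = inn fb e"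
      using uq(4) eV(1) unfolding mechanics_eq_def d_def by blast
    have 3: "inn (strain \<Omega> un) (strain \<Omega> e) - inn (strain \<Omega> u) (strain \<Omega> e) = inn (strain \<Omega> e) (strain \<Omega> e)"
      by (rule inn_strain_diff[OF un uq(1) e_def[THEN meta_eq_to_obj_eq]])
    have 4: "inn Fc d = inn (\<lambda>x. \<cc> (dv ui x) + deriv \<cc> (dv ui x) * dv (\<lambda>y. un y - ui y) x) d - inn (\<lambda>x. \<cc> (dv u x)) d"
      unfolding Fc_def[abs_def] by (rule l2_inner_diff_left) (intro W_L2 Wc dW)+
    have 5: "inn r d = inn pn d - inn p d"
      unfolding r_def by (rule l2_inner_diff_left) (intro W_L2 qn uq dW)+
    have "\<alpha> * inn r d = \<alpha> * inn pn d - \<alpha> * inn p d" by (simp only: 5 right_diff_distrib)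
    with 1 2 3 4 show ?thesis by linarith
  qed
  have int: "integrable (lebesgue_on \<Omega>) (\<lambda>x. f x * g x)" if "f \<in> W" "g \<in> W" for f g
    using that by (intro L2_mult_integrable W_L2)
  \<comment> \<open>Collects all terms except strain and flux; by the two identities its integral is
    minus the sum of those two.\<close>
  define G where "G x = Fb x * r x + \<alpha> * (d' x * r x) + Fc x * d x
      + (Ls * dv (\<lambda>y. un y - ui y) x) * d x - \<alpha> * (r x * d x)" for x
  have GI: "integrable (lebesgue_on \<Omega>) G" "(LINT x|lebesgue_on \<Omega>. G x)
      = inn Fb r + \<alpha> * inn d' r + inn Fc d + inn (\<lambda>x. Ls * dv (\<lambda>y. un y - ui y) x) d - \<alpha> * inn r d"
    using int[OF FW(1) rW(1)] int[OF dW(2) rW(1)] int[OF FW(2) dW(1)] int[OF Wc(3) dW(1)] int[OF rW(1) dW(1)]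
    unfolding G_def[abs_def] l2_inner_def by simp_all
  define H where "H x = (\<alpha>\<^sub>b / 2 - \<eta>) * (r x * r x) + (\<alpha>\<^sub>c + Ls / 2 - \<eta>) * (d x * d x)
      - (Ls / 2 + \<eta>) * (d' x * d' x) - \<eta> * (r' x * r' x)" for x
  have HI: "integrable (lebesgue_on \<Omega>) H" "(LINT x|lebesgue_on \<Omega>. H x)
      = (\<alpha>\<^sub>b / 2 - \<eta>) * inn r r + (\<alpha>\<^sub>c + Ls / 2 - \<eta>) * inn d d - (Ls / 2 + \<eta>) * inn d' d' - \<eta> * inn r' r'"
    using int[OF rW(1) rW(1)] int[OF dW(1) dW(1)] int[OF dW(2) dW(2)] int[OF rW(2) rW(2)]
    unfolding H_def[abs_def] l2_inner_def by simp_all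
  have "(LINT x|lebesgue_on \<Omega>. H x) \<le> (LINT x|lebesgue_on \<Omega>. G x)"
  proof (rule integral_mono_AE[OF HI(1) GI(1)])
    show "AE x in lebesgue_on \<Omega>. H x \<le> G x"
      using ae_d ae_d' ae_dd M(1) M(2)[folded e'_def d'_def]
    proof eventually_elim
      case (elim x)
      have dd: "dv (\<lambda>y. un y - ui y) x = d x - d' x" using elim by simp
      have un_u: "dv un x = dv u x + d x" "dv ui x = dv u x + d' x" using elim by simp_all
      have b: "\<alpha>\<^sub>b * (r x)\<^sup>2 - L * (r' x)\<^sup>2 * \<bar>r x\<bar> \<le> Fb x * r x"
        using newton_remainder[OF b_deriv b_lip L_nonneg ab(2), where x = "po x" and y = "p x" and z = "pn x"]
        unfolding Fb_def r_def r'_def .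
      have c: "\<alpha>\<^sub>c * (d x)\<^sup>2 - L * (d' x)\<^sup>2 * \<bar>d x\<bar> \<le> Fc x * d x"
        using newton_remainder[OF c_deriv c_lip L_nonneg ac(2), where x = "dv ui x" and y = "dv u x" and z = "dv un x"]
        unfolding Fc_def dd un_u by (simp add: add.commute)
      have r': "\<bar>r' x\<bar> \<le> M" using elim(4) by (simp add: r'_def)
      show ?case
        using pointwise_energy_inequality[OF ab(1) stab(2) b c r' elim(5) L_nonneg M(3)]
        unfolding H_def G_def dd by (simp add: power2_eq_square algebra_simps)
    qed
  qed
  then show ?thesis
    using flow_id mech_id GI(2) HI(2) unfolding d_def[symmetric] d'_def[symmetric] by linarith
qed

text \<open>\<open>\<kappa>\<close> times the divergence weight is
  \<open>Ls / 2 + \<alpha>\<^sub>c / 4\<close>, the charge for the old divergence error with a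
  remainder coefficient of \<open>\<alpha>\<^sub>c / 4\<close>.\<close>

definition \<kappa> where "\<kappa> = (Ls + \<alpha>\<^sub>c / 2) / (Ls + \<alpha>\<^sub>c)"

lemma \<kappa>: "1 / 2 \<le> \<kappa>" "\<kappa> < 1"
  using ac stab by (auto simp: \<kappa>_def field_simps)

text \<open>\<open>\<alpha>\<^sub>b / 8\<close> is half the pressure weight and fits
  \<open>\<kappa>\<close> being at least 1/2; \<open>\<alpha>\<^sub>c / 4\<close> fits the
  divergence weight times \<open>\<kappa>\<close>.\<close>

definition \<eta> where "\<eta> = min (\<alpha>\<^sub>b / 8) (\<alpha>\<^sub>c / 4)"

lemma newton_contraction:
  assumes sol: "discrete_step \<Omega> \<T> \<bb> \<cc> k \<alpha> fb ff Sf \<tau> u' p' u q p"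
    and flow: "newton_flow_step \<Omega> \<T> \<bb> k \<alpha> ff Sf \<tau> u' p' ui po qn pn"
    and mech: "newton_mechanics_step \<Omega> \<T> \<cc> \<alpha> Ls fb ui un pn"
    and prev: "u' \<in> V" "p' \<in> W" "ui \<in> V" "po \<in> W" and \<tau>: "\<tau> \<ge> 0"
    and M: "AE x in lebesgue_on \<Omega>. \<bar>po x - p x\<bar> \<le> M" "AE x in lebesgue_on \<Omega>. \<bar>dv (\<lambda>x. ui x - u x) x\<bar> \<le> M"
      "L * M \<le> \<eta>"
  shows "energy \<tau> (\<lambda>x. un x - u x) (\<lambda>x. qn x - q x) (\<lambda>x. pn x - p x)
    \<le> \<kappa> * energy \<tau> (\<lambda>x. ui x - u x) (\<lambda>x. qi x - q x) (\<lambda>x. po x - p x)"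
proof -
  let ?e = "\<lambda>x. un x - u x" and ?eq = "\<lambda>x. qn x - q x" and ?r = "\<lambda>x. pn x - p x"
  let ?e' = "\<lambda>x. ui x - u x" and ?eq' = "\<lambda>x. qi x - q x" and ?r' = "\<lambda>x. po x - p x"
  have nn: "0 \<le> inn ?r ?r" "0 \<le> inn ?r' ?r'" "0 \<le> inn (dv ?e) (dv ?e)" "0 \<le> inn (dv ?e') (dv ?e')"
    "0 \<le> inn (strain \<Omega> ?e') (strain \<Omega> ?e')" "0 \<le> \<tau> * inn (sq ?eq') (sq ?eq')"
    using \<tau> by (simp_all add: l2_inner_self_nonneg)
  have \<eta>: "\<eta> \<le> \<alpha>\<^sub>b / 8" "\<eta> \<le> \<alpha>\<^sub>c / 4" by (simp_all add: \<eta>_def)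
  have "energy \<tau> ?e ?eq ?r \<le> inn (strain \<Omega> ?e) (strain \<Omega> ?e) + \<tau> * inn (sq ?eq) (sq ?eq)
      + (\<alpha>\<^sub>b / 2 - \<eta>) * inn ?r ?r + (\<alpha>\<^sub>c + Ls / 2 - \<eta>) * inn (dv ?e) (dv ?e)"
    unfolding energy_def using \<eta> nn ab(1) ac(1) by (intro add_mono mult_right_mono order_refl) auto
  also have "\<dots> \<le> (Ls / 2 + \<eta>) * inn (dv ?e') (dv ?e') + \<eta> * inn ?r' ?r'"
    by (rule newton_energy_inequality[OF sol flow mech prev M])
  also have "\<dots> \<le> \<kappa> * ((\<alpha>\<^sub>c / 2 + Ls / 2) * inn (dv ?e') (dv ?e')) + \<kappa> * (\<alpha>\<^sub>b / 4 * inn ?r' ?r')"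
  proof -
    have h1: "Ls / 2 + \<eta> \<le> \<kappa> * (\<alpha>\<^sub>c / 2 + Ls / 2)"
    proof -
      have "Ls + \<alpha>\<^sub>c \<noteq> 0" using ac(1) stab(1) by linarith
      then have "\<kappa> * (Ls + \<alpha>\<^sub>c) = Ls + \<alpha>\<^sub>c / 2" by (simp add: \<kappa>_def)
      then show ?thesis using \<eta>(2) by (simp add: algebra_simps)
    qed
    have h2: "\<eta> \<le> \<kappa> * (\<alpha>\<^sub>b / 4)"
    proof -
      have "1 / 2 * (\<alpha>\<^sub>b / 4) \<le> \<kappa> * (\<alpha>\<^sub>b / 4)"
        using ab(1) by (intro mult_right_mono[OF \<kappa>(1)]) simp
      then show ?thesis using \<eta>(1) by linarith
    qed
    show ?thesis
      using add_mono[OF mult_right_mono[OF h1 nn(4)] mult_right_mono[OF h2 nn(2)]] by (simp only: mult.assoc)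
  qed
  \<comment> \<open>The strain and flux parts of the previous energy are added here; they are
    nonnegative.\<close>
  also have "\<dots> \<le> \<kappa> * energy \<tau> ?e' ?eq' ?r'"
    using mult_left_mono[of _ _ \<kappa>] \<kappa>(1) nn(5,6) unfolding energy_def distrib_left[symmetric]
    by (intro mult_left_mono) auto
  finally show ?thesis .
qed

text \<open>Mass balance is already a difference in time, whereas mechanics and Darcy are subtracted
  at the two levels, so the previous state must satisfy both. With all unknowns at the new level the
  coupling terms cancel exactly.\<close>

lemma discrete_step_energy:
  assumes sol: "discrete_step \<Omega> \<T> \<bb> \<cc> k \<alpha> fb ff Sf \<tau> u' p' u q p"
    and prev: "u' \<in> V" "q' \<in> Z" "p' \<in> W" "mechanics_eq \<Omega> \<T> \<cc> \<alpha> fb u' p'" "darcy_eq \<Omega> \<T> k ff q' p'"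
    and \<tau>: "\<tau> \<ge> 0"
  defines "e \<equiv> \<lambda>x. u x - u' x" and "eq \<equiv> \<lambda>x. q x - q' x" and "r \<equiv> \<lambda>x. p x - p' x"
  shows "inn (strain \<Omega> e) (strain \<Omega> e) + \<alpha>\<^sub>c * inn (dv e) (dv e) + \<alpha>\<^sub>b / 2 * inn r r
      + \<tau> / 2 * inn (sq eq) (sq eq) + \<tau> / 2 * inn (sq q) (sq q)
    \<le> \<tau> / 2 * inn (sq q') (sq q') + \<tau>\<^sup>2 / (2 * \<alpha>\<^sub>b) * inn Sf Sf"
proof -
  have uq: "u \<in> V" "q \<in> Z" "p \<in> W" "mechanics_eq \<Omega> \<T> \<cc> \<alpha> fb u p" "darcy_eq \<Omega> \<T> k ff q p"
    "mass_balance_eq \<Omega> \<T> \<bb> \<alpha> Sf \<tau> u' p' u q p"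
    using sol by (auto simp: discrete_step_def)
  have eV: "e \<in> V" unfolding e_def by (intro V_h_diff uq prev)
  have rW: "r \<in> W" unfolding r_def by (intro W_h_diff uq prev)
  define d where "d = dv e"
  have dW: "d \<in> W" unfolding d_def by (intro weak_div_V_h eV)
  have ae_d: "AE x in lebesgue_on \<Omega>. d x = dv u x - dv u' x"
    unfolding d_def e_def by (intro dv_diff_V prev uq)
  have bW: "(\<lambda>x. \<bb> (p x) - \<bb> (p' x)) \<in> W" by (intro W_intros uq prev)
  have cW: "(\<lambda>x. \<cc> (dv u x)) \<in> W" "(\<lambda>x. \<cc> (dv u' x)) \<in> W" "(\<lambda>x. \<cc> (dv u x) - \<cc> (dv u' x)) \<in> W"
    by (intro W_intros uq prev)+
  have mass: "inn (\<lambda>x. \<bb> (p x) - \<bb> (p' x)) r + \<alpha> * inn d r + \<tau> * inn (dv q) r = \<tau> * inn Sf r"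
    using uq(6) rW unfolding mass_balance_eq_def d_def e_def by blast
  have mech: "inn (strain \<Omega> e) (strain \<Omega> e) + inn (\<lambda>x. \<cc> (dv u x) - \<cc> (dv u' x)) d - \<alpha> * inn r d = 0"
  proof -
    have 1: "inn (strain \<Omega> u) (strain \<Omega> e) + inn (\<lambda>x. \<cc> (dv u x)) d - \<alpha> * inn p d = inn fb e"
      using uq(4) eV unfolding mechanics_eq_def d_def by blast
    have 2: "inn (strain \<Omega> u') (strain \<Omega> e) + inn (\<lambda>x. \<cc> (dv u' x)) d - \<alpha> * inn p' d = inn fb e"
      using prev(4) eV unfolding mechanics_eq_def d_def by blast
    have 3: "inn (strain \<Omega> u) (strain \<Omega> e) - inn (strain \<Omega> u') (strain \<Omega> e) = inn (strain \<Omega> e) (strain \<Omega> e)"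
      by (rule inn_strain_diff[OF uq(1) prev(1) e_def[THEN meta_eq_to_obj_eq]])
    have 4: "inn (\<lambda>x. \<cc> (dv u x) - \<cc> (dv u' x)) d = inn (\<lambda>x. \<cc> (dv u x)) d - inn (\<lambda>x. \<cc> (dv u' x)) d"
      by (rule l2_inner_diff_left) (intro W_L2 cW dW)+
    have 5: "inn r d = inn p d - inn p' d"
      unfolding r_def by (rule l2_inner_diff_left) (intro W_L2 uq prev dW)+
    have "\<alpha> * inn r d = \<alpha> * inn p d - \<alpha> * inn p' d" by (simp only: 5 right_diff_distrib)
    with 1 2 3 4 show ?thesis by linarith
  qed
  have b: "\<alpha>\<^sub>b * inn r r \<le> inn (\<lambda>x. \<bb> (p x) - \<bb> (p' x)) r"
  proof -
    have "(LINT x|lebesgue_on \<Omega>. \<alpha>\<^sub>b * (r x * r x)) \<le> (LINT x|lebesgue_on \<Omega>. (\<bb> (p x) - \<bb> (p' x)) * r x)"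
    proof (rule integral_mono_AE)
      show "AE x in lebesgue_on \<Omega>. \<alpha>\<^sub>b * (r x * r x) \<le> (\<bb> (p x) - \<bb> (p' x)) * r x"
        using derivative_lower_bound_monotone[OF b_deriv ab(2)]
        by (intro AE_I2) (simp add: r_def power2_eq_square)
    qed (intro integrable_mult_right L2_mult_integrable W_L2 rW bW)+
    then show ?thesis by (simp add: l2_inner_def)
  qed
  have c: "\<alpha>\<^sub>c * inn d d \<le> inn (\<lambda>x. \<cc> (dv u x) - \<cc> (dv u' x)) d"
  proof -
    have "(LINT x|lebesgue_on \<Omega>. \<alpha>\<^sub>c * (d x * d x)) \<le> (LINT x|lebesgue_on \<Omega>. (\<cc> (dv u x) - \<cc> (dv u' x)) * d x)"
    proof (rule integral_mono_AE)
      show "AE x in lebesgue_on \<Omega>. \<alpha>\<^sub>c * (d x * d x) \<le> (\<cc> (dv u x) - \<cc> (dv u' x)) * d x"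
        using ae_d
      proof eventually_elim
        case (elim x)
        then show ?case using derivative_lower_bound_monotone[OF c_deriv ac(2), of "dv u x" "dv u' x"]
          by (simp add: power2_eq_square)
      qed
    qed (intro integrable_mult_right L2_mult_integrable W_L2 dW cW)+
    then show ?thesis by (simp add: l2_inner_def)
  qed
  have darcy: "inn (dv q) r = (inn (sq q) (sq q) - inn (sq q') (sq q') + inn (sq eq) (sq eq)) / 2"
  proof -
    have "inn (dv q) r = inn (sq eq) (sq q)"
      using darcy_diff[OF uq(5) prev(5) uq(2) prev(2) uq(3) prev(3) uq(2)] by (simp add: eq_def r_def)
    moreover have "inn (sq eq) (sq q) = inn (sq q) (sq q) - inn (sq q') (sq q)"
      "inn (sq eq) (sq eq) = inn (sq q) (sq q) - inn (sq q') (sq q) - (inn (sq q) (sq q') - inn (sq q') (sq q'))"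
      unfolding eq_def sq_diff
      by (simp_all add: l2_inner_diff_left l2_inner_diff_right L2_diff sq_Z_L2 uq(2) prev(2))
    ultimately show ?thesis by (simp add: l2_inner_commute[of _ "sq q'" "sq q"])
  qed
  \<comment> \<open>Young's inequality spends half of the \<open>\<alpha>\<^sub>b\<close> supplied
    by the monotonicity of \<open>\<bb>\<close>; the other half stays on the left.\<close>
  have S: "\<tau> * inn Sf r \<le> \<alpha>\<^sub>b / 2 * inn r r + \<tau>\<^sup>2 / (2 * \<alpha>\<^sub>b) * inn Sf Sf"
  proof -
    define s t where "s = l2_norm \<Omega> Sf" and "t = l2_norm \<Omega> r"
    have "\<tau> * inn Sf r \<le> \<tau> * (s * t)"
      using l2_Cauchy_Schwarz[OF Sf_L2 W_L2[OF rW]] \<tau> unfolding s_def t_def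
      by (intro mult_left_mono) auto
    also have "\<dots> \<le> \<alpha>\<^sub>b / 2 * t\<^sup>2 + \<tau>\<^sup>2 / (2 * \<alpha>\<^sub>b) * s\<^sup>2"
    proof -
      have "0 \<le> (\<alpha>\<^sub>b * t - \<tau> * s)\<^sup>2 / (2 * \<alpha>\<^sub>b)" using ab(1) by simp
      then show ?thesis using ab(1) by (simp add: field_simps power2_eq_square)
    qed
    finally show ?thesis by (simp add: s_def t_def l2_norm_square)
  qed
  have \<tau>darcy: "\<tau> * inn (dv q) r = \<tau> / 2 * inn (sq q) (sq q) - \<tau> / 2 * inn (sq q') (sq q') + \<tau> / 2 * inn (sq eq) (sq eq)"
    unfolding darcy by (simp add: field_simps)
  show ?thesis
    using mass mech b c S \<tau>darcy l2_inner_commute[of \<Omega> d r] unfolding d_def[symmetric] by simp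
qed

end

section \<open>The norm given by the energy, and convergence of the iteration\<close>

context biot
begin

text \<open>Packs the weighted parts of the energy into one function, so that the square root of the
  energy is an \<open>L2\<close> norm and inherits homogeneity and the triangle inequality.\<close>

definition embed :: "real \<Rightarrow> (real^'d \<Rightarrow> real^'d) \<Rightarrow> (real^'d \<Rightarrow> real^'d) \<Rightarrow> (real^'d \<Rightarrow> real)
    \<Rightarrow> real^'d \<Rightarrow> (real^'d^'d) \<times> (real^'d) \<times> real \<times> real" where
  "embed \<tau> u q p x = (strain \<Omega> u x, sqrt \<tau> *\<^sub>R sq q x, sqrt (\<alpha>\<^sub>b / 4) * p x, sqrt (\<alpha>\<^sub>c / 2 + Ls / 2) * dv u x)"

lemma embed_L2:
  assumes "u \<in> V" "q \<in> Z" "p \<in> W"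
  shows "embed \<tau> u q p \<in> L2 \<Omega>"
  unfolding embed_def[abs_def]
  by (intro L2_Pair L2_scaleR L2_cmult V_h_strain_L2 sq_Z_L2 W_L2 weak_div_V_h assms)

lemma norm_embed:
  assumes "\<tau> \<ge> 0" "u \<in> V" "q \<in> Z" "p \<in> W"
  shows "(l2_norm \<Omega> (embed \<tau> u q p))\<^sup>2 = energy \<tau> u q p"
proof -
  have s: "inn (\<lambda>x. sqrt a *\<^sub>R f x) (\<lambda>x. sqrt a *\<^sub>R f x) = a * inn f f" if "a \<ge> 0" for a and f :: "real^'d \<Rightarrow> 'c::euclidean_space"
    using that by (simp add: l2_inner_def flip: mult.assoc)
  have sr: "inn (\<lambda>x. sqrt a * f x) (\<lambda>x. sqrt a * f x) = a * inn f f" if "a \<ge> 0" for a and f :: "real^'d \<Rightarrow> real"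
    using s[OF that, of f] by simp
  have "(l2_norm \<Omega> (embed \<tau> u q p))\<^sup>2 = inn (strain \<Omega> u) (strain \<Omega> u)
      + (inn (\<lambda>x. sqrt \<tau> *\<^sub>R sq q x) (\<lambda>x. sqrt \<tau> *\<^sub>R sq q x)
      + (inn (\<lambda>x. sqrt (\<alpha>\<^sub>b / 4) * p x) (\<lambda>x. sqrt (\<alpha>\<^sub>b / 4) * p x)
      + inn (\<lambda>x. sqrt (\<alpha>\<^sub>c / 2 + Ls / 2) * dv u x) (\<lambda>x. sqrt (\<alpha>\<^sub>c / 2 + Ls / 2) * dv u x)))"
    unfolding l2_norm_square embed_def[abs_def]
    by (subst l2_inner_Pair, (intro L2_Pair L2_scaleR L2_cmult V_h_strain_L2 sq_Z_L2 W_L2 weak_div_V_h assms)+)+ simp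
  then show ?thesis
    using assms(1) ab(1) ac(1) stab(1) by (simp add: s sr energy_def)
qed

lemma embed_lincomb:
  assumes "u \<in> V" "u' \<in> V"
  shows "AE x in lebesgue_on \<Omega>. embed \<tau> (\<lambda>x. r *\<^sub>R u x + s *\<^sub>R u' x) (\<lambda>x. r *\<^sub>R q x + s *\<^sub>R q' x)
      (\<lambda>x. r * p x + s * p' x) x = r *\<^sub>R embed \<tau> u q p x + s *\<^sub>R embed \<tau> u' q' p' x"
  using strain_lincomb[OF open_\<Omega> bounded_\<Omega> V_h_H1[OF assms(1)] V_h_H1[OF assms(2)], of r s]
    weak_div_lincomb[OF open_\<Omega> bounded_\<Omega> V_h_H_div[OF assms(1)] V_h_H_div[OF assms(2)], of r s]
  by eventually_elim (simp add: embed_def sq_def algebra_simps)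

text \<open>\<open>embed\<close> is linear only almost everywhere, so its linearity is used under
  the norm.\<close>

lemma norm_embed_lincomb:
  assumes "u \<in> V" "q \<in> Z" "p \<in> W" "u' \<in> V" "q' \<in> Z" "p' \<in> W"
  shows "l2_norm \<Omega> (embed \<tau> (\<lambda>x. r *\<^sub>R u x + s *\<^sub>R u' x) (\<lambda>x. r *\<^sub>R q x + s *\<^sub>R q' x) (\<lambda>x. r * p x + s * p' x))
    = l2_norm \<Omega> (\<lambda>x. r *\<^sub>R embed \<tau> u q p x + s *\<^sub>R embed \<tau> u' q' p' x)"
  by (intro l2_norm_cong_AE embed_lincomb embed_L2 L2_lincomb V_h_lincomb Z_h_lincomb W_h_add W_h_cmult assms)

lemma norm_embed_scaleR:
  assumes "u \<in> V" "q \<in> Z" "p \<in> W"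
  shows "l2_norm \<Omega> (embed \<tau> (\<lambda>x. r *\<^sub>R u x) (\<lambda>x. r *\<^sub>R q x) (\<lambda>x. r * p x)) = \<bar>r\<bar> * l2_norm \<Omega> (embed \<tau> u q p)"
  using norm_embed_lincomb[OF assms assms, of \<tau> r 0] by (simp add: l2_norm_scaleR)

text \<open>The time step bounds new minus old, whereas the initial error of the iteration is old
  minus new.\<close>

lemma norm_embed_swap:
  assumes "u \<in> V" "q \<in> Z" "p \<in> W" "u' \<in> V" "q' \<in> Z" "p' \<in> W"
  shows "l2_norm \<Omega> (embed \<tau> (\<lambda>x. u' x - u x) (\<lambda>x. q' x - q x) (\<lambda>x. p' x - p x))
    = l2_norm \<Omega> (embed \<tau> (\<lambda>x. u x - u' x) (\<lambda>x. q x - q' x) (\<lambda>x. p x - p' x))"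
  using norm_embed_scaleR[OF V_h_diff[OF assms(1,4)] Z_h_diff[OF assms(2,5)] W_h_diff[OF assms(3,6)], of \<tau> "-1"]
  by simp

text \<open>For the direct implication the strain component gives u = 0 by Korn's argument, while q
  and p are recovered because their weights are positive.\<close>

lemma norm_embed_eq_0_iff:
  assumes "\<tau> > 0" "u \<in> V" "q \<in> Z" "p \<in> W"
  shows "l2_norm \<Omega> (embed \<tau> u q p) = 0 \<longleftrightarrow> (AE x in lebesgue_on \<Omega>. u x = 0) \<and>
    (AE x in lebesgue_on \<Omega>. q x = 0) \<and> (AE x in lebesgue_on \<Omega>. p x = 0)"
proof -
  have kpos: "AE x in lebesgue_on \<Omega>. k x > 0"
    using k(2,3) by (intro AE_I2) (force intro: less_le_trans)
  have "l2_norm \<Omega> (embed \<tau> u q p) = 0 \<longleftrightarrow> (AE x in lebesgue_on \<Omega>. embed \<tau> u q p x = 0)"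
    by (intro l2_norm_eq_0_iff embed_L2 assms)
  also have "\<dots> \<longleftrightarrow> (AE x in lebesgue_on \<Omega>. u x = 0) \<and> (AE x in lebesgue_on \<Omega>. q x = 0) \<and> (AE x in lebesgue_on \<Omega>. p x = 0)"
  proof
    assume 0: "AE x in lebesgue_on \<Omega>. embed \<tau> u q p x = 0"
    have "AE x in lebesgue_on \<Omega>. strain \<Omega> u x = 0"
      using 0 by eventually_elim (simp add: embed_def zero_prod_def)
    then have "AE x in lebesgue_on \<Omega>. u x = 0"
      by (intro strain_eq_0_imp_eq_0 open_\<Omega> bounded_\<Omega> V_h_H1_0 assms)
    moreover have "AE x in lebesgue_on \<Omega>. q x = 0"
      using 0 kpos by eventually_elim (use assms(1) in \<open>simp add: embed_def zero_prod_def sq_def\<close>)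
    moreover have "AE x in lebesgue_on \<Omega>. p x = 0"
      using 0 by eventually_elim (use ab(1) in \<open>simp add: embed_def zero_prod_def\<close>)
    ultimately show "(AE x in lebesgue_on \<Omega>. u x = 0) \<and> (AE x in lebesgue_on \<Omega>. q x = 0) \<and> (AE x in lebesgue_on \<Omega>. p x = 0)"
      by blast
  next
    assume 0: "(AE x in lebesgue_on \<Omega>. u x = 0) \<and> (AE x in lebesgue_on \<Omega>. q x = 0) \<and> (AE x in lebesgue_on \<Omega>. p x = 0)"
    have "AE x in lebesgue_on \<Omega>. strain \<Omega> u x = 0"
      using 0 by (intro strain_AE_0 open_\<Omega> bounded_\<Omega> V_h_H1 assms) auto
    moreover have "AE x in lebesgue_on \<Omega>. dv u x = 0"
      using 0 by (intro weak_div_AE_0 open_\<Omega> bounded_\<Omega> V_h_H_div assms) auto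
    moreover have "AE x in lebesgue_on \<Omega>. q x = 0" "AE x in lebesgue_on \<Omega>. p x = 0"
      using 0 by auto
    ultimately show "AE x in lebesgue_on \<Omega>. embed \<tau> u q p x = 0"
      by eventually_elim (simp add: embed_def zero_prod_def sq_def)
  qed
  finally show ?thesis .
qed

lemma norm_embed_norm:
  assumes "\<tau> > 0"
  shows "norm_on_discrete_space \<Omega> \<T> (\<lambda>u q p. l2_norm \<Omega> (embed \<tau> u q p))"
  unfolding norm_on_discrete_space_def
proof (intro ballI conjI allI)
  fix u q p assume uqp: "u \<in> V" "q \<in> Z" "p \<in> W"
  show "0 \<le> l2_norm \<Omega> (embed \<tau> u q p)" by (rule l2_norm_nonneg)
  show "(l2_norm \<Omega> (embed \<tau> u q p) = 0) = ((AE x in lebesgue_on \<Omega>. u x = 0) \<and>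
    (AE x in lebesgue_on \<Omega>. q x = 0) \<and> (AE x in lebesgue_on \<Omega>. p x = 0))"
    by (rule norm_embed_eq_0_iff[OF assms uqp])
  show "l2_norm \<Omega> (embed \<tau> (\<lambda>x. r *\<^sub>R u x) (\<lambda>x. r *\<^sub>R q x) (\<lambda>x. r * p x)) = \<bar>r\<bar> * l2_norm \<Omega> (embed \<tau> u q p)" for r
    by (rule norm_embed_scaleR[OF uqp])
  fix u' q' p' assume uqp': "u' \<in> V" "q' \<in> Z" "p' \<in> W"
  show "l2_norm \<Omega> (embed \<tau> (\<lambda>x. u x + u' x) (\<lambda>x. q x + q' x) (\<lambda>x. p x + p' x))
      \<le> l2_norm \<Omega> (embed \<tau> u q p) + l2_norm \<Omega> (embed \<tau> u' q' p')"
    using norm_embed_lincomb[OF uqp uqp', of \<tau> 1 1] l2_norm_triangle[OF embed_L2[OF uqp] embed_L2[OF uqp'], of \<tau> \<tau>]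
    by simp
qed

text \<open>One \<open>M\<close> and one \<open>\<mu>\<close> serve all step sizes, which is why
  \<open>\<tau>\<close> is quantified after them.\<close>

lemma small_energy_sup_bound:
  obtains M \<mu> where "\<mu> > 0" "L * M \<le> \<eta>"
    "\<And>\<tau> u q p. \<lbrakk>\<tau> \<ge> 0; u \<in> V; p \<in> W; energy \<tau> u q p \<le> \<mu>\<rbrakk>
      \<Longrightarrow> (AE x in lebesgue_on \<Omega>. \<bar>p x\<bar> \<le> M) \<and> (AE x in lebesgue_on \<Omega>. \<bar>dv u x\<bar> \<le> M)"
proof -
  obtain C where C: "C \<ge> 0" "\<And>w. w \<in> W \<Longrightarrow> AE x in lebesgue_on \<Omega>. \<bar>w x\<bar> \<le> C * l2_norm \<Omega> w"
    using W_h_sup_bound by blast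
  \<comment> \<open>The 1 added to \<open>L\<close> covers \<open>L = 0\<close>, and
    \<open>L * M\<close> is still at most \<open>\<eta>\<close>.\<close>
  define M where "M = \<eta> / (L + 1)"
  define a where "a = min (\<alpha>\<^sub>b / 4) (\<alpha>\<^sub>c / 2)"
  \<comment> \<open>Energy at most \<open>\<mu>\<close> bounds both \<open>L2\<close> norms by
    \<open>M / (C + 1)\<close>, which the inverse estimate turns into the sup bound
    \<open>M\<close>.\<close>
  define \<mu> where "\<mu> = a * (M / (C + 1))\<^sup>2"
  have \<eta>: "\<eta> > 0" using ab ac by (simp add: \<eta>_def)
  have M: "M > 0" using \<eta> L_nonneg by (simp add: M_def)
  have a: "a > 0" using ab ac by (simp add: a_def)
  have LM: "L * M \<le> \<eta>" using \<eta> L_nonneg by (simp add: M_def field_simps)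
  have \<mu>: "\<mu> > 0" using M a C(1) by (simp add: \<mu>_def)
  have sup: "AE x in lebesgue_on \<Omega>. \<bar>w x\<bar> \<le> M" if w: "w \<in> W" "b * inn w w \<le> \<mu>" "a \<le> b" for w b
  proof -
    have "a * inn w w \<le> a * (M / (C + 1))\<^sup>2"
      using mult_right_mono[OF w(3) l2_inner_self_nonneg[of \<Omega> w]] w(2) unfolding \<mu>_def by linarith
    then have "(l2_norm \<Omega> w)\<^sup>2 \<le> (M / (C + 1))\<^sup>2" using a by (simp add: l2_norm_square)
    then have "l2_norm \<Omega> w \<le> M / (C + 1)"
      by (rule power2_le_imp_le) (use M C(1) in simp)
    then have "C * l2_norm \<Omega> w \<le> C * (M / (C + 1))" using C(1) by (rule mult_left_mono)
    also have "\<dots> \<le> M" using M C(1) by (simp add: field_simps)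
    finally show ?thesis using C(2)[OF w(1)] by (auto elim: eventually_mono)
  qed
  show ?thesis
  proof (rule that[OF \<mu> LM])
    fix \<tau> u q p assume as: "\<tau> \<ge> 0" "u \<in> V" "p \<in> W" "energy \<tau> u q p \<le> \<mu>"
    show "(AE x in lebesgue_on \<Omega>. \<bar>p x\<bar> \<le> M) \<and> (AE x in lebesgue_on \<Omega>. \<bar>dv u x\<bar> \<le> M)"
    proof
      show "AE x in lebesgue_on \<Omega>. \<bar>p x\<bar> \<le> M"
        using energy_bounds(2)[OF as(1), of p u q] as by (intro sup[of p "\<alpha>\<^sub>b / 4"]) (auto simp: a_def)
      show "AE x in lebesgue_on \<Omega>. \<bar>dv u x\<bar> \<le> M"
        using energy_bounds(3)[OF as(1), of u q p] as
        by (intro sup[of "dv u" "\<alpha>\<^sub>c / 2"] weak_div_V_h) (auto simp: a_def)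
    qed
  qed
qed

text \<open>The factor \<open>\<tau>\<close> on the right makes the start of the iteration small:
  consecutive time levels are close in energy, uniformly in n and N.\<close>

lemma time_step_energy_bound:
  assumes \<tau>: "\<tau> = T / real N" "N \<ge> 1" "T > 0"
    and init: "U 0 \<in> V" "Q 0 \<in> Z" "P 0 \<in> W" "mechanics_eq \<Omega> \<T> \<cc> \<alpha> fb (U 0) (P 0)" "darcy_eq \<Omega> \<T> k ff (Q 0) (P 0)"
    and sol: "\<And>n. n \<in> {1..N} \<Longrightarrow> discrete_step \<Omega> \<T> \<bb> \<cc> k \<alpha> fb ff Sf \<tau> (U (n-1)) (P (n-1)) (U n) (Q n) (P n)"
    and n: "n \<in> {1..N}"
  shows "energy \<tau> (\<lambda>x. U n x - U (n-1) x) (\<lambda>x. Q n x - Q (n-1) x) (\<lambda>x. P n x - P (n-1) x)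
    \<le> (2 + Ls / \<alpha>\<^sub>c) * (inn (sq (Q 0)) (sq (Q 0)) + T * inn Sf Sf / \<alpha>\<^sub>b) * \<tau>"
proof -
  have \<tau>0: "\<tau> > 0" using \<tau> by simp
  have NT: "real N * \<tau> = T" using \<tau> by simp
  define S where "S = inn Sf Sf / \<alpha>\<^sub>b"
  have S0: "S \<ge> 0" using ab(1) by (simp add: S_def l2_inner_self_nonneg)
  have spaces: "U m \<in> V \<and> Q m \<in> Z \<and> P m \<in> W \<and> mechanics_eq \<Omega> \<T> \<cc> \<alpha> fb (U m) (P m) \<and> darcy_eq \<Omega> \<T> k ff (Q m) (P m)"
    if "m \<le> N" for m
    using init sol[of m] that by (cases "m = 0") (auto simp: discrete_step_def)
  have step: "inn (strain \<Omega> (\<lambda>x. U m x - U (m-1) x)) (strain \<Omega> (\<lambda>x. U m x - U (m-1) x))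
      + \<alpha>\<^sub>c * inn (dv (\<lambda>x. U m x - U (m-1) x)) (dv (\<lambda>x. U m x - U (m-1) x))
      + \<alpha>\<^sub>b / 2 * inn (\<lambda>x. P m x - P (m-1) x) (\<lambda>x. P m x - P (m-1) x)
      + \<tau> / 2 * inn (sq (\<lambda>x. Q m x - Q (m-1) x)) (sq (\<lambda>x. Q m x - Q (m-1) x))
      + \<tau> / 2 * inn (sq (Q m)) (sq (Q m))
    \<le> \<tau> / 2 * inn (sq (Q (m-1))) (sq (Q (m-1))) + \<tau> / 2 * (\<tau> * S)" if "m \<in> {1..N}" for m
  proof -
    have "m - 1 \<le> N" using that by (auto intro: order_trans[OF diff_le_self])
    moreover have "\<tau>\<^sup>2 / (2 * \<alpha>\<^sub>b) * inn Sf Sf = \<tau> / 2 * (\<tau> * S)" by (simp add: S_def power2_eq_square)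
    ultimately show ?thesis
      using discrete_step_energy[OF sol[OF that], of "Q (m-1)"] spaces[of "m-1"] \<tau>0 by simp
  qed
  \<comment> \<open>The flux norms telescope: each step adds at most \<open>\<tau> * S\<close>, so N
    steps add at most \<open>T * S\<close>.\<close>
  have flux: "inn (sq (Q m)) (sq (Q m)) \<le> inn (sq (Q 0)) (sq (Q 0)) + real m * (\<tau> * S)" if "m \<le> N" for m
    using that
  proof (induction m)
    case (Suc m)
    let ?u = "\<lambda>x. U (Suc m) x - U m x" and ?q = "\<lambda>x. Q (Suc m) x - Q m x" and ?p = "\<lambda>x. P (Suc m) x - P m x"
    have "0 \<le> inn (strain \<Omega> ?u) (strain \<Omega> ?u)" "0 \<le> \<alpha>\<^sub>c * inn (dv ?u) (dv ?u)" "0 \<le> \<alpha>\<^sub>b / 2 * inn ?p ?p"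
      "0 \<le> \<tau> / 2 * inn (sq ?q) (sq ?q)"
      using ac(1) ab(1) \<tau>0 by (simp_all add: l2_inner_self_nonneg)
    then have "\<tau> / 2 * inn (sq (Q (Suc m))) (sq (Q (Suc m))) \<le> \<tau> / 2 * (inn (sq (Q m)) (sq (Q m)) + \<tau> * S)"
      using step[of "Suc m"] Suc.prems by (simp add: distrib_left)
    then have "inn (sq (Q (Suc m))) (sq (Q (Suc m))) \<le> inn (sq (Q m)) (sq (Q m)) + \<tau> * S"
      using \<tau>0 by (simp add: mult_le_cancel_left_pos del: times_divide_eq_left)
    then show ?case using Suc by (simp add: distrib_right)
  qed simp
  let ?u = "\<lambda>x. U n x - U (n-1) x" and ?q = "\<lambda>x. Q n x - Q (n-1) x" and ?p = "\<lambda>x. P n x - P (n-1) x"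
  define X where "X = inn (strain \<Omega> ?u) (strain \<Omega> ?u) + \<alpha>\<^sub>c * inn (dv ?u) (dv ?u) + \<alpha>\<^sub>b / 2 * inn ?p ?p
      + \<tau> / 2 * inn (sq ?q) (sq ?q)"
  \<comment> \<open>Chosen so that \<open>c\<close> times \<open>X\<close> dominates every energy
    weight: the 2 compensates the \<open>\<tau> / 2\<close> in front of the flux, and
    \<open>Ls / \<alpha>\<^sub>c\<close> covers the stabilization in the divergence weight.\<close>
  define c where "c = 2 + Ls / \<alpha>\<^sub>c"
  have c: "c \<ge> 2" using ac(1) stab(1) by (simp add: c_def)
  have "0 \<le> \<tau> / 2 * inn (sq (Q n)) (sq (Q n))"
    using \<tau>0 by (simp add: l2_inner_self_nonneg)
  then have "X \<le> \<tau> / 2 * (inn (sq (Q (n-1))) (sq (Q (n-1))) + \<tau> * S)"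
    using step[OF n] unfolding X_def distrib_left by linarith
  \<comment> \<open>The inner factor 2 is slack that cancels the 1/2; the single
    \<open>\<tau> * S\<close> completes the n - 1 steps before to n.\<close>
  also have "\<dots> \<le> \<tau> / 2 * (2 * (inn (sq (Q 0)) (sq (Q 0)) + T * S))"
  proof (rule mult_left_mono)
    have "real (n - 1) * (\<tau> * S) + \<tau> * S = real n * (\<tau> * S)" using n by (cases n) (auto simp: distrib_right)
    also have "\<dots> \<le> real N * (\<tau> * S)" using n \<tau>0 S0 by (intro mult_right_mono) auto
    also have "\<dots> = T * S" using NT by (simp flip: mult.assoc)
    finally have "real (n - 1) * (\<tau> * S) + \<tau> * S \<le> T * S" .
    moreover have "0 \<le> inn (sq (Q 0)) (sq (Q 0))" "0 \<le> T * S"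
      using S0 \<tau>(3) by (simp_all add: l2_inner_self_nonneg)
    ultimately show "inn (sq (Q (n-1))) (sq (Q (n-1))) + \<tau> * S \<le> 2 * (inn (sq (Q 0)) (sq (Q 0)) + T * S)"
      using flux[of "n - 1"] order_trans[OF diff_le_self, of n N 1] n by simp
  qed (use \<tau>0 in simp)
  finally have X: "X \<le> (inn (sq (Q 0)) (sq (Q 0)) + T * S) * \<tau>" by (simp add: algebra_simps)
  have "energy \<tau> ?u ?q ?p \<le> c * inn (strain \<Omega> ?u) (strain \<Omega> ?u) + c * (\<tau> / 2) * inn (sq ?q) (sq ?q)
      + c * (\<alpha>\<^sub>b / 2) * inn ?p ?p + c * \<alpha>\<^sub>c * inn (dv ?u) (dv ?u)"
    unfolding energy_def
  proof (intro add_mono mult_right_mono l2_inner_self_nonneg)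
    show "inn (strain \<Omega> ?u) (strain \<Omega> ?u) \<le> c * inn (strain \<Omega> ?u) (strain \<Omega> ?u)"
      using mult_right_mono[of 1 c "inn (strain \<Omega> ?u) (strain \<Omega> ?u)"] c by (simp add: l2_inner_self_nonneg)
    show "\<tau> \<le> c * (\<tau> / 2)" using mult_right_mono[OF c, of "\<tau> / 2"] \<tau>0 by simp
    show "\<alpha>\<^sub>b / 4 \<le> c * (\<alpha>\<^sub>b / 2)" using mult_right_mono[OF c, of "\<alpha>\<^sub>b / 2"] ab(1) by simp
    show "\<alpha>\<^sub>c / 2 + Ls / 2 \<le> c * \<alpha>\<^sub>c" using ac(1) stab(1) by (simp add: c_def distrib_right)
  qed
  also have "\<dots> = c * X" by (simp add: X_def algebra_simps)
  also have "\<dots> \<le> c * ((inn (sq (Q 0)) (sq (Q 0)) + T * S) * \<tau>)"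
    using X c by (intro mult_left_mono) auto
  finally show ?thesis by (simp add: c_def S_def mult.assoc)
qed

text \<open>Contraction asks for small sup norms, which follow from small energy. Since contraction
  does not increase the energy, the smallness of the initial error persists for all i.\<close>

lemma splitting_converges_linearly:
  assumes \<tau>: "\<tau> > 0" and prev: "u' \<in> V" "q' \<in> Z" "p' \<in> W"
    and sol: "discrete_step \<Omega> \<T> \<bb> \<cc> k \<alpha> fb ff Sf \<tau> u' p' u q p"
    and it: "splitting_newton_iterates \<Omega> \<T> \<bb> \<cc> k \<alpha> Ls fb ff Sf \<tau> u' q' p' uit qit pit"
    and small: "energy \<tau> (\<lambda>x. u' x - u x) (\<lambda>x. q' x - q x) (\<lambda>x. p' x - p x) \<le> \<mu>" and LM: "L * M \<le> \<eta>"
    and sup: "\<And>u q p. \<lbrakk>u \<in> V; p \<in> W; energy \<tau> u q p \<le> \<mu>\<rbrakk>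
      \<Longrightarrow> (AE x in lebesgue_on \<Omega>. \<bar>p x\<bar> \<le> M) \<and> (AE x in lebesgue_on \<Omega>. \<bar>dv u x\<bar> \<le> M)"
  shows "converges_linearly \<Omega> \<T> uit qit pit u q p"
proof -
  have uqp: "u \<in> V" "q \<in> Z" "p \<in> W" using sol by (auto simp: discrete_step_def)
  define E where "E i = energy \<tau> (\<lambda>x. uit i x - u x) (\<lambda>x. qit i x - q x) (\<lambda>x. pit i x - p x)" for i
  have it0: "uit 0 = u'" "qit 0 = q'" "pit 0 = p'" using it by (auto simp: splitting_newton_iterates_def)
  have flow: "newton_flow_step \<Omega> \<T> \<bb> k \<alpha> ff Sf \<tau> u' p' (uit i) (pit i) (qit (Suc i)) (pit (Suc i))"
    and mech: "newton_mechanics_step \<Omega> \<T> \<cc> \<alpha> Ls fb (uit i) (uit (Suc i)) (pit (Suc i))" for i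
  proof -
    have "Suc i \<ge> 1" by simp
    with it have "newton_flow_step \<Omega> \<T> \<bb> k \<alpha> ff Sf \<tau> u' p' (uit (Suc i - 1)) (pit (Suc i - 1)) (qit (Suc i)) (pit (Suc i))
      \<and> newton_mechanics_step \<Omega> \<T> \<cc> \<alpha> Ls fb (uit (Suc i - 1)) (uit (Suc i)) (pit (Suc i))"
      unfolding splitting_newton_iterates_def by blast
    then show "newton_flow_step \<Omega> \<T> \<bb> k \<alpha> ff Sf \<tau> u' p' (uit i) (pit i) (qit (Suc i)) (pit (Suc i))"
      "newton_mechanics_step \<Omega> \<T> \<cc> \<alpha> Ls fb (uit i) (uit (Suc i)) (pit (Suc i))"
      by simp_all
  qed
  have spaces: "uit i \<in> V" "qit i \<in> Z" "pit i \<in> W" for i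
  proof (atomize(full), cases i)
    case 0
    then show "uit i \<in> V \<and> qit i \<in> Z \<and> pit i \<in> W" using it0 prev by simp
  next
    case (Suc j)
    then show "uit i \<in> V \<and> qit i \<in> Z \<and> pit i \<in> W"
      using flow[of j] mech[of j] by (auto simp: newton_flow_step_def newton_mechanics_step_def)
  qed
  have contr: "E (Suc i) \<le> \<kappa> * E i" if "E i \<le> \<mu>" for i
  proof -
    have "(AE x in lebesgue_on \<Omega>. \<bar>pit i x - p x\<bar> \<le> M) \<and> (AE x in lebesgue_on \<Omega>. \<bar>dv (\<lambda>x. uit i x - u x) x\<bar> \<le> M)"
      using that unfolding E_def by (intro sup V_h_diff W_h_diff spaces uqp)
    then show ?thesis
      unfolding E_def
      using newton_contraction[OF sol flow mech prev(1,3) spaces(1,3) less_imp_le[OF \<tau>] _ _ LM] by blast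
  qed
  have E0: "0 \<le> E i" for i unfolding E_def using \<tau> by (intro energy_bounds) simp
  have small_all: "E i \<le> \<mu>" for i
  proof (induction i)
    case 0
    then show ?case using small by (simp add: E_def it0)
  next
    case (Suc i)
    have "E (Suc i) \<le> \<kappa> * E i" by (rule contr[OF Suc])
    also have "\<dots> \<le> 1 * E i" using \<kappa>(2) E0[of i] by (intro mult_right_mono) auto
    finally show ?case using Suc by simp
  qed
  define Nrm where "Nrm u q p = l2_norm \<Omega> (embed \<tau> u q p)" for u q p
  have Nrm_E: "Nrm (\<lambda>x. uit i x - u x) (\<lambda>x. qit i x - q x) (\<lambda>x. pit i x - p x) = sqrt (E i)" for i
    unfolding Nrm_def E_def
    using norm_embed[OF less_imp_le[OF \<tau>] V_h_diff[OF spaces(1) uqp(1)] Z_h_diff[OF spaces(2) uqp(2)]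
        W_h_diff[OF spaces(3) uqp(3)], of i i i]
    by (intro real_sqrt_unique[symmetric]) (simp_all add: l2_norm_nonneg)
  \<comment> \<open>The norm is the square root of the energy, so the rate is
    \<open>sqrt \<kappa>\<close>.\<close>
  have "Nrm (\<lambda>x. uit i x - u x) (\<lambda>x. qit i x - q x) (\<lambda>x. pit i x - p x)
      \<le> sqrt \<kappa> * Nrm (\<lambda>x. uit (i-1) x - u x) (\<lambda>x. qit (i-1) x - q x) (\<lambda>x. pit (i-1) x - p x)" if "i \<ge> 1" for i
    using contr[OF small_all, of "i - 1"] that unfolding Nrm_E by (simp flip: real_sqrt_mult)
  moreover have "0 < sqrt \<kappa>" "sqrt \<kappa> < 1" using \<kappa> by simp_all
  moreover have "norm_on_discrete_space \<Omega> \<T> Nrm"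
    unfolding Nrm_def by (rule norm_embed_norm[OF \<tau>])
  ultimately show ?thesis
    unfolding converges_linearly_def by blast
qed

end

theorem theorem2:
  fixes \<Omega> :: "(real^'d) set" and \<T> :: "(real^'d) set set"
    and \<bb> \<cc> :: "real \<Rightarrow> real" and k :: "real^'d \<Rightarrow> real"
    and \<alpha> \<alpha>\<^sub>b \<alpha>\<^sub>c k\<^sub>m k\<^sub>M Ls T :: real
    and fb ff :: "real^'d \<Rightarrow> real^'d" and Sf :: "real^'d \<Rightarrow> real"
    and u0 q0 :: "real^'d \<Rightarrow> real^'d" and p0 :: "real^'d \<Rightarrow> real"
  assumes dim: "CARD('d) = 2 \<or> CARD('d) = 3"
    and domain: "open \<Omega>" "connected \<Omega>" "\<Omega> \<noteq> {}" "bounded \<Omega>"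
    and mesh: "simplicial_mesh \<Omega> \<T>"
    and A1: "\<forall>\<xi>. \<cc> differentiable at \<xi>" "\<forall>\<xi>. \<bb> differentiable at \<xi>"
      "\<exists>L. L-lipschitz_on UNIV (deriv \<cc>)" "\<exists>L. L-lipschitz_on UNIV (deriv \<bb>)"
    and A2: "\<alpha>\<^sub>c > 0" "\<forall>\<xi>. deriv \<cc> \<xi> > \<alpha>\<^sub>c"
    and A3: "\<alpha>\<^sub>b > 0" "\<forall>\<xi>. deriv \<bb> \<xi> > \<alpha>\<^sub>b"
    and A4: "k \<in> borel_measurable (lebesgue_on \<Omega>)" "k\<^sub>m > 0" "\<forall>x\<in>\<Omega>. k\<^sub>m \<le> k x \<and> k x \<le> k\<^sub>M"
    and data: "fb \<in> L2 \<Omega>" "ff \<in> L2 \<Omega>" "Sf \<in> L2 \<Omega>" "T > 0"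
    and initial: "u0 \<in> V_h \<Omega> \<T>" "q0 \<in> Z_h \<Omega> \<T>" "p0 \<in> W_h \<Omega> \<T>"
      "mechanics_eq \<Omega> \<T> \<cc> \<alpha> fb u0 p0" "darcy_eq \<Omega> \<T> k ff q0 p0"
    and stabilization: "Ls \<ge> 0" "Ls \<ge> \<alpha>\<^sup>2 / \<alpha>\<^sub>b"
  shows "\<exists>\<tau>0>0. \<forall>(N::nat) \<tau> U Q P.
           N \<ge> 1 \<and> \<tau> = T / real N \<and> \<tau> \<le> \<tau>0 \<and>
           U 0 = u0 \<and> Q 0 = q0 \<and> P 0 = p0 \<and>
           (\<forall>n\<in>{1..N}. discrete_step \<Omega> \<T> \<bb> \<cc> k \<alpha> fb ff Sf \<tau>
                          (U (n-1)) (P (n-1)) (U n) (Q n) (P n)) \<longrightarrow>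
           (\<forall>n\<in>{1..N}. \<forall>uit qit pit.
              splitting_newton_iterates \<Omega> \<T> \<bb> \<cc> k \<alpha> Ls fb ff Sf \<tau>
                (U (n-1)) (Q (n-1)) (P (n-1)) uit qit pit \<longrightarrow>
              converges_linearly \<Omega> \<T> uit qit pit (U n) (Q n) (P n))"
proof -
  obtain Lc Lb where Lc: "Lc-lipschitz_on UNIV (deriv \<cc>)" and Lb: "Lb-lipschitz_on UNIV (deriv \<bb>)"
    using A1(3,4) by blast
  \<comment> \<open>One constant for both derivatives, since the pointwise estimate treats both
    remainders alike.\<close>
  define L where "L = max Lc Lb"
  have lip: "L-lipschitz_on UNIV (deriv \<cc>)" "L-lipschitz_on UNIV (deriv \<bb>)"
    using lipschitz_on_le[OF Lc, of L] lipschitz_on_le[OF Lb, of L] by (auto simp: L_def)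
  interpret biot \<Omega> \<T> \<bb> \<cc> k \<alpha> \<alpha>\<^sub>b \<alpha>\<^sub>c k\<^sub>m Ls L fb ff Sf
  proof unfold_locales
    show "(\<bb> has_real_derivative deriv \<bb> t) (at t)" "(\<cc> has_real_derivative deriv \<cc> t) (at t)" for t
      using A1(1,2) by (auto simp: DERIV_deriv_iff_real_differentiable)
    show "\<bar>deriv \<bb> s - deriv \<bb> t\<bar> \<le> L * \<bar>s - t\<bar>" "\<bar>deriv \<cc> s - deriv \<cc> t\<bar> \<le> L * \<bar>s - t\<bar>" for s t
      using lipschitz_onD[OF lip(1), of s t] lipschitz_onD[OF lip(2), of s t] by (simp_all add: dist_real_def)
    show "0 \<le> L" using lip(1) by (rule lipschitz_on_nonneg)
  qed (use domain mesh A2 A3 A4 data stabilization in \<open>auto simp: less_imp_le\<close>)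
  obtain M \<mu> where \<mu>: "\<mu> > 0" "L * M \<le> \<eta>"
    "\<And>\<tau> u q p. \<lbrakk>\<tau> \<ge> 0; u \<in> V; p \<in> W; energy \<tau> u q p \<le> \<mu>\<rbrakk>
      \<Longrightarrow> (AE x in lebesgue_on \<Omega>. \<bar>p x\<bar> \<le> M) \<and> (AE x in lebesgue_on \<Omega>. \<bar>dv u x\<bar> \<le> M)"
    by (rule small_energy_sup_bound) (rule that)
  \<comment> \<open>Built from the data and the initial flux, hence the same for all n and
    N.\<close>
  define C where "C = (2 + Ls / \<alpha>\<^sub>c) * (inn (sq q0) (sq q0) + T * inn Sf Sf / \<alpha>\<^sub>b)"
  have C: "C \<ge> 0" unfolding C_def using ac(1) ab(1) stab(1) data(4)
    by (intro mult_nonneg_nonneg add_nonneg_nonneg divide_nonneg_nonneg l2_inner_self_nonneg) auto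
  \<comment> \<open>The 1 keeps the denominator positive when C = 0, and \<open>C * \<tau>0\<close>
    is at most \<open>\<mu>\<close>. The mesh enters through \<open>\<mu>\<close>.\<close>
  define \<tau>0 where "\<tau>0 = \<mu> / (C + 1)"
  have "\<tau>0 > 0" using \<mu>(1) C by (simp add: \<tau>0_def)
  moreover have "converges_linearly \<Omega> \<T> uit qit pit (U n) (Q n) (P n)"
    if N: "N \<ge> 1" "\<tau> = T / real N" "\<tau> \<le> \<tau>0" and init: "U 0 = u0" "Q 0 = q0" "P 0 = p0"
      and sol: "\<And>n. n \<in> {1..N} \<Longrightarrow> discrete_step \<Omega> \<T> \<bb> \<cc> k \<alpha> fb ff Sf \<tau> (U (n-1)) (P (n-1)) (U n) (Q n) (P n)"
      and n: "n \<in> {1..N}"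
      and it: "splitting_newton_iterates \<Omega> \<T> \<bb> \<cc> k \<alpha> Ls fb ff Sf \<tau> (U (n-1)) (Q (n-1)) (P (n-1)) uit qit pit"
    for N :: nat and \<tau> U Q P n uit qit pit
  proof -
    have \<tau>: "\<tau> > 0" using N data(4) by simp
    have spaces: "U m \<in> V \<and> Q m \<in> Z \<and> P m \<in> W" if "m \<le> N" for m
      using init initial sol[of m] that by (cases "m = 0") (auto simp: discrete_step_def)
    have S: "U n \<in> V" "Q n \<in> Z" "P n \<in> W" "U (n-1) \<in> V" "Q (n-1) \<in> Z" "P (n-1) \<in> W"
      using spaces[of n] spaces[of "n-1"] n by auto
    let ?E = "energy \<tau> (\<lambda>x. U n x - U (n-1) x) (\<lambda>x. Q n x - Q (n-1) x) (\<lambda>x. P n x - P (n-1) x)"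
    have "?E \<le> C * \<tau>"
      using time_step_energy_bound[where U = U and Q = Q and P = P, OF N(2,1) data(4) _ _ _ _ _ sol n] initial
      unfolding init C_def by simp
    also have "\<dots> \<le> C * \<tau>0" using N(3) C by (rule mult_left_mono)
    also have "\<dots> \<le> \<mu>" using \<mu>(1) C by (simp add: \<tau>0_def field_simps)
    finally have E: "?E \<le> \<mu>" .
    \<comment> \<open>The initial guess is the previous time level, so the initial error is the
      negative of the time increment.\<close>
    have "energy \<tau> (\<lambda>x. U (n-1) x - U n x) (\<lambda>x. Q (n-1) x - Q n x) (\<lambda>x. P (n-1) x - P n x) = ?E"
      using norm_embed_swap[OF S, of \<tau>]
        norm_embed[OF less_imp_le[OF \<tau>] V_h_diff[OF S(1,4)] Z_h_diff[OF S(2,5)] W_h_diff[OF S(3,6)]]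
        norm_embed[OF less_imp_le[OF \<tau>] V_h_diff[OF S(4,1)] Z_h_diff[OF S(5,2)] W_h_diff[OF S(6,3)]]
      by simp
    with E show ?thesis
      using \<mu>(3)[OF less_imp_le[OF \<tau>]]
      by (intro splitting_converges_linearly[OF \<tau> S(4-6) sol[OF n] it _ \<mu>(2)]) auto
  qed
  ultimately show ?thesis by blast
qed

end
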